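(* Let $n\ge1$ and $p>n$. There exist constants $B=B(n,p)\ge1$ and $C=C(n,p)>0$ such that for every bounded domain $\Omega\subset\mathbb{R}^n$ containing the origin and all $u\in C_c^\infty(\Omega\setminus\{0\})$ $$\sup_{x,y\in\Omega,\; x\ne y}\left\{\frac{|u(x)-u(y)|}{|x-y|^{1-n/p}}X^{1/p}\Big(\frac{|x-y|}{D}\Big)\right\}\le C\left(\int_\Omega|\nabla u|^pdx-\Big(\frac{p-n}{p}\Big)^p\int_\Omega\frac{|u|^p}{|x|^p}dx\right)^{1/p},$$ where $D=B\operatorname{diam}(\Omega)$. Moreover, the weight function $X^{1/p}$ is optimal in the sense that the power $1/p$ cannot be decreased: for every $q<1/p$ there are no constants $B\ge1$, $C>0$ such that the inequality with $X^{1/p}$ replaced by $X^{q}$ holds for all $u\in C_c^\infty(\Omega\setminus\{0\})$.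
   Context: A domain is an open connected subset of $\mathbb{R}^n$. $X(t):=(1-\log t)^{-1}$ for $t\in(0,1]$, and $X^{q}(t)=(X(t))^{q}$. *)

theory Defs
  imports "HOL-Analysis.Analysis"
begin

definition bounded_domain :: "(real ^ 'n) set \<Rightarrow> bool" where
  "bounded_domain \<Omega> \<longleftrightarrow> open \<Omega> \<and> connected \<Omega> \<and> bounded \<Omega>"

definition grad :: "(real ^ 'n \<Rightarrow> real) \<Rightarrow> real ^ 'n \<Rightarrow> real ^ 'n" where
  "grad u x = (\<chi> i. frechet_derivative u (at x) (axis i 1))"

text \<open>\<open>Ck k u\<close>: the function is \<open>k\<close> times continuously differentiable on the whole space.\<close>

primrec Ck :: "nat \<Rightarrow> (real ^ 'n \<Rightarrow> real) \<Rightarrow> bool" where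
  "Ck 0 u \<longleftrightarrow> continuous_on UNIV u"
| "Ck (Suc k) u \<longleftrightarrow>
     (\<forall>x. u differentiable (at x)) \<and> (\<forall>i. Ck k (\<lambda>x. grad u x $ i))"

text \<open>The space \<open>C\<^sub>c\<^sup>\<infinity>(U)\<close>. Its elements are represented by their extensions by zero, which are
  smooth on the whole space because the support is a compact subset of \<open>U\<close>.\<close>

definition test_functions :: "(real ^ 'n) set \<Rightarrow> (real ^ 'n \<Rightarrow> real) set" where
  "test_functions U =
     {u. (\<forall>k. Ck k u) \<and> compact (closure {x. u x \<noteq> 0}) \<and> closure {x. u x \<noteq> 0} \<subseteq> U}"

text \<open>The logarithmic weight; it is only used for arguments in \<open>(0, 1]\<close>.\<close>

definition X :: "real \<Rightarrow> real" where
  "X t = inverse (1 - ln t)"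

text \<open>The supremum is taken in the extended reals, so that it is \<open>\<infinity>\<close> (rather than unspecified)
  when the quotients are unbounded.\<close>

definition weighted_holder_sup ::
    "real \<Rightarrow> real \<Rightarrow> real \<Rightarrow> (real ^ 'n) set \<Rightarrow> (real ^ 'n \<Rightarrow> real) \<Rightarrow> ereal" where
  "weighted_holder_sup p q D \<Omega> u =
     (SUP (x, y) \<in> {(x, y). x \<in> \<Omega> \<and> y \<in> \<Omega> \<and> x \<noteq> y}.
        ereal (\<bar>u x - u y\<bar> / norm (x - y) powr (1 - real CARD('n) / p)
               * X (norm (x - y) / D) powr q))"

definition hardy_difference :: "real \<Rightarrow> (real ^ 'n) set \<Rightarrow> (real ^ 'n \<Rightarrow> real) \<Rightarrow> real" where
  "hardy_difference p \<Omega> u =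
     (LINT x:\<Omega>|lborel. norm (grad u x) powr p)
     - ((p - real CARD('n)) / p) powr p
       * (LINT x:\<Omega>|lborel. \<bar>u x\<bar> powr p / norm x powr p)"

definition hardy_morrey_ineq ::
    "real \<Rightarrow> real \<Rightarrow> real \<Rightarrow> real \<Rightarrow> (real ^ 'n) set \<Rightarrow> (real ^ 'n \<Rightarrow> real) \<Rightarrow> bool" where
  "hardy_morrey_ineq p q B C \<Omega> u \<longleftrightarrow>
     weighted_holder_sup p q (B * diameter \<Omega>) \<Omega> u
       \<le> ereal (C * hardy_difference p \<Omega> u powr (1 / p))"

end

theory Submission
  imports Defs
begin

text \<open>Every field \<open>T = \<phi>(|x|) x / |x|\<^sup>p\<close> yields a Hardy inequality: the tangent line of \<open>|\<xi>|\<^sup>p\<close> bounds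
  \<open>|\<nabla>u|\<^sup>p\<close> from below by \<open>T \<bullet> \<nabla>|u|\<^sup>p\<close> minus a multiple of \<open>|u|\<^sup>p / |x|\<^sup>p\<close>, and the first term is integrated
  by parts. The choice \<open>\<phi> = 1\<close> is the sharp Hardy inequality. Bending \<open>\<phi>\<close> down by \<open>\<kappa> / (1 + log (d / |x|))\<close>
  outside the radius \<open>r\<close> leaves a remainder on the annulus \<open>|x| \<approx> r\<close>, so \<open>|u|\<^sup>p / |x|\<^sup>p\<close> and
  \<open>|\<nabla>u|\<^sup>p\<close> integrate there to at most \<open>(1 + log (d / r))\<close> times the Hardy difference. Morrey's
  estimate on balls \<open>B(x, |x| / 2)\<close> turns this into the pointwise and Hoelder bounds. The power
  \<open>1 / p\<close> is optimal because \<open>|x|\<^sup>1\<^sup>-\<^sup>n\<^sup>/\<^sup>p\<close>, cut off smoothly on the scale \<open>M\<close> in the variable \<open>log |x|\<close>, has a Hardy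
  difference of order \<open>1 / M\<close>; the Hoelder quotient is tested between the origin and a point where the
  cutoff is not small.\<close>

section \<open>Elementary inequalities and integration by parts along dilations\<close>

text \<open>The bend alone would not give the power 1/p. With l = 1 + log (d / |x|) and \<phi> = 1 -
  \<kappa> / l, the gain is the derivative of \<kappa> / l along the dilations. It is only of order
  1 / l^2 and would end in the power 2/p of the logarithm. Switching the bend on by a factor \<eta>
  that rises from 0 to 1 around |x| = r adds the gain 2 \<kappa> \<eta> (1 - \<eta>) / l, which is
  of order 1 / l where |x| is comparable to r. The term of order 1 / l^2 is still needed: it pays
  for the loss, quadratic in the bend, that comes from leaving \<phi> = 1. The price is a field that
  depends on r, so every annulus is estimated separately by the whole Hardy difference. For
  pointwise bounds this is enough, since a Morrey estimate on one ball sees only one annulus. The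
  Hardy difference is handled as the integral of a single density. For \<phi> = 1 this density is
  nonnegative pointwise, and for the trial functions it is a Taylor remainder of |.|^p, which
  explains the order 1 / M.\<close>

lemma powr_ge_tangent:
  fixes p z t :: real
  assumes "1 < p"
  shows "\<bar>t\<bar> powr p + p * \<bar>t\<bar> powr (p - 1) * sgn t * (z - t) \<le> \<bar>z\<bar> powr p"
proof -
  \<comment> \<open>Young's inequality for the conjugate exponents p and p / (p - 1) stands in for
    convexity of |.|^p. It needs no derivative and covers t = 0.\<close>
  have *: "\<bar>z\<bar> * \<bar>t\<bar> powr (p - 1)
      \<le> \<bar>z\<bar> powr p / p + (\<bar>t\<bar> powr (p - 1)) powr (p / (p - 1)) / (p / (p - 1))"
    using assms by (intro Youngs_inequality) (auto simp: field_simps)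
  have 1: "p * (\<bar>z\<bar> * \<bar>t\<bar> powr (p - 1)) \<le> \<bar>z\<bar> powr p + p * \<bar>t\<bar> powr p - \<bar>t\<bar> powr p"
  proof -
    have "(p - 1) * (p / (p - 1)) = p" using assms by simp
    then have "(\<bar>t\<bar> powr (p - 1)) powr (p / (p - 1)) = \<bar>t\<bar> powr p"
      by (simp add: powr_powr)
    with * have "p * (\<bar>z\<bar> * \<bar>t\<bar> powr (p - 1)) \<le> p * (\<bar>z\<bar> powr p / p + \<bar>t\<bar> powr p / (p / (p - 1)))"
      using assms by (intro mult_left_mono) auto
    also have "\<dots> = \<bar>z\<bar> powr p + p * \<bar>t\<bar> powr p - \<bar>t\<bar> powr p"
      using assms by (simp add: distrib_left) (simp add: algebra_simps)
    finally show ?thesis .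
  qed
  have "sgn t * z \<le> \<bar>z\<bar>"
    by (cases t "0::real" rule: linorder_cases) auto
  then have "\<bar>t\<bar> powr (p - 1) * (sgn t * z) \<le> \<bar>t\<bar> powr (p - 1) * \<bar>z\<bar>"
    by (intro mult_left_mono) auto
  then have 2: "p * (\<bar>t\<bar> powr (p - 1) * (sgn t * z)) \<le> p * (\<bar>z\<bar> * \<bar>t\<bar> powr (p - 1))"
    using assms by (simp add: mult.commute)
  have "\<bar>t\<bar> powr (p - 1) * \<bar>t\<bar> = \<bar>t\<bar> powr p"
    using assms by (cases "t = 0") (simp_all add: powr_diff)
  then have 3: "\<bar>t\<bar> powr (p - 1) * (sgn t * t) = \<bar>t\<bar> powr p"
    by (simp add: sgn_mult_self_eq abs_sgn mult.commute)
  have "p * \<bar>t\<bar> powr (p - 1) * sgn t * (z - t)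
      = p * (\<bar>t\<bar> powr (p - 1) * (sgn t * z)) - p * \<bar>t\<bar> powr p"
    unfolding 3[symmetric] by (simp add: algebra_simps)
  with 1 2 show ?thesis by linarith
qed

lemma powr_le_second_order:
  fixes q s :: real
  assumes q: "1 < q" and s: "0 \<le> s" "s \<le> 2"
  shows "s powr q \<le> 1 + q * (s - 1) + q\<^sup>2 * 2 powr q * (s - 1)\<^sup>2"
proof (cases "s = 0")
  case True
  have "1 \<le> 2 powr q" using q by (simp add: ge_one_powr_ge_zero)
  moreover have "q * 1 \<le> q * q" using q by (intro mult_left_mono) auto
  ultimately have "(q * 1) * 1 \<le> (q * q) * 2 powr q" using q by (intro mult_mono) auto
  then have "0 \<le> 1 - q + (q * q) * 2 powr q" by linarith
  with True show ?thesis by (simp add: power2_eq_square)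
next
  case False
  with s have s0: "0 < s" by simp
  have t: "s powr q + q * s powr (q - 1) * (1 - s) \<le> 1"
    using powr_ge_tangent[OF q, of s 1] s0 by simp
  have "(s powr (q - 1) - 1) * (s - 1) \<le> q * 2 powr q * (s - 1)\<^sup>2"
  proof (cases "1 \<le> s")
    case True
    have "s powr (q - 1) \<le> s powr q" using True by (intro powr_mono) auto
    moreover have "s powr (q - 1) \<le> 2 powr q"
      using True s q calculation powr_mono2[of q s 2] by linarith
    then have "q * s powr (q - 1) * (s - 1) \<le> q * 2 powr q * (s - 1)"
      using q True by (intro mult_right_mono mult_left_mono) auto
    ultimately have "s powr (q - 1) - 1 \<le> q * 2 powr q * (s - 1)"
      using t by (simp add: algebra_simps)
    then have "(s powr (q - 1) - 1) * (s - 1) \<le> q * 2 powr q * (s - 1) * (s - 1)"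
      using True by (intro mult_right_mono) auto
    then show ?thesis by (simp add: power2_eq_square mult.assoc)
  next
    case lt: False
    have "s powr q \<le> s powr (q - 1)" using s0 lt by (intro powr_mono') auto
    moreover have "1 + q * (s - 1) \<le> s powr q"
      using powr_ge_tangent[OF q, of 1 s] s0 by simp
    ultimately have "1 - s powr (q - 1) \<le> q * (1 - s)" by (simp add: algebra_simps)
    then have "(1 - s powr (q - 1)) * (1 - s) \<le> q * (1 - s) * (1 - s)"
      using lt by (intro mult_right_mono) auto
    moreover have "q * (1 - s)\<^sup>2 \<le> q * 2 powr q * (1 - s)\<^sup>2"
      using q by (intro mult_right_mono) (auto simp: ge_one_powr_ge_zero)
    ultimately show ?thesis by (simp add: power2_eq_square algebra_simps)
  qed
  then have "q * ((s powr (q - 1) - 1) * (s - 1)) \<le> q * (q * 2 powr q * (s - 1)\<^sup>2)"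
    using q by (intro mult_left_mono) auto
  with t show ?thesis by (simp add: power2_eq_square algebra_simps)
qed

section \<open>Integrals of compactly supported functions and the dilation-invariant measure |x|^-n
  dx\<close>

lemma integrable_bounded_compact_support:
  fixes f :: "'a::euclidean_space \<Rightarrow> real"
  assumes [measurable]: "f \<in> borel_measurable borel"
    and "compact K" "\<And>x. x \<notin> K \<Longrightarrow> f x = 0" "\<And>x. \<bar>f x\<bar> \<le> B"
  shows "integrable lborel f"
proof (rule Bochner_Integration.integrable_bound)
  show "integrable lborel (\<lambda>x. indicator K x *\<^sub>R B)"
    using assms by (intro borel_integrable_compact) auto
  show "AE x in lborel. norm (f x) \<le> norm (indicator K x *\<^sub>R B)"
    using assms by (intro AE_I2) (auto simp: indicator_def intro: order_trans[OF _ abs_ge_self])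
qed simp

lemma measurable_continuous_on_compact_support:
  fixes f :: "'a::euclidean_space \<Rightarrow> real"
  assumes "compact K" "continuous_on K f" "\<And>x. x \<notin> K \<Longrightarrow> f x = 0"
  shows "f \<in> borel_measurable borel"
proof -
  have "(\<lambda>x. indicator K x *\<^sub>R f x) \<in> borel_measurable borel"
    using assms by (intro borel_measurable_continuous_on_indicator) (auto simp: compact_imp_closed)
  also have "(\<lambda>x. indicator K x *\<^sub>R f x) = f"
    using assms(3) by (fastforce simp: indicator_def fun_eq_iff)
  finally show ?thesis .
qed

lemma nn_integral_lborel_affine:
  fixes f :: "'a::euclidean_space \<Rightarrow> ennreal"
  assumes [measurable]: "f \<in> borel_measurable borel" and "0 < c"
  shows "(\<integral>\<^sup>+x. f x \<partial>lborel) = ennreal (c ^ DIM('a)) * (\<integral>\<^sup>+x. f (t + c *\<^sub>R x) \<partial>lborel)"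
  using assms
  by (subst lborel_affine[of c t])
     (simp_all add: nn_integral_density nn_integral_distr nn_integral_cmult)

lemma integral_lborel_scaleR:
  fixes f :: "'a::euclidean_space \<Rightarrow> real"
  assumes [measurable]: "f \<in> borel_measurable borel" and "0 < c"
  shows "(\<integral>x. f x \<partial>lborel) = c ^ DIM('a) * (\<integral>x. f (c *\<^sub>R x) \<partial>lborel)"
  using assms
  by (subst lborel_affine[of c 0])
     (simp_all add: integral_density integral_distr)

lemma integral_scaleR_div_norm_power:
  fixes f :: "'a::euclidean_space \<Rightarrow> real"
  assumes [measurable]: "f \<in> borel_measurable borel" and "0 < c"
  shows "(\<integral>x. f (c *\<^sub>R x) / norm x ^ DIM('a) \<partial>lborel) = (\<integral>x. f x / norm x ^ DIM('a) \<partial>lborel)"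
proof -
  have "(\<integral>x. f x / norm x ^ DIM('a) \<partial>lborel)
      = c ^ DIM('a) * (\<integral>x. f (c *\<^sub>R x) / norm (c *\<^sub>R x) ^ DIM('a) \<partial>lborel)"
    using assms(2) by (rule integral_lborel_scaleR[rotated]) simp
  also have "\<dots> = (\<integral>x. c ^ DIM('a) * (f (c *\<^sub>R x) / norm (c *\<^sub>R x) ^ DIM('a)) \<partial>lborel)"
    by (rule integral_mult_right_zero[symmetric])
  also have "\<dots> = (\<integral>x. f (c *\<^sub>R x) / norm x ^ DIM('a) \<partial>lborel)"
    using assms(2) by (intro Bochner_Integration.integral_cong refl) (simp add: power_mult_distrib)
  finally show ?thesis ..
qed

lemma compact_norm_bounds:
  fixes K :: "'a::euclidean_space set"
  assumes "compact K" "0 \<notin> K"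
  obtains a b where "0 < a" "a \<le> b" "\<And>x. x \<in> K \<Longrightarrow> a \<le> norm x \<and> norm x \<le> b"
proof -
  obtain b where b: "\<And>x. x \<in> K \<Longrightarrow> norm x \<le> b"
    using compact_imp_bounded[OF assms(1)] by (auto simp: bounded_iff)
  have "open (- K)" using assms(1) by (simp add: compact_imp_closed open_Compl)
  then obtain a where a: "0 < a" "ball 0 a \<subseteq> - K"
    using assms(2) open_contains_ball by (metis ComplI)
  have "a \<le> norm x \<and> norm x \<le> max a b" if "x \<in> K" for x
    using a(2) b[OF that] that by (auto simp: subset_iff not_less[symmetric])
  with a(1) that show thesis by (metis max.cobounded1)
qed

text \<open>The measure \<open>|x|\<^sup>-\<^sup>n dx\<close> is invariant under dilations, so it annihilates the derivative
  \<open>G\<close> of \<open>g\<close> along the dilation flow.\<close>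

lemma integral_dilation_derivative_eq_0:
  fixes g G :: "'a::euclidean_space \<Rightarrow> real"
  assumes K: "compact K" "0 \<notin> K"
    and g: "continuous_on K g" "\<And>x. x \<notin> K \<Longrightarrow> g x = 0"
    and G: "continuous_on K G" "\<And>x. x \<notin> K \<Longrightarrow> G x = 0"
    and der: "\<And>x. ((\<lambda>s. g (exp s *\<^sub>R x)) has_real_derivative G x) (at 0)"
  shows "(\<integral>x. G x / norm x ^ DIM('a) \<partial>lborel) = 0"
proof -
  have [measurable]: "g \<in> borel_measurable borel" "G \<in> borel_measurable borel"
    using K g G by (auto intro: measurable_continuous_on_compact_support)
  obtain a b where ab: "0 < a" "a \<le> b" "\<And>x. x \<in> K \<Longrightarrow> a \<le> norm x \<and> norm x \<le> b"
    using compact_norm_bounds[OF K] by metis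
  have bdd: "\<exists>B. \<forall>x. \<bar>f x\<bar> \<le> B" if "continuous_on K f" "\<And>x. x \<notin> K \<Longrightarrow> f x = 0" for f :: "'a \<Rightarrow> real"
  proof -
    have "bounded (f ` K)"
      using K that by (intro compact_imp_bounded compact_continuous_image)
    then obtain B where "\<And>x. x \<in> K \<Longrightarrow> \<bar>f x\<bar> \<le> B" by (auto simp: bounded_iff)
    then have "\<bar>f x\<bar> \<le> max B 0" for x
      using that(2)[of x] by (cases "x \<in> K") (auto simp: le_max_iff_disj)
    then show ?thesis by blast
  qed
  \<comment> \<open>Averaging over the flow time s in [0, 1] avoids differentiating under the
    integral. For each s the integral of \<open>H G s\<close> is that of \<open>G\<close> against
    |x|^-n, while the integral over s is \<open>H g 1 x - H g 0 x\<close>, whose integral over x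
    vanishes by the same invariance.\<close>
  define H where "H f s x = f (exp s *\<^sub>R x) / norm x ^ DIM('a)" for f :: "'a \<Rightarrow> real" and s x
  have Hm [measurable]: "(\<lambda>z. H f (fst z) (snd z)) \<in> borel_measurable borel" if [measurable]: "f \<in> borel_measurable borel" for f
  proof -
    have [measurable]: "(\<lambda>z::real \<times> 'a. exp (fst z) *\<^sub>R snd z) \<in> borel_measurable borel"
      by (intro borel_measurable_continuous_onI continuous_intros)
    have [measurable]: "(\<lambda>z::real \<times> 'a. norm (snd z)) \<in> borel_measurable borel"
      by (intro borel_measurable_continuous_onI continuous_intros)
    show ?thesis unfolding H_def by measurable
  qed
  have Hm1: "H f s \<in> borel_measurable borel" if [measurable]: "f \<in> borel_measurable borel" for f s
    unfolding H_def by measurable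
  have Hm2: "(\<lambda>s. H f s x) \<in> borel_measurable borel" if [measurable]: "f \<in> borel_measurable borel" for f x
    unfolding H_def by measurable
  \<comment> \<open>Up to time 1 the flow expands by a factor of at most e, so all supports stay in
    one annulus with inner radius a / e, away from the singularity of |x|^-n.\<close>
  have H0: "H f s x = 0" if f: "\<And>x. x \<notin> K \<Longrightarrow> f x = 0" and s: "0 \<le> s" "s \<le> 1"
      and x: "\<not> (a / exp 1 \<le> norm x \<and> norm x \<le> b)" for f s x
  proof (cases "exp s *\<^sub>R x \<in> K")
    case True
    then have *: "a \<le> exp s * norm x" "exp s * norm x \<le> b" using ab(3) by fastforce+
    have "a \<le> exp 1 * norm x"
      using *(1) s by (intro order_trans[OF *(1)] mult_right_mono) auto
    moreover have "1 * norm x \<le> exp s * norm x" using s by (intro mult_right_mono) auto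
    ultimately show ?thesis using x * by (auto simp: field_simps)
  qed (simp add: H_def f)
  have Hb: "\<exists>B. \<forall>s x. 0 \<le> s \<longrightarrow> s \<le> 1 \<longrightarrow> \<bar>H f s x\<bar> \<le> B"
    if f: "continuous_on K f" "\<And>x. x \<notin> K \<Longrightarrow> f x = 0" for f
  proof -
    obtain B where B: "\<And>x. \<bar>f x\<bar> \<le> B" using bdd[OF f] by auto
    have B0: "0 \<le> B" using B[of 0] by linarith
    have "\<bar>H f s x\<bar> \<le> B / (a / exp 1) ^ DIM('a)" if "0 \<le> s" "s \<le> 1" for s x
    proof (cases "a / exp 1 \<le> norm x \<and> norm x \<le> b")
      case True
      have "\<bar>f (exp s *\<^sub>R x)\<bar> / norm x ^ DIM('a) \<le> B / (a / exp 1) ^ DIM('a)"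
        using True ab(1) B B0 by (intro frac_le power_mono) auto
      then show ?thesis by (simp add: H_def)
    next
      case False
      then show ?thesis using H0[OF f(2) that False] B0 ab(1) by simp
    qed
    then show ?thesis by blast
  qed
  have int1: "integrable lborel (H f s)"
    if s: "0 \<le> s" "s \<le> 1" and f: "continuous_on K f" "\<And>x. x \<notin> K \<Longrightarrow> f x = 0" for f s
  proof -
    obtain B where "\<And>s x. 0 \<le> s \<Longrightarrow> s \<le> 1 \<Longrightarrow> \<bar>H f s x\<bar> \<le> B" using Hb[OF f] by blast
    moreover have "f \<in> borel_measurable borel"
      using K f by (auto intro: measurable_continuous_on_compact_support)
    ultimately show ?thesis
      using H0[OF f(2) s] s
      by (intro integrable_bounded_compact_support[where K="cball 0 b" and B=B] Hm1) auto
  qed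
  obtain B where B: "\<And>s x. 0 \<le> s \<Longrightarrow> s \<le> 1 \<Longrightarrow> \<bar>H G s x\<bar> \<le> B" using Hb[OF G] by blast
  have B0: "0 \<le> B" using B[of 0 0] by auto
  have HG0: "norm x \<le> b" if "0 \<le> s" "s \<le> 1" "H G s x \<noteq> 0" for s x
    using H0[where f=G, OF G(2)] that by blast
  have HG: "(\<lambda>z. indicator {0..1} (fst z) * H G (fst z) (snd z) :: real) \<in> borel_measurable borel"
  proof -
    have "(\<lambda>z::real\<times>'a. fst z) \<in> borel_measurable borel"
      by (intro borel_measurable_continuous_onI continuous_intros)
    from measurable_compose[OF this, of "indicator {0..1} :: real \<Rightarrow> real" borel]
    have [measurable]: "(\<lambda>z::real\<times>'a. indicator {0..1} (fst z) :: real) \<in> borel_measurable borel"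
      by simp
    show ?thesis by (intro borel_measurable_times Hm) auto
  qed
  have "integrable lborel (\<lambda>z. indicator {0..1} (fst z) * H G (fst z) (snd z) :: real)"
    using B0 B HG0
    by (intro integrable_bounded_compact_support[where K="{0..1} \<times> cball 0 b" and B=B] HG)
       (auto intro!: compact_Times simp: indicator_def)
  then have int: "integrable (lborel \<Otimes>\<^sub>M lborel) (\<lambda>(s, x). indicator {0..1} s * H G s x)"
    by (simp add: lborel_prod case_prod_unfold)
  have inner: "(\<integral>s. indicator {0..1} s * H G s x \<partial>lborel) = H g 1 x - H g 0 x" for x
  proof -
    have "((\<lambda>s. g (exp s *\<^sub>R x)) has_real_derivative G (exp s *\<^sub>R x)) (at s)" for s
    proof -
      have "((\<lambda>h. g (exp h *\<^sub>R (exp s *\<^sub>R x))) has_real_derivative G (exp s *\<^sub>R x)) (at 0)"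
        by (rule der)
      then have "((\<lambda>h. g (exp (h + s) *\<^sub>R x)) has_real_derivative G (exp s *\<^sub>R x)) (at 0)"
        by (simp add: exp_add)
      then show ?thesis
        using DERIV_shift[of "\<lambda>s. g (exp s *\<^sub>R x)" "G (exp s *\<^sub>R x)" 0 s] by (simp add: add.commute)
    qed
    then have "((\<lambda>s. H g s x) has_real_derivative H G s x) (at s within {0..1})" for s
      unfolding H_def by (intro DERIV_cdivide) (auto intro: has_field_derivative_at_within)
    then have 1: "((\<lambda>s. H G s x) has_integral (H g 1 x - H g 0 x)) {0..1}"
      by (intro fundamental_theorem_of_calculus)
         (auto simp: has_real_derivative_iff_has_vector_derivative)
    have "integrable lborel (\<lambda>s. indicator {0..1} s * H G s x)"
      using B0 B Hm2[of G x]
      by (intro integrable_bounded_compact_support[where K="{0..1}" and B=B])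
         (auto simp: indicator_def)
    then have "((\<lambda>s. indicator {0..1} s * H G s x) has_integral (\<integral>s. indicator {0..1} s * H G s x \<partial>lborel)) UNIV"
      by (rule has_integral_integral_lborel)
    moreover have "(\<lambda>s. indicator {0..1} s * H G s x) = (\<lambda>s. if s \<in> {0..1} then H G s x else 0)"
      by (auto simp: indicator_def)
    ultimately have "((\<lambda>s. H G s x) has_integral (\<integral>s. indicator {0..1} s * H G s x \<partial>lborel)) {0..1}"
      by (simp only: has_integral_restrict_UNIV)
    with 1 show ?thesis by (rule has_integral_unique[symmetric])
  qed
  have inv: "(\<integral>x. H f s x \<partial>lborel) = (\<integral>x. f x / norm x ^ DIM('a) \<partial>lborel)"
    if [measurable]: "f \<in> borel_measurable borel" for f s
    unfolding H_def by (rule integral_scaleR_div_norm_power) auto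
  have "(\<integral>x. G x / norm x ^ DIM('a) \<partial>lborel)
      = (\<integral>s. indicator {0..1::real} s * (\<integral>x. G x / norm x ^ DIM('a) \<partial>lborel) \<partial>lborel)"
    by simp
  also have "\<dots> = (\<integral>s. (\<integral>x. indicator {0..1} s * H G s x \<partial>lborel) \<partial>lborel)"
    by (simp add: inv)
  also have "\<dots> = (\<integral>x. (\<integral>s. indicator {0..1} s * H G s x \<partial>lborel) \<partial>lborel)"
    using lborel_pair.Fubini_integral[OF int] by simp
  also have "\<dots> = (\<integral>x. H g 1 x - H g 0 x \<partial>lborel)"
    by (simp add: inner)
  also have "\<dots> = 0"
    using g by (subst Bochner_Integration.integral_diff) (auto intro!: int1 simp: inv)
  finally show ?thesis .
qed

section \<open>Morrey estimates on balls\<close>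

text \<open>Either s \<le> a, or (s / a)^(p-1) \<ge> 1. The right side is linear in s^p and so can
  be integrated directly; if a is the p-mean of s, the mean of s comes out as at most 2 a, a factor
  2 worse than with Hoelder's inequality.\<close>

lemma le_add_powr:
  fixes a s p :: real
  assumes "1 < p" "0 < a" "0 \<le> s"
  shows "s \<le> a + a powr (1 - p) * s powr p"
proof (cases "s \<le> a")
  case True
  then show ?thesis using assms by (simp add: add_increasing2)
next
  case False
  have "s = (a powr (1 - p) * a powr (p - 1)) * s" using assms by (simp add: powr_add[symmetric])
  also have "\<dots> \<le> (a powr (1 - p) * s powr (p - 1)) * s"
    using assms False by (intro mult_right_mono mult_left_mono powr_mono2) auto
  also have "\<dots> = a powr (1 - p) * s powr p"
    using assms False by (simp add: powr_diff)
  finally show ?thesis using assms by linarith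
qed

lemma content_cball_pos':
  fixes z :: "'a::euclidean_space"
  assumes "0 < \<rho>"
  shows "emeasure lborel (cball z \<rho>) = ennreal (measure lborel (cball z \<rho>))" "0 < measure lborel (cball z \<rho>)"
proof -
  show "emeasure lborel (cball z \<rho>) = ennreal (measure lborel (cball z \<rho>))"
    using emeasure_lborel_cball_finite[of z \<rho>] by (intro emeasure_eq_ennreal_measure) auto
qed (rule content_cball_pos[OF assms])

text \<open>The fundamental theorem of calculus on the segment, phrased with a nonnegative integral
  so that Tonelli's theorem applies without integrability conditions. The common bound c on the
  lengths leaves an integrand that depends on y only through the point of the segment.\<close>

lemma abs_diff_le_nn_integral_segment:
  fixes u :: "'a::euclidean_space \<Rightarrow> real" and Du :: "'a \<Rightarrow> 'a"
  assumes der: "\<And>x. (u has_derivative (\<lambda>h. Du x \<bullet> h)) (at x)"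
    and cont: "continuous_on UNIV Du"
    and "norm (y - x) \<le> c"
  shows "ennreal \<bar>u y - u x\<bar>
      \<le> (\<integral>\<^sup>+t. ennreal (indicator {0..1} t * (c * norm (Du (x + t *\<^sub>R (y - x))))) \<partial>lborel)"
proof -
  define w where "w t = c * norm (Du (x + t *\<^sub>R (y - x)))" for t
  have c0: "0 \<le> c" using assms(3) norm_ge_zero order_trans by blast
  have w0: "0 \<le> w t" for t using c0 by (simp add: w_def)
  have contw: "continuous_on UNIV w"
    unfolding w_def by (intro continuous_intros continuous_on_compose2[OF cont]) auto
  then have [measurable]: "w \<in> borel_measurable borel" by (rule borel_measurable_continuous_onI)
  have "((\<lambda>t. u (x + t *\<^sub>R (y - x))) has_real_derivative Du (x + t *\<^sub>R (y - x)) \<bullet> (y - x)) (at t within {0..1})" for t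
    unfolding has_field_derivative_def
    by (rule has_derivative_eq_rhs, rule has_derivative_compose[OF _ der])
       (auto intro!: derivative_eq_intros simp: fun_eq_iff inner_commute)
  then have "((\<lambda>t. Du (x + t *\<^sub>R (y - x)) \<bullet> (y - x)) has_integral
      u (x + 1 *\<^sub>R (y - x)) - u (x + 0 *\<^sub>R (y - x))) {0..1}"
    by (intro fundamental_theorem_of_calculus)
       (auto simp: has_real_derivative_iff_has_vector_derivative)
  then have 1: "((\<lambda>t. Du (x + t *\<^sub>R (y - x)) \<bullet> (y - x)) has_integral u y - u x) {0..1}" by simp
  have 2: "(w has_integral (integral {0..1} w)) {0..1}"
    using contw by (intro integrable_integral integrable_continuous_interval)
      (auto intro: continuous_on_subset)
  have "norm (integral {0..1} (\<lambda>t. Du (x + t *\<^sub>R (y - x)) \<bullet> (y - x))) \<le> integral {0..1} w"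
  proof (rule integral_norm_bound_integral)
    fix t :: real
    have "\<bar>Du (x + t *\<^sub>R (y - x)) \<bullet> (y - x)\<bar> \<le> norm (Du (x + t *\<^sub>R (y - x))) * norm (y - x)"
      by (rule Cauchy_Schwarz_ineq2)
    also have "\<dots> \<le> norm (Du (x + t *\<^sub>R (y - x))) * c"
      using assms(3) by (intro mult_left_mono) auto
    finally show "norm (Du (x + t *\<^sub>R (y - x)) \<bullet> (y - x)) \<le> w t" by (simp add: w_def mult.commute)
  qed (use 1 2 in auto)
  then have 3: "\<bar>u y - u x\<bar> \<le> integral {0..1} w" using 1 by (simp add: integral_unique)
  have "(\<lambda>t. indicator {0..1} t * w t) = (\<lambda>t. if t \<in> {0..1} then w t else 0)"
    by (auto simp: indicator_def)
  with 2 have "((\<lambda>t. indicator {0..1} t * w t) has_integral (integral {0..1} w)) UNIV"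
    by (simp only: has_integral_restrict_UNIV)
  then have "(\<integral>\<^sup>+t. ennreal (indicator {0..1} t * w t) \<partial>lborel) = ennreal (integral {0..1} w)"
  proof (intro nn_integral_has_integral_lborel)
    show "(\<lambda>t. indicator {0..1} t * w t) \<in> borel_measurable borel" by measurable
    show "0 \<le> indicator {0..1} t * w t" for t by (intro mult_nonneg_nonneg w0 indicator_pos_le)
  qed
  with 3 show ?thesis by (simp add: w_def ennreal_leI)
qed

text \<open>Morrey's estimate without polar coordinates: the increments of \<open>u\<close> are integrated along the
  segments from \<open>x\<close>, and the dilation with centre \<open>x\<close> and ratio \<open>t\<close> maps the ball into itself.
  Young's inequality with the weight \<open>a = t\<^sup>-\<^sup>n\<^sup>/\<^sup>p m\<close> replaces the inequality of Hoelder.\<close>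

lemma nn_integral_oscillation_le:
  fixes u :: "'a::euclidean_space \<Rightarrow> real" and Du :: "'a \<Rightarrow> 'a"
  assumes p: "real DIM('a) < p" and \<rho>: "0 < \<rho>" and m: "0 < m"
    and der: "\<And>x. (u has_derivative (\<lambda>h. Du x \<bullet> h)) (at x)"
    and cont: "continuous_on UNIV Du"
    and x: "x \<in> cball z \<rho>"
    and le: "(\<integral>\<^sup>+y. ennreal (indicator (cball z \<rho>) y * norm (Du y) powr p) \<partial>lborel)
      \<le> ennreal (measure lborel (cball z \<rho>) * m powr p)"
  shows "(\<integral>\<^sup>+y. ennreal (indicator (cball z \<rho>) y * \<bar>u y - u x\<bar>) \<partial>lborel)
      \<le> ennreal (measure lborel (cball z \<rho>) * (4 * \<rho> * m / (1 - real DIM('a) / p)))"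
proof -
  define n where "n = DIM('a)"
  define S where "S = cball z \<rho>"
  define V where "V = measure lborel S"
  have n: "1 \<le> n" using DIM_positive[where 'a='a] unfolding n_def by linarith
  have p1: "1 < p" using p n unfolding n_def by linarith
  have V: "0 < V" "emeasure lborel S = ennreal V"
    using content_cball_pos'[OF \<rho>] by (auto simp: V_def S_def)
  have [measurable]: "S \<in> sets borel" by (simp add: S_def)
  have [measurable]: "(\<lambda>y. norm (Du y)) \<in> borel_measurable borel"
    using cont by (intro borel_measurable_continuous_onI continuous_intros)
  have [measurable]: "Du \<in> borel_measurable borel"
    using cont by (intro borel_measurable_continuous_onI)
  have [measurable]: "u \<in> borel_measurable borel"
    using der by (intro borel_measurable_continuous_onI continuous_at_imp_continuous_on ballI)
      (rule has_derivative_continuous)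
  define k where "k t y = indicator S y * (indicator {0..1} t * (2 * \<rho> * norm (Du (x + t *\<^sub>R (y - x)))))"
    for t :: real and y
  have [measurable]: "(\<lambda>w::'a \<times> real. norm (Du (x + snd w *\<^sub>R (fst w - x)))) \<in> borel_measurable borel"
    by (intro borel_measurable_continuous_onI continuous_intros continuous_on_compose2[OF cont]) auto
  have k_meas [measurable]: "(\<lambda>(y, t). ennreal (k t y)) \<in> borel_measurable (lborel \<Otimes>\<^sub>M lborel)"
  proof -
    have "(\<lambda>w::'a \<times> real. norm (Du (x + snd w *\<^sub>R (fst w - x)))) \<in> borel_measurable (lborel \<Otimes>\<^sub>M lborel)"
      by (simp add: lborel_prod)
    moreover have "(\<lambda>w::'a \<times> real. indicator S (fst w) :: real) \<in> borel_measurable (lborel \<Otimes>\<^sub>M lborel)"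
      by (rule measurable_compose[OF measurable_fst]) simp
    moreover have "(\<lambda>w::'a \<times> real. indicator {0..1} (snd w) :: real) \<in> borel_measurable (lborel \<Otimes>\<^sub>M lborel)"
      by (rule measurable_compose[OF measurable_snd]) simp
    ultimately show ?thesis unfolding k_def case_prod_unfold
      by (intro measurable_compose[OF _ measurable_ennreal] borel_measurable_times borel_measurable_const)
  qed
  have "(\<integral>\<^sup>+y. ennreal (indicator S y * \<bar>u y - u x\<bar>) \<partial>lborel)
      \<le> (\<integral>\<^sup>+y. (\<integral>\<^sup>+t. ennreal (k t y) \<partial>lborel) \<partial>lborel)"
  proof (rule nn_integral_mono)
    fix y
    show "ennreal (indicator S y * \<bar>u y - u x\<bar>) \<le> (\<integral>\<^sup>+t. ennreal (k t y) \<partial>lborel)"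
    proof (cases "y \<in> S")
      case True
      have "norm (y - x) \<le> 2 * \<rho>"
        using True x dist_triangle2[of y x z] by (auto simp: S_def dist_norm norm_minus_commute)
      from abs_diff_le_nn_integral_segment[OF der cont this] True
      show ?thesis by (simp add: k_def)
    qed simp
  qed
  also have "\<dots> = (\<integral>\<^sup>+t. (\<integral>\<^sup>+y. ennreal (k t y) \<partial>lborel) \<partial>lborel)"
    using lborel_pair.Fubini'[OF k_meas] by simp
  also have "\<dots> \<le> (\<integral>\<^sup>+t. ennreal (4 * \<rho> * m * V) * ennreal (indicator {0..1} t * t powr (- (n / p))) \<partial>lborel)"
  proof (rule nn_integral_mono_AE)
    have "AE t::real in lborel. t \<noteq> 0" by (rule AE_lborel_singleton)
    then show "AE t in lborel. (\<integral>\<^sup>+y. ennreal (k t y) \<partial>lborel)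
        \<le> ennreal (4 * \<rho> * m * V) * ennreal (indicator {0..1} t * t powr (- (n / p)))"
    proof (rule AE_mp, intro AE_I2 impI)
      fix t :: real assume "t \<noteq> 0"
      show "(\<integral>\<^sup>+y. ennreal (k t y) \<partial>lborel)
          \<le> ennreal (4 * \<rho> * m * V) * ennreal (indicator {0..1} t * t powr (- (n / p)))"
      proof (cases "t \<in> {0..1}")
        case True
        with \<open>t \<noteq> 0\<close> have t: "0 < t" "t \<le> 1" by auto
        define \<tau> where "\<tau> = t powr (- (n / p))"
        have \<tau>: "0 < \<tau>" using t by (simp add: \<tau>_def)
        define a where "a = \<tau> * m"
        have a: "0 < a" using \<tau> m by (simp add: a_def)
        define f where "f y = ennreal (indicator S y * norm (Du y) powr p)" for y
        have [measurable]: "f \<in> borel_measurable borel" unfolding f_def by measurable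
        define c where "c = x - t *\<^sub>R x"
        have c: "x + t *\<^sub>R (y - x) = c + t *\<^sub>R y" for y by (simp add: c_def algebra_simps)
        have S: "c + t *\<^sub>R y \<in> S" if "y \<in> S" for y
          using convexD_alt[of S x y t] t x that convex_cball[of z \<rho>]
          by (simp add: S_def c_def algebra_simps)
        have f: "ennreal (t ^ n) * (\<integral>\<^sup>+y. f (c + t *\<^sub>R y) \<partial>lborel) \<le> ennreal (V * m powr p)"
          using le t nn_integral_lborel_affine[of f t c] by (simp add: f_def n_def V_def S_def)
        \<comment> \<open>This determines the weight a: its power 1 - p produces the factor t^n that
          cancels the Jacobian t^-n of the dilation, and what remains in t is t^(-n/p).\<close>
        have a': "a powr (1 - p) = \<tau> * m powr (1 - p) * t ^ n"
        proof -
          have *: "- (n / p) * (1 - p) = - (n / p) + n" using p1 by (simp add: field_simps)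
          have "a powr (1 - p) = t powr (- (n / p) * (1 - p)) * m powr (1 - p)"
            using t m by (simp only: a_def \<tau>_def powr_mult powr_powr powr_ge_zero less_imp_le)
          also have "t powr (- (n / p) * (1 - p)) = t powr (- (n / p)) * t ^ n"
            using t(1) by (simp only: * powr_add powr_realpow)
          finally show ?thesis by (simp only: \<tau>_def mult_ac)
        qed
        have "ennreal (a powr (1 - p)) * (\<integral>\<^sup>+y. f (c + t *\<^sub>R y) \<partial>lborel)
            = ennreal (\<tau> * m powr (1 - p)) * (ennreal (t ^ n) * (\<integral>\<^sup>+y. f (c + t *\<^sub>R y) \<partial>lborel))"
          using t \<tau> by (simp only: a' ennreal_mult mult.assoc powr_ge_zero mult_nonneg_nonneg less_imp_le zero_le_power)
        also have "\<dots> \<le> ennreal (\<tau> * m powr (1 - p)) * ennreal (V * m powr p)"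
          by (intro mult_left_mono f) simp
        also have "\<dots> = ennreal (a * V)"
        proof -
          have "m powr (1 - p) * m powr p = m" using m by (simp add: powr_add[symmetric])
          moreover have "\<tau> * m powr (1 - p) * (V * m powr p) = \<tau> * (m powr (1 - p) * m powr p) * V"
            by (simp only: mult_ac)
          ultimately have "\<tau> * m powr (1 - p) * (V * m powr p) = a * V"
            by (simp only: a_def)
          then show ?thesis using V(1) \<tau> by (subst ennreal_mult[symmetric]) auto
        qed
        finally have Y: "ennreal (a powr (1 - p)) * (\<integral>\<^sup>+y. f (c + t *\<^sub>R y) \<partial>lborel) \<le> ennreal (a * V)" .
        have "(\<integral>\<^sup>+y. ennreal (k t y) \<partial>lborel)
            \<le> (\<integral>\<^sup>+y. ennreal (2 * \<rho>) * (ennreal a * indicator S y + ennreal (a powr (1 - p)) * f (c + t *\<^sub>R y)) \<partial>lborel)"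
        proof (rule nn_integral_mono)
          fix y
          show "ennreal (k t y)
              \<le> ennreal (2 * \<rho>) * (ennreal a * indicator S y + ennreal (a powr (1 - p)) * f (c + t *\<^sub>R y))"
          proof (cases "y \<in> S")
            case yS: True
            have "k t y = 2 * \<rho> * norm (Du (c + t *\<^sub>R y))"
              using True yS by (simp add: k_def c)
            also have "\<dots> \<le> 2 * \<rho> * (a + a powr (1 - p) * norm (Du (c + t *\<^sub>R y)) powr p)"
              using \<rho> by (intro mult_left_mono le_add_powr p1 a) auto
            finally have "ennreal (k t y) \<le> ennreal (2 * \<rho> * (a + a powr (1 - p) * norm (Du (c + t *\<^sub>R y)) powr p))"
              by (rule ennreal_leI)
            also have "\<dots> = ennreal (2 * \<rho>) * (ennreal a * indicator S y + ennreal (a powr (1 - p)) * f (c + t *\<^sub>R y))"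
              using yS S[OF yS] \<rho> a by (simp add: f_def ennreal_mult ennreal_plus)
            finally show ?thesis .
          qed (simp add: k_def)
        qed
        also have "\<dots> = ennreal (2 * \<rho>) * (ennreal a * ennreal V
            + ennreal (a powr (1 - p)) * (\<integral>\<^sup>+y. f (c + t *\<^sub>R y) \<partial>lborel))"
          using V(2) by (simp add: nn_integral_cmult nn_integral_add)
        also have "\<dots> \<le> ennreal (2 * \<rho>) * (ennreal a * ennreal V + ennreal (a * V))"
          by (intro mult_left_mono add_left_mono Y) auto
        also have "\<dots> = ennreal (4 * \<rho> * m * V) * ennreal (indicator {0..1} t * t powr (- (n / p)))"
        proof -
          have "indicator {0..1} t * t powr (- (n / p)) = \<tau>" using True by (simp add: \<tau>_def)
          moreover have "2 * \<rho> * (a * V + a * V) = 4 * \<rho> * m * V * \<tau>" by (simp add: a_def)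
          ultimately show ?thesis
            using a V(1) \<rho> m \<tau>
            by (simp only: ennreal_mult[symmetric] ennreal_plus[symmetric] less_imp_le
                mult_nonneg_nonneg add_nonneg_nonneg zero_le_numeral)
        qed
        finally show ?thesis .
      qed (simp add: k_def)
    qed
  qed
  also have "\<dots> = ennreal (4 * \<rho> * m * V) * ennreal (1 / (1 - n / p))"
  proof -
    \<comment> \<open>The exponent - n / p exceeds -1 exactly because p > n; this is where the
      integral over the dilation ratio converges.\<close>
    have "((\<lambda>t. t powr (- (n / p))) has_integral 1 powr (- (n / p) + 1) / (- (n / p) + 1)) {0..1}"
      using p p1 by (intro has_integral_powr_from_0) (auto simp: n_def field_simps)
    then have "((\<lambda>t. t powr (- (n / p))) has_integral 1 / (1 - n / p)) {0..1}"
      by (simp add: add.commute)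
    moreover have "(\<lambda>t. indicator {0..1} t * t powr (- (n / p)))
        = (\<lambda>t. if t \<in> {0..1} then t powr (- (n / p)) else 0)"
      by (auto simp: indicator_def)
    ultimately have "((\<lambda>t. indicator {0..1} t * t powr (- (n / p))) has_integral 1 / (1 - n / p)) UNIV"
      by (simp only: has_integral_restrict_UNIV)
    then have "(\<integral>\<^sup>+t. ennreal (indicator {0..1} t * t powr (- (n / p))) \<partial>lborel) = ennreal (1 / (1 - n / p))"
      by (intro nn_integral_has_integral_lborel) auto
    then show ?thesis by (simp add: nn_integral_cmult)
  qed
  also have "\<dots> = ennreal (V * (4 * \<rho> * m / (1 - n / p)))"
    using \<rho> m V(1) p p1 by (simp add: ennreal_mult[symmetric] n_def mult_ac)
  finally show ?thesis by (simp add: S_def V_def n_def)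
qed

lemma nn_integral_indicator_const:
  assumes "0 < \<rho>" "0 \<le> c"
  shows "(\<integral>\<^sup>+w. ennreal (indicator (cball z \<rho>) w * c) \<partial>lborel) = ennreal (measure lborel (cball z \<rho>) * c)"
proof -
  have "(\<integral>\<^sup>+w. ennreal (indicator (cball z \<rho>) w * c) \<partial>lborel)
      = (\<integral>\<^sup>+w. ennreal c * indicator (cball z \<rho>) w \<partial>lborel)"
    by (intro nn_integral_cong) (auto simp: indicator_def)
  then show ?thesis
    using assms content_cball_pos'(1)[OF assms(1), of z]
    by (simp only: nn_integral_cmult_indicator sets_lborel borel_closed closed_cball)
       (simp add: ennreal_mult[symmetric] mult.commute)
qed

text \<open>Averaging |u x - u y| \<le> |u w - u x| + |u w - u y| over w in the ball doubles the
  constant 4 to 8. Both points may lie anywhere in the ball.\<close>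

lemma morrey_oscillation_le:
  fixes u :: "'a::euclidean_space \<Rightarrow> real" and Du :: "'a \<Rightarrow> 'a"
  assumes p: "real DIM('a) < p" and \<rho>: "0 < \<rho>" and m: "0 < m"
    and der: "\<And>x. (u has_derivative (\<lambda>h. Du x \<bullet> h)) (at x)"
    and cont: "continuous_on UNIV Du"
    and x: "x \<in> cball z \<rho>" and y: "y \<in> cball z \<rho>"
    and le: "(\<integral>\<^sup>+w. ennreal (indicator (cball z \<rho>) w * norm (Du w) powr p) \<partial>lborel)
      \<le> ennreal (measure lborel (cball z \<rho>) * m powr p)"
  shows "\<bar>u x - u y\<bar> \<le> 8 * \<rho> * m / (1 - real DIM('a) / p)"
proof -
  define V where "V = measure lborel (cball z \<rho>)"
  define b where "b = 4 * \<rho> * m / (1 - real DIM('a) / p)"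
  have V: "0 < V" using content_cball_pos'[OF \<rho>] by (simp add: V_def)
  have "0 \<le> b" using \<rho> m p by (auto simp: b_def)
  have [measurable]: "u \<in> borel_measurable borel"
    using der by (intro borel_measurable_continuous_onI continuous_at_imp_continuous_on ballI)
      (rule has_derivative_continuous)
  have [measurable]: "cball z \<rho> \<in> sets borel" by simp
  have "ennreal (V * \<bar>u x - u y\<bar>) = (\<integral>\<^sup>+w. ennreal (indicator (cball z \<rho>) w * \<bar>u x - u y\<bar>) \<partial>lborel)"
    using \<rho> by (simp add: nn_integral_indicator_const V_def)
  also have "\<dots> \<le> (\<integral>\<^sup>+w. ennreal (indicator (cball z \<rho>) w * \<bar>u w - u x\<bar>)
      + ennreal (indicator (cball z \<rho>) w * \<bar>u w - u y\<bar>) \<partial>lborel)"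
    by (intro nn_integral_mono)
       (auto simp: indicator_def ennreal_plus[symmetric] simp del: ennreal_plus intro!: ennreal_leI)
  also have "\<dots> = (\<integral>\<^sup>+w. ennreal (indicator (cball z \<rho>) w * \<bar>u w - u x\<bar>) \<partial>lborel)
      + (\<integral>\<^sup>+w. ennreal (indicator (cball z \<rho>) w * \<bar>u w - u y\<bar>) \<partial>lborel)"
    by (intro nn_integral_add) measurable
  also have "\<dots> \<le> ennreal (V * b) + ennreal (V * b)"
    using nn_integral_oscillation_le[OF p \<rho> m der cont x le]
      nn_integral_oscillation_le[OF p \<rho> m der cont y le]
    by (intro add_mono) (simp_all add: V_def b_def)
  also have "\<dots> = ennreal (V * (2 * b))"
    using V \<open>0 \<le> b\<close> by (simp add: ennreal_plus[symmetric] del: ennreal_plus)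
  finally have "V * \<bar>u x - u y\<bar> \<le> V * (2 * b)"
    using V \<open>0 \<le> b\<close> by (simp add: ennreal_le_iff)
  then show ?thesis using V by (simp only: mult_le_cancel_left_pos) (simp add: b_def)
qed

text \<open>The same averaging with |u x| \<le> |u w| + |u w - u x|; \<open>le_add_powr\<close> with
  a = m' bounds the mean of |u| by 2 m'.\<close>

lemma morrey_pointwise_le:
  fixes u :: "'a::euclidean_space \<Rightarrow> real" and Du :: "'a \<Rightarrow> 'a"
  assumes p: "real DIM('a) < p" and \<rho>: "0 < \<rho>" and m: "0 < m" and m': "0 < m'"
    and der: "\<And>x. (u has_derivative (\<lambda>h. Du x \<bullet> h)) (at x)"
    and cont: "continuous_on UNIV Du"
    and x: "x \<in> cball z \<rho>"
    and le: "(\<integral>\<^sup>+w. ennreal (indicator (cball z \<rho>) w * norm (Du w) powr p) \<partial>lborel)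
      \<le> ennreal (measure lborel (cball z \<rho>) * m powr p)"
    and le': "(\<integral>\<^sup>+w. ennreal (indicator (cball z \<rho>) w * \<bar>u w\<bar> powr p) \<partial>lborel)
      \<le> ennreal (measure lborel (cball z \<rho>) * m' powr p)"
  shows "\<bar>u x\<bar> \<le> 2 * m' + 4 * \<rho> * m / (1 - real DIM('a) / p)"
proof -
  define V where "V = measure lborel (cball z \<rho>)"
  define b where "b = 4 * \<rho> * m / (1 - real DIM('a) / p)"
  have V: "0 < V" using content_cball_pos'[OF \<rho>] by (simp add: V_def)
  have "0 \<le> b" using \<rho> m p by (auto simp: b_def)
  have p1: "1 < p" using p DIM_positive[where 'a='a] by linarith
  have [measurable]: "u \<in> borel_measurable borel"
    using der by (intro borel_measurable_continuous_onI continuous_at_imp_continuous_on ballI)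
      (rule has_derivative_continuous)
  have [measurable]: "cball z \<rho> \<in> sets borel" by simp
  have "(\<integral>\<^sup>+w. ennreal (indicator (cball z \<rho>) w * \<bar>u w\<bar>) \<partial>lborel)
      \<le> (\<integral>\<^sup>+w. ennreal (indicator (cball z \<rho>) w * m')
        + ennreal (m' powr (1 - p)) * ennreal (indicator (cball z \<rho>) w * \<bar>u w\<bar> powr p) \<partial>lborel)"
  proof (rule nn_integral_mono)
    fix w
    have "indicator (cball z \<rho>) w * \<bar>u w\<bar> \<le> indicator (cball z \<rho>) w * m'
        + m' powr (1 - p) * (indicator (cball z \<rho>) w * \<bar>u w\<bar> powr p)"
      using le_add_powr[OF p1 m', of "\<bar>u w\<bar>"] by (simp add: indicator_def)
    then have "ennreal (indicator (cball z \<rho>) w * \<bar>u w\<bar>) \<le> ennreal (indicator (cball z \<rho>) w * m'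
        + m' powr (1 - p) * (indicator (cball z \<rho>) w * \<bar>u w\<bar> powr p))"
      by (rule ennreal_leI)
    also have "\<dots> = ennreal (indicator (cball z \<rho>) w * m')
        + ennreal (m' powr (1 - p)) * ennreal (indicator (cball z \<rho>) w * \<bar>u w\<bar> powr p)"
      using m' by (subst ennreal_plus) (auto simp: ennreal_mult)
    finally show "ennreal (indicator (cball z \<rho>) w * \<bar>u w\<bar>) \<le> ennreal (indicator (cball z \<rho>) w * m')
        + ennreal (m' powr (1 - p)) * ennreal (indicator (cball z \<rho>) w * \<bar>u w\<bar> powr p)" .
  qed
  also have "\<dots> = ennreal (V * m')
      + ennreal (m' powr (1 - p)) * (\<integral>\<^sup>+w. ennreal (indicator (cball z \<rho>) w * \<bar>u w\<bar> powr p) \<partial>lborel)"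
    using \<rho> m' nn_integral_indicator_const[of \<rho> m' z]
    by (simp add: nn_integral_add nn_integral_cmult V_def del: ennreal_mult')
  also have "\<dots> \<le> ennreal (V * m') + ennreal (m' powr (1 - p)) * ennreal (V * m' powr p)"
    using le' by (intro add_mono mult_left_mono) (auto simp: V_def)
  also have "\<dots> = ennreal (V * (2 * m'))"
  proof -
    have "m' powr (1 - p) * m' powr p = m'" using m' by (simp add: powr_add[symmetric])
    then have "m' powr (1 - p) * (V * m' powr p) = V * m'" by (metis mult.left_commute)
    then show ?thesis using V m'
      by (simp add: ennreal_mult[symmetric] ennreal_plus[symmetric] del: ennreal_plus)
  qed
  finally have 1: "(\<integral>\<^sup>+w. ennreal (indicator (cball z \<rho>) w * \<bar>u w\<bar>) \<partial>lborel) \<le> ennreal (V * (2 * m'))" .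
  have "ennreal (V * \<bar>u x\<bar>) = (\<integral>\<^sup>+w. ennreal (indicator (cball z \<rho>) w * \<bar>u x\<bar>) \<partial>lborel)"
    using \<rho> by (simp add: nn_integral_indicator_const V_def)
  also have "\<dots> \<le> (\<integral>\<^sup>+w. ennreal (indicator (cball z \<rho>) w * \<bar>u w\<bar>)
      + ennreal (indicator (cball z \<rho>) w * \<bar>u w - u x\<bar>) \<partial>lborel)"
    by (intro nn_integral_mono)
       (auto simp: indicator_def ennreal_plus[symmetric] simp del: ennreal_plus intro!: ennreal_leI)
  also have "\<dots> = (\<integral>\<^sup>+w. ennreal (indicator (cball z \<rho>) w * \<bar>u w\<bar>) \<partial>lborel)
      + (\<integral>\<^sup>+w. ennreal (indicator (cball z \<rho>) w * \<bar>u w - u x\<bar>) \<partial>lborel)"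
    by (intro nn_integral_add) measurable
  also have "\<dots> \<le> ennreal (V * (2 * m')) + ennreal (V * b)"
    using nn_integral_oscillation_le[OF p \<rho> m der cont x le] 1
    by (intro add_mono) (simp_all add: V_def b_def)
  also have "\<dots> = ennreal (V * (2 * m' + b))"
    using V m' \<open>0 \<le> b\<close> by (simp add: ennreal_plus[symmetric] distrib_left del: ennreal_plus)
  finally have "V * \<bar>u x\<bar> \<le> V * (2 * m' + b)"
    using V m' \<open>0 \<le> b\<close> by (simp add: ennreal_le_iff)
  then show ?thesis using V by (simp only: mult_le_cancel_left_pos) (simp add: b_def)
qed

section \<open>Calibrated Hardy inequalities\<close>

text \<open>Since p > 1, the formula holds at t = 0 as well. Hence |u|^p is differentiable across
  the zeros of u and can be carried along the dilation flow without regularising the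
  modulus.\<close>

lemma has_real_derivative_abs_powr:
  fixes p t :: real
  assumes "1 < p"
  shows "((\<lambda>t. \<bar>t\<bar> powr p) has_real_derivative p * (\<bar>t\<bar> powr (p - 1) * sgn t)) (at t)"
proof (cases "t = 0")
  case True
  have "((\<lambda>h::real. \<bar>h\<bar> powr (p - 1)) \<longlongrightarrow> \<bar>0\<bar> powr (p - 1)) (at 0)"
    using assms by (intro tendsto_powr' tendsto_intros) auto
  then have "((\<lambda>h::real. \<bar>h\<bar> powr (p - 1)) \<longlongrightarrow> 0) (at 0)" by simp
  then have "((\<lambda>h::real. \<bar>h\<bar> powr p / h) \<longlongrightarrow> 0) (at 0)"
    by (rule tendsto_0_le[where K=1])
       (auto simp: eventually_at_filter powr_diff intro!: always_eventually)
  then show ?thesis using True assms by (simp add: has_field_derivative_iff)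
next
  case False
  have "(abs has_real_derivative sgn t) (at t)"
    using has_derivative_norm[OF False]
    by (simp add: has_field_derivative_def inner_real_def mult_commute_abs abs_real_def[abs_def] real_norm_def[abs_def])
  from DERIV_chain2[OF has_real_derivative_powr this, of p] False
  show ?thesis by (simp add: mult.assoc)
qed

lemma continuous_on_abs_powr_sgn:
  fixes q :: real
  assumes "0 < q" "continuous_on S f"
  shows "continuous_on S (\<lambda>x. \<bar>f x\<bar> powr q * sgn (f x))"
proof -
  have eq: "(\<lambda>x. \<bar>f x\<bar> powr q * sgn (f x)) = (\<lambda>x. max 0 (f x) powr q - max 0 (- f x) powr q)"
    by (auto simp: fun_eq_iff sgn_if max_def)
  show ?thesis
    unfolding eq using assms by (intro continuous_on_diff continuous_on_powr' continuous_intros) auto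
qed

text \<open>The estimates use one continuous derivative, given by its Riesz vectors
  \<open>Du\<close>. Vanishing off \<open>K\<close> turns all integrals into integrals over the
  whole space, and since \<open>K\<close> avoids the origin every singular weight is continuous on
  \<open>K\<close>.\<close>

locale punctured_C1 =
  fixes p :: real and u :: "'a::euclidean_space \<Rightarrow> real" and Du :: "'a \<Rightarrow> 'a" and K :: "'a set"
  assumes p: "real DIM('a) < p"
    and compact_K: "compact K" and zero_notin_K: "0 \<notin> K"
    and u_eq_0: "\<And>x. x \<notin> K \<Longrightarrow> u x = 0" and Du_eq_0: "\<And>x. x \<notin> K \<Longrightarrow> Du x = 0"
    and der_u: "\<And>x. (u has_derivative (\<lambda>h. Du x \<bullet> h)) (at x)"
    and cont_Du: "continuous_on UNIV Du"
begin

text \<open>This number is at once the Hoelder exponent and, as (p - n) / p, the base of the Hardy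
  constant. The two roles meet in |x|^\<alpha>, for which the two sides of the Hardy inequality
  agree pointwise.\<close>

definition "\<alpha> = 1 - real DIM('a) / p"

definition "hardy_gap = (\<integral>x. norm (Du x) powr p \<partial>lborel)
  - \<alpha> powr p * (\<integral>x. \<bar>u x\<bar> powr p / norm x powr p \<partial>lborel)"

text \<open>\<open>p |u|\<^sup>p\<^sup>-\<^sup>2 u (x \<bullet> \<nabla>u)\<close>, the derivative of \<open>|u|\<^sup>p\<close> along the dilation flow.\<close>

definition "dil x = p * (\<bar>u x\<bar> powr (p - 1) * sgn (u x)) * (Du x \<bullet> x)"

lemma p_gt_1: "1 < p"
  using p DIM_positive[where 'a='a] by linarith

lemma \<alpha>_pos: "0 < \<alpha>"
  using p p_gt_1 by (simp add: \<alpha>_def)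

lemma p_\<alpha>: "p * \<alpha> = p - real DIM('a)"
  using p_gt_1 by (simp add: \<alpha>_def right_diff_distrib)

lemma cont_u: "continuous_on S u"
  by (intro continuous_at_imp_continuous_on ballI has_derivative_continuous[OF der_u])

lemma cont_Du': "continuous_on S Du"
  by (rule continuous_on_subset[OF cont_Du]) simp

lemma K_ne_0: "x \<in> K \<Longrightarrow> x \<noteq> 0"
  using zero_notin_K by blast

lemma integrable_vanishing_off_K:
  fixes f :: "'a \<Rightarrow> real"
  assumes "continuous_on K f" "\<And>x. x \<notin> K \<Longrightarrow> f x = 0"
  shows "integrable lborel f"
proof -
  have "integrable lborel (\<lambda>x. indicator K x *\<^sub>R f x)"
    by (rule borel_integrable_compact[OF compact_K assms(1)])
  also have "(\<lambda>x. indicator K x *\<^sub>R f x) = f"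
    using assms(2) by (fastforce simp: indicator_def fun_eq_iff)
  finally show ?thesis .
qed

lemma dil_eq_0: "x \<notin> K \<Longrightarrow> dil x = 0"
  by (simp add: dil_def Du_eq_0)

lemma cont_abs_u_powr: "continuous_on S (\<lambda>x. \<bar>u x\<bar> powr p)"
  using p_gt_1 by (intro continuous_on_powr' continuous_intros cont_u) auto

lemma cont_dil: "continuous_on S dil"
  unfolding dil_def using p_gt_1
  by (intro continuous_intros continuous_on_abs_powr_sgn cont_u cont_Du') auto

lemma cont_norm_powr: "continuous_on K (\<lambda>x. norm x powr q)"
  by (intro continuous_on_powr continuous_intros) (auto dest: K_ne_0)

lemma integrable_Du: "integrable lborel (\<lambda>x. norm (Du x) powr p)"
  using p_gt_1
  by (intro integrable_vanishing_off_K continuous_on_powr' continuous_intros cont_Du')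
     (auto simp: Du_eq_0)

lemma integrable_u: "integrable lborel (\<lambda>x. \<bar>u x\<bar> powr p / norm x powr p)"
  using p_gt_1
  by (intro integrable_vanishing_off_K continuous_on_divide cont_abs_u_powr cont_norm_powr)
     (auto simp: u_eq_0 dest: K_ne_0)

text \<open>The divergence theorem for the field \<phi> |u|^p x / |x|^p, whose divergence is the
  integrand because n - p = - p \<alpha>. It follows by letting g = \<phi> |x|^(n-p) |u|^p move with
  the dilations; the extra |x|^n compensates the weight of the invariant measure.\<close>

lemma
  fixes \<phi> \<theta> :: "'a \<Rightarrow> real"
  assumes \<phi>: "continuous_on K \<phi>" "continuous_on K \<theta>"
    and der_\<phi>: "\<And>x. x \<in> K \<Longrightarrow> ((\<lambda>s. \<phi> (exp s *\<^sub>R x)) has_real_derivative \<theta> x) (at 0)"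
  shows integrable_dilation_field: "integrable lborel
      (\<lambda>x. norm x powr - p * (\<phi> x * dil x + (\<theta> x - p * \<alpha> * \<phi> x) * \<bar>u x\<bar> powr p))"
    and integral_dilation_field_eq_0:
      "(\<integral>x. norm x powr - p * (\<phi> x * dil x + (\<theta> x - p * \<alpha> * \<phi> x) * \<bar>u x\<bar> powr p) \<partial>lborel) = 0"
proof -
  define n where "n = real DIM('a)"
  define B where "B x = \<phi> x * dil x + (\<theta> x - p * \<alpha> * \<phi> x) * \<bar>u x\<bar> powr p" for x
  define g where "g x = \<phi> x * (norm x powr (n - p) * \<bar>u x\<bar> powr p)" for x
  define G where "G x = norm x powr (n - p) * B x" for x
  have contB: "continuous_on K B"
    unfolding B_def by (intro continuous_intros \<phi> cont_dil cont_abs_u_powr)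
  have B0: "B x = 0" if "x \<notin> K" for x
    using that p_gt_1 by (simp add: B_def dil_eq_0 u_eq_0)
  show "integrable lborel (\<lambda>x. norm x powr - p * (\<phi> x * dil x + (\<theta> x - p * \<alpha> * \<phi> x) * \<bar>u x\<bar> powr p))"
    unfolding B_def[symmetric]
    by (intro integrable_vanishing_off_K continuous_intros cont_norm_powr contB) (simp add: B0)
  have "(\<integral>x. G x / norm x ^ DIM('a) \<partial>lborel) = 0"
  proof (rule integral_dilation_derivative_eq_0[OF compact_K zero_notin_K])
    show "continuous_on K g"
      unfolding g_def by (intro continuous_intros \<phi> cont_norm_powr cont_abs_u_powr)
    show "continuous_on K G"
      unfolding G_def by (intro continuous_intros cont_norm_powr contB)
    show g0: "g x = 0" if "x \<notin> K" for x using that p_gt_1 by (simp add: g_def u_eq_0)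
    show "G x = 0" if "x \<notin> K" for x using that by (simp add: G_def B0)
    show "((\<lambda>s. g (exp s *\<^sub>R x)) has_real_derivative G x) (at 0)" for x
    proof (cases "x \<in> K")
      case True
      then have x: "x \<noteq> 0" by (rule K_ne_0)
      have flow: "((\<lambda>s. exp s *\<^sub>R x) has_derivative (\<lambda>h. h *\<^sub>R x)) (at 0)"
        by (auto intro!: derivative_eq_intros)
      have "((\<lambda>s. u (exp s *\<^sub>R x)) has_derivative (\<lambda>h. Du x \<bullet> (h *\<^sub>R x))) (at 0)"
        using has_derivative_compose[OF flow, of u "\<lambda>h. Du x \<bullet> h"] der_u[of x] by simp
      then have "((\<lambda>s. u (exp s *\<^sub>R x)) has_real_derivative Du x \<bullet> x) (at 0)"
        by (simp add: has_field_derivative_def mult_commute_abs)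
      from DERIV_chain2[OF has_real_derivative_abs_powr[OF p_gt_1] this]
      have 1: "((\<lambda>s. \<bar>u (exp s *\<^sub>R x)\<bar> powr p) has_real_derivative dil x) (at 0)"
        by (simp add: dil_def)
      have "((\<lambda>s. exp (s * (n - p)) * norm x powr (n - p)) has_real_derivative
          (n - p) * norm x powr (n - p)) (at 0)"
        by (auto intro!: derivative_eq_intros)
      moreover have "norm (exp s *\<^sub>R x) powr (n - p) = exp (s * (n - p)) * norm x powr (n - p)" for s
        by (simp add: powr_mult exp_powr_real)
      ultimately have 2: "((\<lambda>s. norm (exp s *\<^sub>R x) powr (n - p)) has_real_derivative
          (n - p) * norm x powr (n - p)) (at 0)" by simp
      have "((\<lambda>s. g (exp s *\<^sub>R x)) has_real_derivative
         \<theta> x * (norm x powr (n - p) * \<bar>u x\<bar> powr p)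
         + ((n - p) * norm x powr (n - p) * \<bar>u x\<bar> powr p + dil x * norm x powr (n - p)) * \<phi> x) (at 0)"
        unfolding g_def using DERIV_mult[OF der_\<phi>[OF True] DERIV_mult[OF 2 1]] by simp
      then show ?thesis
        by (rule DERIV_cong) (simp add: G_def B_def p_\<alpha> n_def[symmetric], simp add: algebra_simps)
    next
      case False
      have "((\<lambda>s. exp s *\<^sub>R x) \<longlongrightarrow> exp 0 *\<^sub>R x) (at 0)" by (intro tendsto_intros)
      moreover have "open (- K)" using compact_K by (simp add: compact_imp_closed open_Compl)
      ultimately have "\<forall>\<^sub>F s in at 0. exp s *\<^sub>R x \<in> - K"
        using False by (intro topological_tendstoD) auto
      then have "\<forall>\<^sub>F s in nhds 0. g (exp s *\<^sub>R x) = 0"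
        using g0 False by (auto simp: eventually_at_filter elim!: eventually_mono)
      then have "((\<lambda>s. g (exp s *\<^sub>R x)) has_real_derivative 0) (at 0)"
        by (subst DERIV_cong_ev[OF refl _ refl, where g="\<lambda>_. 0"]) auto
      then show ?thesis using False by (simp add: G_def B0)
    qed
  qed
  moreover have "G x / norm x ^ DIM('a) = norm x powr - p * B x" for x
  proof (cases "x \<in> K")
    case True
    then have x: "0 < norm x" using K_ne_0 by simp
    have "norm x powr (n - p) = norm x powr n * norm x powr - p"
      by (simp add: powr_add[symmetric])
    moreover have "norm x powr n = norm x ^ DIM('a)"
      using x by (simp add: n_def powr_realpow)
    ultimately show ?thesis using x by (simp add: G_def)
  qed (simp add: G_def B0)
  ultimately show "(\<integral>x. norm x powr - p * (\<phi> x * dil x + (\<theta> x - p * \<alpha> * \<phi> x) * \<bar>u x\<bar> powr p) \<partial>lborel) = 0"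
    by (simp add: B_def)
qed

text \<open>Its integral is the Hardy difference whenever \<open>\<theta>\<close> is the derivative of \<open>\<phi>\<close> along the dilation
  flow: the last term is the divergence of \<open>\<alpha>\<^sup>p\<^sup>-\<^sup>1 \<phi> |u|\<^sup>p x / |x|\<^sup>p\<close>.\<close>

definition "gap_density \<phi> \<theta> x = norm (Du x) powr p - \<alpha> powr p * (\<bar>u x\<bar> powr p / norm x powr p)
  - \<alpha> powr (p - 1) * (norm x powr - p * (\<phi> * dil x + (\<theta> - p * \<alpha> * \<phi>) * \<bar>u x\<bar> powr p))"

lemma
  fixes \<phi> \<theta> :: "'a \<Rightarrow> real"
  assumes "continuous_on K \<phi>" "continuous_on K \<theta>"
    and "\<And>x. x \<in> K \<Longrightarrow> ((\<lambda>s. \<phi> (exp s *\<^sub>R x)) has_real_derivative \<theta> x) (at 0)"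
  shows integrable_gap_density: "integrable lborel (\<lambda>x. gap_density (\<phi> x) (\<theta> x) x)"
    and hardy_gap_eq: "hardy_gap = (\<integral>x. gap_density (\<phi> x) (\<theta> x) x \<partial>lborel)"
proof -
  have "has_bochner_integral lborel (\<lambda>x. gap_density (\<phi> x) (\<theta> x) x) (hardy_gap - \<alpha> powr (p - 1) * 0)"
    unfolding gap_density_def hardy_gap_def
    by (intro has_bochner_integral_diff has_bochner_integral_mult_right)
       (auto simp only: has_bochner_integral_iff integrable_dilation_field[OF assms]
         integral_dilation_field_eq_0[OF assms] integrable_Du integrable_u)
  then show "integrable lborel (\<lambda>x. gap_density (\<phi> x) (\<theta> x) x)"
    "hardy_gap = (\<integral>x. gap_density (\<phi> x) (\<theta> x) x \<partial>lborel)"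
    by (auto simp: has_bochner_integral_iff)
qed

lemma gap_density_eq_0: "x \<notin> K \<Longrightarrow> gap_density \<phi> \<theta> x = 0"
  using p_gt_1 by (simp add: gap_density_def u_eq_0 Du_eq_0 dil_eq_0)

text \<open>The tangent inequality for the radial derivative z of u. The tangent point is found by
  requiring the slope |t|^(p-1) sgn t to equal \<alpha>^(p-1) \<phi> |u|^(p-1) sgn u / |x|^(p-1);
  this forces t = \<alpha> \<phi>^(1/(p-1)) u / |x|, hence the exponent p / (p - 1) of \<phi> in the
  zero-order term.\<close>

lemma norm_Du_powr_ge:
  assumes x: "x \<noteq> 0" and \<phi>: "0 < \<phi>"
  shows "norm x powr - p * (\<alpha> powr (p - 1) * \<phi> * dil x
      - (p - 1) * \<alpha> powr p * \<phi> powr (p / (p - 1)) * \<bar>u x\<bar> powr p) \<le> norm (Du x) powr p"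
proof -
  define r where "r = norm x"
  have r: "0 < r" using x by (simp add: r_def)
  define \<mu> where "\<mu> = \<phi> powr (1 / (p - 1))"
  have \<mu>: "0 < \<mu>" "\<mu> powr (p - 1) = \<phi>" "\<mu> powr p = \<phi> powr (p / (p - 1))"
    using \<phi> p_gt_1 by (auto simp: \<mu>_def powr_powr)
  define z where "z = (Du x \<bullet> x) / r"
  define t where "t = \<alpha> * \<mu> * u x / r"
  have "\<bar>z\<bar> \<le> norm (Du x)"
    using Cauchy_Schwarz_ineq2[of "Du x" x] r by (simp add: z_def r_def field_simps)
  then have z: "\<bar>z\<bar> powr p \<le> norm (Du x) powr p"
    using p_gt_1 by (intro powr_mono2) auto
  have abs_t: "\<bar>t\<bar> = \<alpha> * \<mu> * \<bar>u x\<bar> / r"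
    using \<alpha>_pos \<mu>(1) r by (simp add: t_def abs_mult)
  have sgn_t: "sgn t = sgn (u x)"
    using \<alpha>_pos \<mu>(1) r by (simp add: t_def sgn_mult)
  have tp: "\<bar>t\<bar> powr p = \<alpha> powr p * \<phi> powr (p / (p - 1)) * \<bar>u x\<bar> powr p * r powr - p"
    unfolding abs_t using \<alpha>_pos \<mu> r
    by (simp add: powr_mult powr_divide powr_minus_divide)
  have tp1: "\<bar>t\<bar> powr (p - 1) = \<alpha> powr (p - 1) * \<phi> * \<bar>u x\<bar> powr (p - 1) * (r * r powr - p)"
  proof -
    have "r * r powr - p = 1 / r powr (p - 1)"
      using r by (simp add: powr_diff powr_minus field_simps)
    then show ?thesis
      unfolding abs_t using \<alpha>_pos \<mu>(1) r by (simp add: powr_mult powr_divide \<mu>(2))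
  qed
  have tt: "\<bar>t\<bar> powr (p - 1) * sgn t * t = \<bar>t\<bar> powr p"
    by (cases t "0::real" rule: linorder_cases) (auto simp: powr_diff)
  have "\<bar>t\<bar> powr (p - 1) * sgn t * z * p = r powr - p * (\<alpha> powr (p - 1) * \<phi> * dil x)"
    unfolding tp1 sgn_t using r by (simp add: z_def dil_def)
  moreover have "p * \<bar>t\<bar> powr (p - 1) * sgn t * (z - t)
      = \<bar>t\<bar> powr (p - 1) * sgn t * z * p - p * (\<bar>t\<bar> powr (p - 1) * sgn t * t)"
    by (simp add: algebra_simps)
  ultimately have "r powr - p * (\<alpha> powr (p - 1) * \<phi> * dil x) - (p - 1) * \<bar>t\<bar> powr p \<le> \<bar>z\<bar> powr p"
    using powr_ge_tangent[OF p_gt_1, of t z] unfolding tt by (simp add: left_diff_distrib)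
  with z show ?thesis unfolding tp r_def[symmetric] by (simp add: algebra_simps)
qed

text \<open>The \<open>dil\<close> terms cancel, and the remaining coefficient p (1 - \<psi>) - 1 -
  (p - 1) (1 - \<psi>)^(p/(p-1)) vanishes at \<psi> = 0 together with its first derivative. A bend
  \<psi> thus loses only a multiple of \<psi>^2, while its derivative - \<theta> enters
  linearly.\<close>

lemma gap_density_ge:
  assumes x: "x \<noteq> 0" and \<psi>: "\<bar>\<psi>\<bar> < 1"
  shows "\<alpha> powr (p - 1) * (- \<theta> - (p - 1) * \<alpha> * ((p / (p - 1))\<^sup>2 * 2 powr (p / (p - 1))) * \<psi>\<^sup>2)
      * (\<bar>u x\<bar> powr p / norm x powr p) \<le> gap_density (1 - \<psi>) \<theta> x"
proof -
  define q where "q = p / (p - 1)"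
  define L where "L = q\<^sup>2 * 2 powr q"
  define v where "v = \<bar>u x\<bar> powr p"
  define R where "R = norm x powr - p"
  define A where "A = \<alpha> powr (p - 1)"
  have q: "1 < q" "(p - 1) * q = p" using p_gt_1 by (auto simp: q_def)
  have A\<alpha>: "\<alpha> powr p = A * \<alpha>" using \<alpha>_pos by (simp add: A_def powr_diff)
  have div: "w / norm x powr p = w * R" for w by (simp add: R_def powr_minus divide_inverse)
  have nonneg: "0 \<le> v" "0 \<le> R" "0 < A" using \<alpha>_pos by (auto simp: v_def R_def A_def)
  have "(1 - \<psi>) powr q \<le> 1 + q * ((1 - \<psi>) - 1) + L * ((1 - \<psi>) - 1)\<^sup>2"
    unfolding L_def using \<psi> q by (intro powr_le_second_order) auto
  then have "(p - 1) * (1 - \<psi>) powr q \<le> (p - 1) * (1 - q * \<psi> + L * \<psi>\<^sup>2)"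
    using p_gt_1 by (intro mult_left_mono) auto
  also have "\<dots> = (p - 1) - p * \<psi> + (p - 1) * L * \<psi>\<^sup>2"
    using q(2) by (simp add: algebra_simps)
  finally have 1: "(p - 1) * (1 - \<psi>) powr q \<le> (p - 1) - p * \<psi> + (p - 1) * L * \<psi>\<^sup>2" .
  have "R * (A * (1 - \<psi>) * dil x - (p - 1) * (A * \<alpha>) * (1 - \<psi>) powr q * v) \<le> norm (Du x) powr p"
    using norm_Du_powr_ge[OF x, of "1 - \<psi>"] \<psi> by (simp add: R_def A_def[symmetric] A\<alpha> q_def v_def)
  then have "gap_density (1 - \<psi>) \<theta> x \<ge>
      R * (A * (1 - \<psi>) * dil x - (p - 1) * (A * \<alpha>) * (1 - \<psi>) powr q * v) - A * \<alpha> * (v * R)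
      - A * (R * ((1 - \<psi>) * dil x + (\<theta> - p * \<alpha> * (1 - \<psi>)) * v))"
    unfolding gap_density_def div A\<alpha> A_def[symmetric] v_def[symmetric] R_def[symmetric] by simp
  also have "R * (A * (1 - \<psi>) * dil x - (p - 1) * (A * \<alpha>) * (1 - \<psi>) powr q * v) - A * \<alpha> * (v * R)
      - A * (R * ((1 - \<psi>) * dil x + (\<theta> - p * \<alpha> * (1 - \<psi>)) * v))
      = A * (- \<theta> + \<alpha> * (p * (1 - \<psi>) - 1 - (p - 1) * (1 - \<psi>) powr q)) * (v * R)"
    by (simp add: algebra_simps)
  finally have 2: "A * (- \<theta> + \<alpha> * (p * (1 - \<psi>) - 1 - (p - 1) * (1 - \<psi>) powr q)) * (v * R)
      \<le> gap_density (1 - \<psi>) \<theta> x" .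
  have "\<alpha> * (- (p - 1) * L * \<psi>\<^sup>2) \<le> \<alpha> * (p * (1 - \<psi>) - 1 - (p - 1) * (1 - \<psi>) powr q)"
    using 1 \<alpha>_pos by (intro mult_left_mono) (auto simp: algebra_simps)
  from add_left_mono[OF this, of "- \<theta>"] have "A * (- \<theta> + \<alpha> * (- (p - 1) * L * \<psi>\<^sup>2)) * (v * R)
      \<le> A * (- \<theta> + \<alpha> * (p * (1 - \<psi>) - 1 - (p - 1) * (1 - \<psi>) powr q)) * (v * R)"
    using nonneg by (intro mult_right_mono[of _ _ "v * R"] mult_left_mono[of _ _ A]) auto
  with 2 show ?thesis unfolding div A_def[symmetric] v_def[symmetric] L_def[symmetric] q_def[symmetric]
    by (simp add: algebra_simps)
qed

text \<open>The field is the one with \<phi> = 1, but its \<open>dil\<close> term is estimated by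
  \<open>norm_Du_powr_ge\<close> with \<phi> = 2. Halved, that inequality spends only half of
  |Du|^p, so the other half survives at the cost of a multiple of |u|^p / |x|^p.\<close>

lemma gap_density_0_ge:
  assumes x: "x \<noteq> 0"
  shows "norm (Du x) powr p / 2 - (p - 1) * \<alpha> powr p * 2 powr (p / (p - 1)) * (\<bar>u x\<bar> powr p / norm x powr p)
    \<le> gap_density 1 0 x"
proof -
  define v where "v = \<bar>u x\<bar> powr p"
  define R where "R = norm x powr - p"
  define A where "A = \<alpha> powr (p - 1)"
  define T where "T = 2 powr (p / (p - 1))"
  have A\<alpha>: "\<alpha> powr p = A * \<alpha>" using \<alpha>_pos by (simp add: A_def powr_diff)
  have div: "w / norm x powr p = w * R" for w by (simp add: R_def powr_minus divide_inverse)
  have nonneg: "0 \<le> v" "0 \<le> R" "0 < A" "0 \<le> T" using \<alpha>_pos by (auto simp: v_def R_def A_def T_def)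
  have "R * (A * 2 * dil x - (p - 1) * (A * \<alpha>) * T * v) \<le> norm (Du x) powr p"
    using norm_Du_powr_ge[OF x, of 2] by (simp add: R_def A_def[symmetric] A\<alpha> T_def v_def)
  moreover have "gap_density 1 0 x = norm (Du x) powr p - R * A * dil x + (p - 1) * (A * \<alpha> * v * R)"
    unfolding gap_density_def div A\<alpha> A_def[symmetric] v_def[symmetric] R_def[symmetric]
    by (simp add: algebra_simps)
  moreover have "0 \<le> (p - 1) * (A * \<alpha> * v * R)" "0 \<le> (p - 1) * (A * \<alpha> * v * R) * T"
    using nonneg \<alpha>_pos p_gt_1 by auto
  ultimately show ?thesis unfolding div A\<alpha> v_def[symmetric] T_def[symmetric]
    by (simp add: algebra_simps)
qed

end

section \<open>The Hardy difference controls dyadic annuli\<close>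

text \<open>The size \<kappa> = 1 / (2 + M) of the bend, where M is the coefficient of \<psi>^2 in
  \<open>gap_density_ge\<close>. The 2 gives \<kappa> \<le> 1 / 2, hence |\<psi>| < 1, and M gives M
  \<kappa> \<le> 1.\<close>

definition log_hardy_rate :: "real \<Rightarrow> real \<Rightarrow> real" where
  "log_hardy_rate a p = 1 / (2 + (p - 1) * a * ((p / (p - 1))\<^sup>2 * 2 powr (p / (p - 1))))"

definition log_hardy_const :: "real \<Rightarrow> real \<Rightarrow> real" where
  "log_hardy_const a p = 10 / (log_hardy_rate a p * a powr (p - 1))"

text \<open>The factors 2 undo the half of |Du|^p that is kept in
  \<open>gap_density_0_ge\<close>.\<close>

definition log_gradient_const :: "real \<Rightarrow> real \<Rightarrow> real" where
  "log_gradient_const a p = 2 + 2 * ((p - 1) * a powr p * 2 powr (p / (p - 1))) * log_hardy_const a p"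

lemma log_hardy_rate_bounds:
  assumes "0 < a" "1 < p"
  shows "0 < log_hardy_rate a p" "log_hardy_rate a p \<le> 1 / 2"
    "(p - 1) * a * ((p / (p - 1))\<^sup>2 * 2 powr (p / (p - 1))) * log_hardy_rate a p \<le> 1"
proof -
  define M where "M = (p - 1) * a * ((p / (p - 1))\<^sup>2 * 2 powr (p / (p - 1)))"
  have M: "0 \<le> M" using assms by (simp add: M_def)
  have eq: "log_hardy_rate a p = 1 / (2 + M)" by (simp add: log_hardy_rate_def M_def)
  show "0 < log_hardy_rate a p" "log_hardy_rate a p \<le> 1 / 2"
    using M by (auto simp: eq field_simps)
  show "(p - 1) * a * ((p / (p - 1))\<^sup>2 * 2 powr (p / (p - 1))) * log_hardy_rate a p \<le> 1"
    unfolding eq M_def[symmetric] using M by (simp add: field_simps)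
qed

lemma log_hardy_const_pos:
  assumes "0 < a" "1 < p"
  shows "0 < log_hardy_const a p" "0 < log_gradient_const a p"
proof -
  show 1: "0 < log_hardy_const a p"
    using assms log_hardy_rate_bounds(1)[OF assms] by (simp add: log_hardy_const_def)
  show "0 < log_gradient_const a p"
    unfolding log_gradient_const_def using assms 1 by (intro add_pos_nonneg) auto
qed

text \<open>The product is half the derivative of the switch s^2 / (s^2 + r^2) along the dilations.
  It peaks at s = r; on the given range its least value is 4 / 25, attained at s = r / 2, so 1 / 10
  is a convenient lower bound.\<close>

lemma cutoff_ge:
  fixes r s :: real
  assumes "0 < r" "r / 2 \<le> s" "s \<le> 3 * r / 2"
  shows "1 / 10 \<le> (s\<^sup>2 / (s\<^sup>2 + r\<^sup>2)) * (1 - s\<^sup>2 / (s\<^sup>2 + r\<^sup>2))"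
proof -
  define R where "R = s\<^sup>2"
  define T where "T = r\<^sup>2"
  have T: "0 < T" using assms by (simp add: T_def)
  have "(r / 2)\<^sup>2 \<le> s\<^sup>2" "s\<^sup>2 \<le> (3 * r / 2)\<^sup>2" using assms by (auto intro: power_mono)
  then have R: "T / 4 \<le> R" "R \<le> 9 * T / 4" by (auto simp: R_def T_def power_mult_distrib power_divide)
  have "0 \<le> (R - T / 4) * (9 * T / 4 - R)" using R by simp
  moreover have "(R - T / 4) * (9 * T / 4 - R) = 5 / 2 * (R * T) - 9 / 16 * (T * T) - R * R"
    by (simp add: field_simps)
  ultimately have "R * R \<le> 5 / 2 * (R * T) - 9 / 16 * (T * T)" by linarith
  moreover have "T / 4 * T \<le> R * T" using R T by (intro mult_right_mono) auto
  moreover have "0 < T * T" using T by simp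
  ultimately have "(R + T) * (R + T) \<le> 10 * (R * T)" by (simp add: algebra_simps)
  moreover have RT: "0 < R + T" using R T by linarith
  moreover have "R / (R + T) * (1 - R / (R + T)) = R * T / ((R + T) * (R + T))"
    using RT by (simp add: field_simps)
  ultimately show ?thesis
    unfolding R_def[symmetric] T_def[symmetric] by (simp add: divide_le_eq le_divide_eq)
qed

context punctured_C1
begin

text \<open>The field strength is 1 - \<kappa> \<eta> / l. Along the dilations l decreases at unit
  rate and \<eta> has derivative 2 \<eta> (1 - \<eta>), so - \<theta> consists of 2 \<kappa> \<eta>
  (1 - \<eta>) / l and \<kappa> \<eta> / l^2. The second part absorbs the quadratic loss everywhere;
  the first is nonnegative on \<open>K\<close> and at least of order 1 / (1 + log (d / r)) on
  \<open>B\<close>.\<close>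

lemma hardy_gap_ge_annulus:
  assumes d: "\<And>x. x \<in> K \<Longrightarrow> norm x \<le> d" and r: "0 < r" "r \<le> d"
    and [measurable]: "B \<in> sets borel" and B: "\<And>x. x \<in> B \<Longrightarrow> r / 2 \<le> norm x \<and> norm x \<le> 3 * r / 2"
  shows "(\<integral>x. indicator B x * (\<bar>u x\<bar> powr p / norm x powr p) \<partial>lborel)
      \<le> log_hardy_const \<alpha> p * (1 + ln (d / r)) * hardy_gap"
proof -
  define \<kappa> where "\<kappa> = log_hardy_rate \<alpha> p"
  define M where "M = (p - 1) * \<alpha> * ((p / (p - 1))\<^sup>2 * 2 powr (p / (p - 1)))"
  have \<kappa>: "0 < \<kappa>" "\<kappa> \<le> 1 / 2" "M * \<kappa> \<le> 1"
    using log_hardy_rate_bounds[OF \<alpha>_pos p_gt_1] by (auto simp: \<kappa>_def M_def)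
  have M0: "0 \<le> M" using \<alpha>_pos p_gt_1 by (simp add: M_def)
  define l where "l x = 1 + ln d - ln (norm x)" for x :: 'a
  define \<eta> where "\<eta> x = (norm x)\<^sup>2 / ((norm x)\<^sup>2 + r\<^sup>2)" for x :: 'a
  define \<psi> where "\<psi> x = \<kappa> * \<eta> x / l x" for x
  define \<theta> where "\<theta> x = - \<kappa> * (2 * (\<eta> x * (1 - \<eta> x)) / l x + \<eta> x / (l x)\<^sup>2)" for x
  define w where "w x = \<bar>u x\<bar> powr p / norm x powr p" for x
  have d0: "0 < d" using r by simp
  have l: "1 \<le> l x" if "x \<in> K" for x
    using d[OF that] K_ne_0[OF that] d0 by (simp add: l_def)
  have \<eta>: "0 \<le> \<eta> x" "\<eta> x \<le> 1" for x
    using r by (auto simp: \<eta>_def divide_le_eq_1 add_nonneg_pos)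
  have rr: "0 < (norm x)\<^sup>2 + r\<^sup>2" for x :: 'a using r by (simp add: add_nonneg_pos)
  have cont: "continuous_on K l" "continuous_on K \<eta>"
    unfolding l_def \<eta>_def using rr by (auto intro!: continuous_intros dest: K_ne_0 simp: less_imp_neq[THEN not_sym])
  have contpsi: "continuous_on K (\<lambda>x. 1 - \<psi> x)" "continuous_on K \<theta>"
    unfolding \<psi>_def \<theta>_def using l by (intro continuous_intros cont; force)+
  have der: "((\<lambda>s. 1 - \<psi> (exp s *\<^sub>R x)) has_real_derivative \<theta> x) (at 0)" if "x \<in> K" for x
  proof -
    have x: "0 < norm x" using K_ne_0[OF that] by simp
    have lx: "l x \<noteq> 0" using l[OF that] by simp
    have "l (exp s *\<^sub>R x) = l x - s" for s
      using x by (simp add: l_def ln_mult)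
    then have 1: "((\<lambda>s. l (exp s *\<^sub>R x)) has_real_derivative - 1) (at 0)"
      by (auto intro!: derivative_eq_intros)
    have eq: "\<eta> (exp s *\<^sub>R x) = exp (2 * s) * (norm x)\<^sup>2 / (exp (2 * s) * (norm x)\<^sup>2 + r\<^sup>2)" for s
      by (simp add: \<eta>_def power_mult_distrib exp_double)
    have "((\<lambda>s. \<eta> (exp s *\<^sub>R x)) has_real_derivative
       (2 * (norm x)\<^sup>2 * ((norm x)\<^sup>2 + r\<^sup>2) - (norm x)\<^sup>2 * (2 * (norm x)\<^sup>2)) / (((norm x)\<^sup>2 + r\<^sup>2) * ((norm x)\<^sup>2 + r\<^sup>2))) (at 0)"
      unfolding eq using rr[of x] by (auto intro!: derivative_eq_intros)
    moreover have "(2 * (norm x)\<^sup>2 * ((norm x)\<^sup>2 + r\<^sup>2) - (norm x)\<^sup>2 * (2 * (norm x)\<^sup>2)) / (((norm x)\<^sup>2 + r\<^sup>2) * ((norm x)\<^sup>2 + r\<^sup>2))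
        = 2 * (\<eta> x * (1 - \<eta> x))"
    proof -
      have 1: "1 - \<eta> x = r\<^sup>2 / ((norm x)\<^sup>2 + r\<^sup>2)" using less_imp_neq[OF rr[of x]]
        by (simp add: \<eta>_def eq_divide_eq left_diff_distrib)
      have 2: "2 * (norm x)\<^sup>2 * ((norm x)\<^sup>2 + r\<^sup>2) - (norm x)\<^sup>2 * (2 * (norm x)\<^sup>2) = 2 * ((norm x)\<^sup>2 * r\<^sup>2)"
        by (simp add: algebra_simps)
      show ?thesis unfolding 1 2 by (simp add: \<eta>_def)
    qed
    ultimately have 2: "((\<lambda>s. \<eta> (exp s *\<^sub>R x)) has_real_derivative 2 * (\<eta> x * (1 - \<eta> x))) (at 0)"
      by simp
    have "((\<lambda>s. \<kappa> * (\<eta> (exp s *\<^sub>R x) / l (exp s *\<^sub>R x))) has_real_derivative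
        \<kappa> * ((2 * (\<eta> x * (1 - \<eta> x)) * l x - \<eta> x * (- 1)) / (l x * l x))) (at 0)"
      using DERIV_cmult[OF DERIV_divide[OF 2 1], of \<kappa>] lx by simp
    from DERIV_diff[OF DERIV_const[of 1] this]
    show ?thesis unfolding \<psi>_def times_divide_eq_right
      by (rule DERIV_cong) (use lx in \<open>simp add: \<theta>_def power2_eq_square field_simps\<close>)
  qed
  have \<psi>1: "\<bar>\<psi> x\<bar> < 1" if "x \<in> K" for x
  proof -
    have "\<kappa> * \<eta> x \<le> (1 / 2) * 1" using \<kappa> \<eta>[of x] by (intro mult_mono) auto
    then have "\<kappa> * \<eta> x < l x" using l[OF that] by linarith
    then show ?thesis using \<kappa> \<eta>[of x] l[OF that] by (simp add: \<psi>_def)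
  qed
  have ge: "\<alpha> powr (p - 1) * (2 * \<kappa> * (\<eta> x * (1 - \<eta> x)) / l x) * w x \<le> gap_density (1 - \<psi> x) (\<theta> x) x"
    if "x \<in> K" for x
  proof -
    \<comment> \<open>Both M \<psi>^2 and the second part of - \<theta> are of order \<eta> / l^2;
      the choice of \<kappa> and \<eta> \<le> 1 make the former the smaller one.\<close>
    have "M * (\<psi> x)\<^sup>2 = (M * \<kappa>) * (\<eta> x * \<eta> x) * (\<kappa> / (l x)\<^sup>2)"
      by (simp add: \<psi>_def power2_eq_square)
    also have "\<dots> \<le> 1 * (\<eta> x * 1) * (\<kappa> / (l x)\<^sup>2)"
      using \<kappa> \<eta>[of x] M0 by (intro mult_right_mono mult_mono) auto
    finally have "M * (\<psi> x)\<^sup>2 \<le> \<kappa> * (\<eta> x / (l x)\<^sup>2)" by (simp add: mult_ac)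
    moreover have "- \<theta> x = \<kappa> * (2 * (\<eta> x * (1 - \<eta> x)) / l x) + \<kappa> * (\<eta> x / (l x)\<^sup>2)"
      unfolding \<theta>_def by (simp only: distrib_left[symmetric] mult_minus_left minus_minus)
    moreover have "\<kappa> * (2 * (\<eta> x * (1 - \<eta> x)) / l x) = 2 * \<kappa> * (\<eta> x * (1 - \<eta> x)) / l x"
      by simp
    ultimately have "2 * \<kappa> * (\<eta> x * (1 - \<eta> x)) / l x \<le> - \<theta> x - M * (\<psi> x)\<^sup>2"
      by linarith
    then have "\<alpha> powr (p - 1) * (2 * \<kappa> * (\<eta> x * (1 - \<eta> x)) / l x) * w x
        \<le> \<alpha> powr (p - 1) * (- \<theta> x - M * (\<psi> x)\<^sup>2) * w x"
      by (intro mult_right_mono mult_left_mono) (auto simp: w_def)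
    then show ?thesis
      using gap_density_ge[OF K_ne_0[OF that] \<psi>1[OF that], of "\<theta> x"] by (simp add: M_def w_def)
  qed
  \<comment> \<open>The 1 / 10 comes from \<open>cutoff_ge\<close>. The 2 from the derivative of
    \<eta> cancels against l \<le> 2 (1 + log (d / r)) on \<open>B\<close>, where |x| \<ge> r / 2
    costs at most log 2 < 1.\<close>
  define c where "c = \<alpha> powr (p - 1) * \<kappa> / 10 / (1 + ln (d / r))"
  have L1: "1 \<le> 1 + ln (d / r)" using r by (simp add: ln_div)
  have le: "c * (indicator B x * w x) \<le> gap_density (1 - \<psi> x) (\<theta> x) x" for x
  proof (cases "x \<in> K")
    case True
    have w: "0 \<le> w x" by (simp add: w_def)
    show ?thesis
    proof (cases "x \<in> B")
      case xB: True
      have "ln (r / 2) \<le> ln (norm x)" using B[OF xB] r K_ne_0[OF True] by (intro ln_mono) auto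
      then have "l x \<le> 1 + ln (d / r) + ln 2" using r by (simp add: l_def ln_div)
      also have "\<dots> \<le> (1 + ln (d / r)) + (1 + ln (d / r))"
        by (intro add_left_mono order_trans[OF less_imp_le[OF ln_2_less_1] L1])
      also have "\<dots> = 2 * (1 + ln (d / r))" by (rule mult_2[symmetric])
      finally have lx: "l x \<le> 2 * (1 + ln (d / r))" .
      have "1 / 10 \<le> \<eta> x * (1 - \<eta> x)"
        unfolding \<eta>_def using B[OF xB] r by (intro cutoff_ge) auto
      then have "2 * \<kappa> * (1 / 10) \<le> 2 * \<kappa> * (\<eta> x * (1 - \<eta> x))"
        using \<kappa> by (intro mult_left_mono) auto
      then have "2 * \<kappa> * (1 / 10) / (2 * (1 + ln (d / r))) \<le> 2 * \<kappa> * (\<eta> x * (1 - \<eta> x)) / l x"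
        using l[OF True] lx \<kappa> \<eta>[of x] by (intro frac_le) auto
      moreover have "c = \<alpha> powr (p - 1) * (2 * \<kappa> * (1 / 10) / (2 * (1 + ln (d / r))))"
        using L1 by (simp add: c_def field_simps)
      ultimately have "c * w x \<le> \<alpha> powr (p - 1) * (2 * \<kappa> * (\<eta> x * (1 - \<eta> x)) / l x) * w x"
        using w by (simp only:) (intro mult_right_mono mult_left_mono; simp)
      then show ?thesis using ge[OF True] xB by simp
    next
      case False
      have "0 \<le> \<alpha> powr (p - 1) * (2 * \<kappa> * (\<eta> x * (1 - \<eta> x)) / l x) * w x"
        using l[OF True] \<kappa> \<eta>[of x] w by (intro mult_nonneg_nonneg divide_nonneg_nonneg) auto
      then show ?thesis using ge[OF True] False by simp
    qed
  next
    case False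
    then show ?thesis using p_gt_1 by (simp add: gap_density_eq_0 w_def u_eq_0)
  qed
  have "integrable lborel (\<lambda>x. indicator B x *\<^sub>R w x)"
    unfolding w_def by (intro integrable_mult_indicator integrable_u) simp
  then have "integrable lborel (\<lambda>x. c * (indicator B x * w x))"
    by (intro integrable_mult_right) simp
  then have "(\<integral>x. c * (indicator B x * w x) \<partial>lborel) \<le> (\<integral>x. gap_density (1 - \<psi> x) (\<theta> x) x \<partial>lborel)"
    by (rule integral_mono[OF _ integrable_gap_density[OF contpsi der] le])
  also have "\<dots> = hardy_gap"
    by (rule hardy_gap_eq[OF contpsi der, symmetric])
  finally have "(\<integral>x. c * (indicator B x * w x) \<partial>lborel) \<le> hardy_gap" .
  then have *: "c * (\<integral>x. indicator B x * w x \<partial>lborel) \<le> hardy_gap" by simp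
  have c0: "0 < c" using \<alpha>_pos \<kappa> L1 by (simp add: c_def)
  have "(\<integral>x. indicator B x * w x \<partial>lborel) \<le> (1 / c) * hardy_gap"
    using * c0 by (simp add: field_simps)
  also have "1 / c = log_hardy_const \<alpha> p * (1 + ln (d / r))"
    using L1 by (simp add: c_def log_hardy_const_def \<kappa>_def)
  finally show ?thesis by (simp add: w_def)
qed

lemma
  shows integrable_gap_density_0: "integrable lborel (gap_density 1 0)"
    and hardy_gap_eq_0: "hardy_gap = (\<integral>x. gap_density 1 0 x \<partial>lborel)"
  using integrable_gap_density[of "\<lambda>_. 1" "\<lambda>_. 0"] hardy_gap_eq[of "\<lambda>_. 1" "\<lambda>_. 0"] by auto

lemma gap_density_0_nonneg: "0 \<le> gap_density 1 0 x"
  using gap_density_ge[of x 0 0] gap_density_eq_0[of x] K_ne_0[of x] by (cases "x \<in> K") auto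

lemma hardy_gap_nonneg: "0 \<le> hardy_gap"
  unfolding hardy_gap_eq_0 by (intro Bochner_Integration.integral_nonneg gap_density_0_nonneg)

text \<open>On \<open>B\<close> the density for \<phi> = 1 controls half of |Du|^p up to a multiple
  of |u|^p / |x|^p, which was just estimated; elsewhere it is nonnegative and may be
  dropped.\<close>

lemma gradient_annulus_le:
  assumes d: "\<And>x. x \<in> K \<Longrightarrow> norm x \<le> d" and r: "0 < r" "r \<le> d"
    and [measurable]: "B \<in> sets borel" and B: "\<And>x. x \<in> B \<Longrightarrow> r / 2 \<le> norm x \<and> norm x \<le> 3 * r / 2"
  shows "(\<integral>x. indicator B x * norm (Du x) powr p \<partial>lborel)
      \<le> log_gradient_const \<alpha> p * (1 + ln (d / r)) * hardy_gap"
proof -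
  define c where "c = (p - 1) * \<alpha> powr p * 2 powr (p / (p - 1))"
  have c0: "0 \<le> c" using p_gt_1 by (simp add: c_def)
  define w where "w x = \<bar>u x\<bar> powr p / norm x powr p" for x
  have i: "integrable lborel (\<lambda>x. indicator B x * w x)" "integrable lborel (\<lambda>x. indicator B x * norm (Du x) powr p)"
    using integrable_mult_indicator[OF _ integrable_u, of B] integrable_mult_indicator[OF _ integrable_Du, of B]
    by (auto simp: w_def)
  have L1: "1 \<le> 1 + ln (d / r)" using r by (simp add: ln_div)
  have "(\<integral>x. indicator B x * norm (Du x) powr p / 2 - c * (indicator B x * w x) \<partial>lborel) \<le> hardy_gap"
    unfolding hardy_gap_eq_0
  proof (intro integral_mono integrable_gap_density_0 Bochner_Integration.integrable_diff integrable_mult_right integrable_divide i)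
    fix x
    show "indicator B x * norm (Du x) powr p / 2 - c * (indicator B x * w x) \<le> gap_density 1 0 x"
    proof (cases "x \<in> K \<and> x \<in> B")
      case True
      then show ?thesis using gap_density_0_ge[of x] K_ne_0[of x] by (simp add: c_def w_def)
    next
      case False
      then have "indicator B x * norm (Du x) powr p / 2 - c * (indicator B x * w x) = 0"
        using p_gt_1 by (auto simp: u_eq_0 Du_eq_0 w_def)
      with gap_density_0_nonneg[of x] show ?thesis by linarith
    qed
  qed
  then have "(\<integral>x. indicator B x * norm (Du x) powr p \<partial>lborel) / 2 - c * (\<integral>x. indicator B x * w x \<partial>lborel) \<le> hardy_gap"
    using i by simp
  moreover have "c * (\<integral>x. indicator B x * w x \<partial>lborel) \<le> c * (log_hardy_const \<alpha> p * (1 + ln (d / r)) * hardy_gap)"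
    unfolding w_def by (intro mult_left_mono c0 hardy_gap_ge_annulus[OF d r assms(4) B])
  moreover have "1 * hardy_gap \<le> (1 + ln (d / r)) * hardy_gap"
    using L1 hardy_gap_nonneg by (intro mult_right_mono)
  ultimately show ?thesis
    unfolding log_gradient_const_def c_def[symmetric] by (simp add: algebra_simps)
qed

end

section \<open>Pointwise and Hoelder bounds\<close>

text \<open>Up to a constant, t^\<beta> (1 + log (d / t)) is increasing, because a power beats the
  logarithm: with \<tau> = t / \<rho> the claim reduces to - \<tau>^\<beta> log \<tau> \<le> 1 /
  \<beta>. It transfers a bound at the scale |x| to a larger scale |x - y|.\<close>

lemma powr_mult_log_le:
  fixes t \<rho> \<beta> d :: real
  assumes \<beta>: "0 < \<beta>" and t: "0 < t" "t \<le> 3 * \<rho>" and \<rho>: "0 < \<rho>" "\<rho> \<le> d"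
  shows "t powr \<beta> * (1 + ln (d / t)) \<le> (3 powr \<beta> + 1 / \<beta>) * (\<rho> powr \<beta> * (1 + ln (d / \<rho>)))"
proof -
  define \<tau> where "\<tau> = t / \<rho>"
  define L where "L = 1 + ln (d / \<rho>)"
  have d: "0 < d" using \<rho> by simp
  have L: "1 \<le> L" using \<rho> by (simp add: L_def ln_div)
  have \<tau>: "0 < \<tau>" "\<tau> \<le> 3" using t \<rho> by (auto simp: \<tau>_def field_simps)
  have t_eq: "t = \<tau> * \<rho>" using \<rho> by (simp add: \<tau>_def)
  define y where "y = \<tau> powr \<beta>"
  have y: "0 < y" using \<tau> by (simp add: y_def)
  have "ln (1 / y) \<le> 1 / y - 1" using y by (intro ln_le_minus_one) simp
  then have "y * (- ln y) \<le> y * (1 / y)" using y by (intro mult_left_mono) (auto simp: ln_div)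
  then have "y * (- (\<beta> * ln \<tau>)) \<le> 1" using y \<tau> by (simp add: y_def ln_powr)
  then have 1: "y * (- ln \<tau>) \<le> 1 / \<beta> * 1" using \<beta> by (simp add: field_simps)
  have "y \<le> 3 powr \<beta>" using \<tau> \<beta> unfolding y_def by (intro powr_mono2) auto
  then have 2: "y * L \<le> 3 powr \<beta> * L" using L by (intro mult_right_mono) auto
  have 3: "1 / \<beta> * 1 \<le> 1 / \<beta> * L" using L \<beta> by (intro mult_left_mono) auto
  have "y * (L - ln \<tau>) \<le> (3 powr \<beta> + 1 / \<beta>) * L"
    using 1 2 3 by (simp only: distrib_right right_diff_distrib)
  then have "\<rho> powr \<beta> * (y * (L - ln \<tau>)) \<le> \<rho> powr \<beta> * ((3 powr \<beta> + 1 / \<beta>) * L)"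
    by (intro mult_left_mono) auto
  moreover have "t powr \<beta> = y * \<rho> powr \<beta>" using \<tau> \<rho> by (simp add: t_eq y_def powr_mult)
  moreover have "1 + ln (d / t) = L - ln \<tau>"
    using d \<tau> \<rho> by (simp add: t_eq L_def ln_div ln_mult)
  ultimately show ?thesis unfolding L_def[symmetric] by (simp add: mult_ac)
qed

text \<open>Brings integral bounds into the form demanded by the Morrey estimates. For s = - n / p
  the power of \<rho> disappears, as needed for the gradient; for s = \<alpha> it is \<rho>^p, as
  needed for |u|^p, because n + p \<alpha> = p.\<close>

lemma measure_cball_mult_powr:
  fixes z :: "'a::euclidean_space"
  assumes "0 < \<rho>" "0 < p" "0 \<le> c"
  shows "measure lborel (cball z \<rho>) * (\<rho> powr s * (c / measure lborel (cball (0::'a) 1)) powr (1 / p)) powr p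
    = \<rho> powr (real DIM('a) + p * s) * c"
proof -
  define \<omega> where "\<omega> = measure lborel (cball (0::'a) 1)"
  have \<omega>: "0 < \<omega>" unfolding \<omega>_def by (rule content_cball_pos) simp
  have V: "measure lborel (cball z \<rho>) = \<rho> powr real DIM('a) * \<omega>"
    using assms content_ball_conv_unit_ball[of \<rho> z]
    by (simp add: \<omega>_def content_cball_conv_ball powr_realpow)
  show ?thesis
    unfolding V \<omega>_def[symmetric] using assms \<omega>
    by (simp add: powr_mult powr_powr powr_add mult.commute)
qed

definition morrey_const :: "real \<Rightarrow> real \<Rightarrow> real \<Rightarrow> real" where
  "morrey_const a p \<omega> = 8 / a * (log_gradient_const a p / \<omega>) powr (1 / p)"

definition pointwise_const :: "real \<Rightarrow> real \<Rightarrow> real \<Rightarrow> real" where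
  "pointwise_const a p \<omega> = 2 * (4 powr p * log_hardy_const a p / \<omega>) powr (1 / p)
     + 4 / a * (log_gradient_const a p / \<omega>) powr (1 / p)"

definition holder_const :: "real \<Rightarrow> real \<Rightarrow> real \<Rightarrow> real" where
  "holder_const a p \<omega> = morrey_const a p \<omega>
     + 2 * (pointwise_const a p \<omega> * (3 powr (p * a) + 1 / (p * a)) powr (1 / p))"

context punctured_C1
begin

definition "\<omega> = measure lborel (cball (0::'a) 1)"

lemma \<omega>_pos: "0 < \<omega>"
  unfolding \<omega>_def by (rule content_cball_pos) simp

lemma nn_integral_indicator_le:
  fixes f :: "'a \<Rightarrow> real"
  assumes "integrable lborel f" "\<And>x. 0 \<le> f x" "B \<in> sets borel"
    and "(\<integral>x. indicator B x * f x \<partial>lborel) \<le> c"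
  shows "(\<integral>\<^sup>+x. ennreal (indicator B x * f x) \<partial>lborel) \<le> ennreal c"
proof -
  have "integrable lborel (\<lambda>x. indicator B x * f x)"
    using integrable_mult_indicator[OF _ assms(1), of B] assms(3) by simp
  then have "(\<integral>\<^sup>+x. ennreal (indicator B x * f x) \<partial>lborel) = ennreal (\<integral>x. indicator B x * f x \<partial>lborel)"
    using assms(2) by (intro nn_integral_eq_integral) auto
  with assms(4) show ?thesis by (simp add: ennreal_leI)
qed

lemma cball_annulus:
  assumes "x \<noteq> 0" "s \<le> norm x / 2" "y \<in> cball x s"
  shows "norm x / 2 \<le> norm y \<and> norm y \<le> 3 * norm x / 2"
proof -
  have "norm (x - y) \<le> norm x / 2" using assms by (simp add: dist_norm)
  then show ?thesis using norm_triangle_ineq2[of x y] norm_triangle_ineq3[of x y] by linarith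
qed

text \<open>The ball of radius |x - y| about x stays in the annulus around |x|, and the logarithm
  only grows when |x| is replaced by |x - y|. The positive majorant Q of the Hardy difference
  appears because the Morrey estimates require m > 0.\<close>

lemma oscillation_near_le:
  assumes d: "\<And>x. x \<in> K \<Longrightarrow> norm x \<le> d" and x: "x \<noteq> 0" "norm x \<le> d"
    and y: "y \<noteq> x" "norm (x - y) \<le> norm x / 2"
    and Q: "0 < Q" "hardy_gap \<le> Q"
  shows "\<bar>u x - u y\<bar> \<le> morrey_const \<alpha> p \<omega> * (norm (x - y) powr \<alpha> *
    ((1 + ln (d / norm (x - y))) * Q) powr (1 / p))"
proof -
  define \<rho> where "\<rho> = norm (x - y)"
  define c where "c = log_gradient_const \<alpha> p"
  define N where "N = (1 + ln (d / \<rho>)) * Q"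
  have \<rho>: "0 < \<rho>" "\<rho> \<le> norm x / 2" using x y by (auto simp: \<rho>_def)
  have \<rho>x: "\<rho> \<le> norm x" "\<rho> \<le> d" using \<rho> x by linarith+
  have c: "0 < c" using log_hardy_const_pos[OF \<alpha>_pos p_gt_1] by (simp add: c_def)
  have N: "0 < N" unfolding N_def using \<rho> \<rho>x x Q by (intro mult_pos_pos add_pos_nonneg ln_ge_zero) auto
  define m where "m = \<rho> powr (- (real DIM('a) / p)) * (c * N / \<omega>) powr (1 / p)"
  have m: "0 < m" using \<rho> c N \<omega>_pos by (simp add: m_def)
  have L: "1 + ln (d / norm x) \<le> 1 + ln (d / \<rho>)" "0 \<le> 1 + ln (d / norm x)"
    using \<rho> \<rho>x x by (auto intro!: ln_mono frac_le add_nonneg_nonneg ln_ge_zero)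
  have "(\<integral>w. indicator (cball x \<rho>) w * norm (Du w) powr p \<partial>lborel)
      \<le> c * (1 + ln (d / norm x)) * hardy_gap"
    unfolding c_def using x cball_annulus[OF x(1) \<rho>(2)] by (intro gradient_annulus_le[OF d]) auto
  also have "\<dots> = c * ((1 + ln (d / norm x)) * hardy_gap)" by simp
  also have "\<dots> \<le> c * N"
    unfolding N_def using L Q c hardy_gap_nonneg by (intro mult_left_mono mult_mono) auto
  also have "\<dots> = measure lborel (cball x \<rho>) * m powr p"
    unfolding m_def \<omega>_def using measure_cball_mult_powr[OF \<rho>(1), of p "c * N" x "- (real DIM('a) / p)"] c N p_gt_1 \<rho>
    by simp
  finally have "(\<integral>\<^sup>+w. ennreal (indicator (cball x \<rho>) w * norm (Du w) powr p) \<partial>lborel)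
      \<le> ennreal (measure lborel (cball x \<rho>) * m powr p)"
    by (intro nn_integral_indicator_le integrable_Du) auto
  then have "\<bar>u x - u y\<bar> \<le> 8 * \<rho> * m / \<alpha>"
    unfolding \<alpha>_def using \<rho>
    by (intro morrey_oscillation_le[OF p \<rho>(1) m der_u cont_Du]) (auto simp: \<rho>_def dist_norm)
  also have "8 * \<rho> * m / \<alpha> = 8 / \<alpha> * (\<rho> * \<rho> powr (- (real DIM('a) / p))) * (c / \<omega> * N) powr (1 / p)"
    by (simp add: m_def)
  also have "\<rho> * \<rho> powr (- (real DIM('a) / p)) = \<rho> powr \<alpha>"
    using \<rho> by (simp add: \<alpha>_def powr_diff powr_minus_divide)
  also have "(c / \<omega> * N) powr (1 / p) = (c / \<omega>) powr (1 / p) * N powr (1 / p)"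
    by (rule powr_mult)
  finally show ?thesis by (simp add: morrey_const_def c_def N_def \<rho>_def mult_ac)
qed

text \<open>On the ball of radius \<rho> = |x| / 2 about x the norm is at most 3 \<rho>, so the
  weight |w|^-p can be traded for (4 \<rho>)^-p. The annulus bounds then supply both means required
  by \<open>morrey_pointwise_le\<close>.\<close>

lemma abs_u_le:
  assumes d: "\<And>x. x \<in> K \<Longrightarrow> norm x \<le> d" and x: "x \<noteq> 0" "norm x \<le> d"
    and Q: "0 < Q" "hardy_gap \<le> Q"
  shows "\<bar>u x\<bar> \<le> pointwise_const \<alpha> p \<omega> * (norm x powr \<alpha> *
    ((1 + ln (d / norm x)) * Q) powr (1 / p))"
proof -
  define \<rho> where "\<rho> = norm x / 2"
  define c where "c = log_gradient_const \<alpha> p"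
  define c' where "c' = log_hardy_const \<alpha> p"
  define N where "N = (1 + ln (d / norm x)) * Q"
  have \<rho>: "0 < \<rho>" "\<rho> \<le> norm x / 2" using x by (auto simp: \<rho>_def)
  have c: "0 < c" "0 < c'" using log_hardy_const_pos[OF \<alpha>_pos p_gt_1] by (auto simp: c_def c'_def)
  have L: "0 < 1 + ln (d / norm x)" using x by (intro add_pos_nonneg ln_ge_zero) auto
  have N: "0 < N" using L Q by (simp add: N_def)
  have NQ: "(1 + ln (d / norm x)) * hardy_gap \<le> N"
    unfolding N_def using L Q by (intro mult_left_mono) auto
  note annulus = cball_annulus[OF x(1) \<rho>(2)]
  define m where "m = \<rho> powr (- (real DIM('a) / p)) * (c * N / \<omega>) powr (1 / p)"
  define m' where "m' = \<rho> powr \<alpha> * (4 powr p * c' * N / \<omega>) powr (1 / p)"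
  have m: "0 < m" "0 < m'" using \<rho> c N \<omega>_pos by (auto simp: m_def m'_def)
  have "(\<integral>w. indicator (cball x \<rho>) w * norm (Du w) powr p \<partial>lborel)
      \<le> c * (1 + ln (d / norm x)) * hardy_gap"
    unfolding c_def using x annulus by (intro gradient_annulus_le[OF d]) auto
  also have "\<dots> = c * ((1 + ln (d / norm x)) * hardy_gap)" by simp
  also have "\<dots> \<le> c * N" using c NQ by (intro mult_left_mono) auto
  also have "\<dots> = measure lborel (cball x \<rho>) * m powr p"
    unfolding m_def \<omega>_def using measure_cball_mult_powr[OF \<rho>(1), of p "c * N" x "- (real DIM('a) / p)"] c N p_gt_1 \<rho>
    by simp
  finally have 1: "(\<integral>\<^sup>+w. ennreal (indicator (cball x \<rho>) w * norm (Du w) powr p) \<partial>lborel)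
      \<le> ennreal (measure lborel (cball x \<rho>) * m powr p)"
    by (intro nn_integral_indicator_le integrable_Du) auto
  have iu: "integrable lborel (\<lambda>w. \<bar>u w\<bar> powr p)"
    using p_gt_1 by (intro integrable_vanishing_off_K cont_abs_u_powr) (simp add: u_eq_0)
  have "(\<integral>w. indicator (cball x \<rho>) w * \<bar>u w\<bar> powr p \<partial>lborel)
      \<le> (\<integral>w. (4 * \<rho>) powr p * (indicator (cball x \<rho>) w * (\<bar>u w\<bar> powr p / norm w powr p)) \<partial>lborel)"
  proof (intro integral_mono)
    show "integrable lborel (\<lambda>w. indicator (cball x \<rho>) w * \<bar>u w\<bar> powr p)"
      using integrable_mult_indicator[OF _ iu, of "cball x \<rho>"] by simp
    show "integrable lborel (\<lambda>w. (4 * \<rho>) powr p * (indicator (cball x \<rho>) w * (\<bar>u w\<bar> powr p / norm w powr p)))"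
      using integrable_mult_indicator[OF _ integrable_u, of "cball x \<rho>"] by (intro integrable_mult_right) simp
    fix w
    show "indicator (cball x \<rho>) w * \<bar>u w\<bar> powr p
        \<le> (4 * \<rho>) powr p * (indicator (cball x \<rho>) w * (\<bar>u w\<bar> powr p / norm w powr p))"
    proof (cases "w \<in> cball x \<rho>")
      case True
      have w: "0 < norm w" "norm w \<le> 4 * \<rho>" using annulus[OF True] zero_less_norm_iff[of x] x unfolding \<rho>_def by auto
      then have "norm w powr p \<le> (4 * \<rho>) powr p" using p_gt_1 by (intro powr_mono2) auto
      then have "norm w powr p * (\<bar>u w\<bar> powr p / norm w powr p)
          \<le> (4 * \<rho>) powr p * (\<bar>u w\<bar> powr p / norm w powr p)"
        by (intro mult_right_mono) auto
      then show ?thesis using True w by simp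
    qed simp
  qed
  also have "\<dots> = (4 * \<rho>) powr p * (\<integral>w. indicator (cball x \<rho>) w * (\<bar>u w\<bar> powr p / norm w powr p) \<partial>lborel)"
    by (rule integral_mult_right_zero)
  also have "\<dots> \<le> (4 * \<rho>) powr p * (c' * (1 + ln (d / norm x)) * hardy_gap)"
    unfolding c'_def using x annulus by (intro mult_left_mono hardy_gap_ge_annulus[OF d]) auto
  also have "\<dots> = (4 * \<rho>) powr p * (c' * ((1 + ln (d / norm x)) * hardy_gap))" by simp
  also have "\<dots> \<le> (4 * \<rho>) powr p * (c' * N)" using c NQ by (intro mult_left_mono) auto
  also have "\<dots> = \<rho> powr (real DIM('a) + p * \<alpha>) * (4 powr p * c' * N)"
    using \<rho> by (simp add: p_\<alpha> powr_mult)
  also have "\<dots> = measure lborel (cball x \<rho>) * m' powr p"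
    unfolding m'_def \<omega>_def using measure_cball_mult_powr[OF \<rho>(1), of p "4 powr p * c' * N" x \<alpha>] c N p_gt_1 \<rho>
    by simp
  finally have 2: "(\<integral>\<^sup>+w. ennreal (indicator (cball x \<rho>) w * \<bar>u w\<bar> powr p) \<partial>lborel)
      \<le> ennreal (measure lborel (cball x \<rho>) * m' powr p)"
    by (intro nn_integral_indicator_le iu) auto
  have "\<bar>u x\<bar> \<le> 2 * m' + 4 * \<rho> * m / \<alpha>"
    unfolding \<alpha>_def using \<rho>
    by (intro morrey_pointwise_le[OF p \<rho>(1) m der_u cont_Du _ 1 2]) auto
  also have "4 * \<rho> * m / \<alpha> = 4 / \<alpha> * (\<rho> * \<rho> powr (- (real DIM('a) / p))) * (c / \<omega> * N) powr (1 / p)"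
    by (simp add: m_def)
  also have "\<rho> * \<rho> powr (- (real DIM('a) / p)) = \<rho> powr \<alpha>"
    using \<rho> by (simp add: \<alpha>_def powr_diff powr_minus_divide)
  also have "(c / \<omega> * N) powr (1 / p) = (c / \<omega>) powr (1 / p) * N powr (1 / p)"
    by (rule powr_mult)
  also have "m' = \<rho> powr \<alpha> * (4 powr p * c' / \<omega> * N) powr (1 / p)" by (simp add: m'_def)
  also have "(4 powr p * c' / \<omega> * N) powr (1 / p) = (4 powr p * c' / \<omega>) powr (1 / p) * N powr (1 / p)"
    by (rule powr_mult)
  finally have "\<bar>u x\<bar> \<le> pointwise_const \<alpha> p \<omega> * (\<rho> powr \<alpha> * N powr (1 / p))"
    by (simp add: pointwise_const_def c_def c'_def algebra_simps)
  also have "\<dots> \<le> pointwise_const \<alpha> p \<omega> * (norm x powr \<alpha> * N powr (1 / p))"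
    unfolding pointwise_const_def using \<rho> \<alpha>_pos
    by (intro mult_left_mono mult_right_mono powr_mono2) (auto simp: \<rho>_def)
  finally show ?thesis by (simp add: N_def)
qed

lemma abs_u_le':
  assumes d: "\<And>x. x \<in> K \<Longrightarrow> norm x \<le> d" and x: "norm x \<le> d"
    and \<rho>: "0 < \<rho>" "norm x \<le> 3 * \<rho>" "\<rho> \<le> d"
    and Q: "0 < Q" "hardy_gap \<le> Q"
  shows "\<bar>u x\<bar> \<le> pointwise_const \<alpha> p \<omega> * (3 powr (p * \<alpha>) + 1 / (p * \<alpha>)) powr (1 / p) *
    (\<rho> powr \<alpha> * ((1 + ln (d / \<rho>)) * Q) powr (1 / p))"
proof (cases "x = 0")
  case True
  then show ?thesis using u_eq_0[OF zero_notin_K] \<alpha>_pos by (simp add: pointwise_const_def)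
next
  case False
  define c where "c = 3 powr (p * \<alpha>) + 1 / (p * \<alpha>)"
  have p\<alpha>: "0 < p * \<alpha>" using \<alpha>_pos p_gt_1 by simp
  \<comment> \<open>Everything is moved under the p-th root, so that \<open>powr_mult_log_le\<close>
    applies with \<beta> = p \<alpha>.\<close>
  have root: "s powr \<alpha> * (a * Q) powr (1 / p) = (s powr (p * \<alpha>) * a * Q) powr (1 / p)" if "0 < s" "0 \<le> a" for s a
    using that Q p_gt_1 by (simp add: powr_mult powr_powr)
  have c: "0 < c" using p\<alpha> by (simp add: c_def add_pos_pos)
  have L: "0 \<le> 1 + ln (d / norm x)" "0 \<le> 1 + ln (d / \<rho>)"
    using x \<rho> False by (auto intro!: add_nonneg_nonneg ln_ge_zero)
  have "norm x powr \<alpha> * ((1 + ln (d / norm x)) * Q) powr (1 / p)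
      = (norm x powr (p * \<alpha>) * (1 + ln (d / norm x)) * Q) powr (1 / p)"
    using False L by (intro root) auto
  also have "\<dots> \<le> (c * (\<rho> powr (p * \<alpha>) * (1 + ln (d / \<rho>))) * Q) powr (1 / p)"
    unfolding c_def using False x \<rho> Q p_gt_1 p\<alpha> L
    by (intro powr_mono2 mult_right_mono powr_mult_log_le) auto
  also have "\<dots> = c powr (1 / p) * (\<rho> powr (p * \<alpha>) * (1 + ln (d / \<rho>)) * Q) powr (1 / p)"
    using c L Q by (simp add: powr_mult mult.assoc)
  also have "(\<rho> powr (p * \<alpha>) * (1 + ln (d / \<rho>)) * Q) powr (1 / p) = \<rho> powr \<alpha> * ((1 + ln (d / \<rho>)) * Q) powr (1 / p)"
    using \<rho> L by (intro root[symmetric]) auto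
  finally have "pointwise_const \<alpha> p \<omega> * (norm x powr \<alpha> * ((1 + ln (d / norm x)) * Q) powr (1 / p))
     \<le> pointwise_const \<alpha> p \<omega> * (c powr (1 / p) * (\<rho> powr \<alpha> * ((1 + ln (d / \<rho>)) * Q) powr (1 / p)))"
    using \<alpha>_pos by (intro mult_left_mono) (auto simp: pointwise_const_def)
  with abs_u_le[OF d False x Q] show ?thesis by (simp add: c_def mult.assoc)
qed

text \<open>Two regimes. If |x - y| \<le> |x| / 2, the Morrey estimate on a ball away from the
  origin applies. Otherwise both |x| and |y| are at most 3 |x - y|, and the values of u are bounded
  separately; this is the summand with factor 2 in \<open>holder_const\<close>.\<close>

lemma oscillation_le:
  assumes d: "\<And>x. x \<in> K \<Longrightarrow> norm x \<le> d" and x: "norm x \<le> d" and y: "norm y \<le> d" "x \<noteq> y" "norm (x - y) \<le> d"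
  shows "\<bar>u x - u y\<bar> \<le> holder_const \<alpha> p \<omega> * (norm (x - y) powr \<alpha> *
    (1 + ln (d / norm (x - y))) powr (1 / p) * hardy_gap powr (1 / p))"
proof -
  define \<rho> where "\<rho> = norm (x - y)"
  define c where "c = pointwise_const \<alpha> p \<omega> * (3 powr (p * \<alpha>) + 1 / (p * \<alpha>)) powr (1 / p)"
  have \<rho>: "0 < \<rho>" "\<rho> \<le> d" using y by (auto simp: \<rho>_def)
  define E where "E = \<rho> powr \<alpha> * (1 + ln (d / \<rho>)) powr (1 / p)"
  have L: "0 < 1 + ln (d / \<rho>)" using \<rho> by (auto intro!: add_pos_nonneg ln_ge_zero)
  have E: "0 < E" using \<rho> L by (simp add: E_def)
  have c0: "0 \<le> c" "0 < morrey_const \<alpha> p \<omega>"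
    using \<alpha>_pos log_hardy_const_pos[OF \<alpha>_pos p_gt_1] \<omega>_pos
    by (auto simp: c_def pointwise_const_def morrey_const_def)
  have C: "holder_const \<alpha> p \<omega> = morrey_const \<alpha> p \<omega> + 2 * c" by (simp add: holder_const_def c_def)
  have main: "\<bar>u x - u y\<bar> \<le> holder_const \<alpha> p \<omega> * E * Q powr (1 / p)" if Q: "0 < Q" "hardy_gap \<le> Q" for Q
  proof -
    define T where "T = \<rho> powr \<alpha> * ((1 + ln (d / \<rho>)) * Q) powr (1 / p)"
    have T: "T = E * Q powr (1 / p)" using L Q by (simp add: T_def E_def powr_mult)
    have T0: "0 \<le> T" using L Q by (simp add: T_def)
    have "\<bar>u x - u y\<bar> \<le> holder_const \<alpha> p \<omega> * T"
    proof (cases "\<rho> \<le> norm x / 2")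
      case True
      then have "x \<noteq> 0" using \<rho> by auto
      then have "\<bar>u x - u y\<bar> \<le> morrey_const \<alpha> p \<omega> * T"
        unfolding T_def \<rho>_def using True y(2) by (intro oscillation_near_le d x Q) (auto simp: \<rho>_def)
      also have "\<dots> \<le> holder_const \<alpha> p \<omega> * T"
        unfolding C using c0 T0 by (intro mult_right_mono) auto
      finally show ?thesis .
    next
      case False
      have "norm y \<le> norm x + \<rho>" using norm_triangle_ineq2[of y x] by (simp add: \<rho>_def norm_minus_commute)
      with False have "norm x \<le> 3 * \<rho>" "norm y \<le> 3 * \<rho>" using \<rho> by auto
      then have "\<bar>u x\<bar> \<le> c * T" "\<bar>u y\<bar> \<le> c * T"
        unfolding c_def T_def using \<rho> by (intro abs_u_le' d x y Q; simp)+
      then have "\<bar>u x - u y\<bar> \<le> 2 * c * T" by linarith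
      also have "\<dots> \<le> holder_const \<alpha> p \<omega> * T"
        unfolding C using c0 T0 by (intro mult_right_mono) auto
      finally show ?thesis .
    qed
    then show ?thesis by (simp add: T)
  qed
  have "\<bar>u x - u y\<bar> \<le> holder_const \<alpha> p \<omega> * E * hardy_gap powr (1 / p)"
  proof (cases "hardy_gap = 0")
    case True
    define b where "b = holder_const \<alpha> p \<omega> * E"
    have b: "0 < b" using E c0 by (simp add: b_def C)
    \<comment> \<open>A vanishing Hardy difference is not an admissible Q; it is approached through
      Q = (e / b)^p, which turns the bound into e.\<close>
    have *: "\<bar>u x - u y\<bar> \<le> e" if "0 < e" for e
    proof -
      have "((e / b) powr p) powr (1 / p) = e / b"
        using that b p_gt_1 powr_powr[of "e / b" p "1 / p"] by simp
      then show ?thesis using main[of "(e / b) powr p"] that b True by (simp add: b_def[symmetric])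
    qed
    have "\<bar>u x - u y\<bar> \<le> 0"
    proof (rule field_le_epsilon)
      show "\<bar>u x - u y\<bar> \<le> 0 + e" if "0 < e" for e using *[OF that] by linarith
    qed
    with True show ?thesis by simp
  next
    case False
    then show ?thesis using main[of hardy_gap] hardy_gap_nonneg by simp
  qed
  then show ?thesis by (simp add: E_def \<rho>_def)
qed

end

section \<open>From test functions to the punctured setting; the inequality itself\<close>

lemma test_functionsD:
  fixes u :: "real ^ 'n \<Rightarrow> real"
  assumes "u \<in> test_functions U"
  obtains K where "compact K" "K \<subseteq> U" "\<And>x. x \<notin> K \<Longrightarrow> u x = 0" "\<And>x. x \<notin> K \<Longrightarrow> grad u x = 0"
    "\<And>x. (u has_derivative (\<lambda>h. grad u x \<bullet> h)) (at x)" "continuous_on UNIV (grad u)"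
proof -
  define K where "K = closure {x. u x \<noteq> 0}"
  have K: "compact K" "K \<subseteq> U" using assms by (auto simp: test_functions_def K_def)
  have u0: "u x = 0" if "x \<notin> K" for x using that closure_subset[of "{x. u x \<noteq> 0}"] by (auto simp: K_def)
  have C1: "Ck (Suc 0) u" using assms unfolding test_functions_def by blast
  have g0: "grad u x = 0" if "x \<notin> K" for x
  proof -
    have "open (- K)" by (simp add: K_def open_Compl)
    then have "(u has_derivative (\<lambda>_. 0)) (at x)"
      using has_derivative_transform_within_open[of "\<lambda>_. 0::real" "\<lambda>_. 0" x UNIV "- K" u] that u0 by auto
    then show ?thesis by (simp add: grad_def frechet_derivative_at[symmetric] vec_eq_iff)
  qed
  have der: "(u has_derivative (\<lambda>h. grad u x \<bullet> h)) (at x)" for x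
  proof -
    define f where "f = frechet_derivative u (at x)"
    have D: "(u has_derivative f) (at x)"
      using C1 by (simp add: f_def frechet_derivative_works)
    then have lin: "linear f" by (rule has_derivative_linear)
    have "f h = grad u x \<bullet> h" for h
    proof -
      have "f h = f (\<Sum>i\<in>UNIV. h $ i *\<^sub>R axis i 1)"
        by (simp add: basis_expansion[of h, unfolded scalar_mult_eq_scaleR])
      also have "\<dots> = (\<Sum>i\<in>UNIV. h $ i * f (axis i 1))"
        using lin by (simp add: linear_sum linear_cmul)
      finally show ?thesis by (simp add: inner_vec_def grad_def f_def mult.commute)
    qed
    then have "f = (\<lambda>h. grad u x \<bullet> h)" by auto
    with D show ?thesis by simp
  qed
  have "continuous_on UNIV (\<lambda>x. \<chi> i. grad u x $ i)"
    using C1 by (intro continuous_on_vec_lambda) auto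
  then have "continuous_on UNIV (grad u)" by (simp add: vec_nth_inverse)
  with K u0 g0 der that show thesis by blast
qed

lemma punctured_C1_test_function:
  fixes u :: "real ^ 'n \<Rightarrow> real"
  assumes p: "real CARD('n) < p" and u: "u \<in> test_functions (\<Omega> - {0})" and \<Omega>: "open \<Omega>"
  obtains K where "punctured_C1 p u (grad u) K" "K \<subseteq> \<Omega>"
    "hardy_difference p \<Omega> u = punctured_C1.hardy_gap p u (grad u)"
proof -
  obtain K where K: "compact K" "K \<subseteq> \<Omega> - {0}" "\<And>x. x \<notin> K \<Longrightarrow> u x = 0" "\<And>x. x \<notin> K \<Longrightarrow> grad u x = 0"
    "\<And>x. (u has_derivative (\<lambda>h. grad u x \<bullet> h)) (at x)" "continuous_on UNIV (grad u)"
    using test_functionsD[OF u] by blast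
  interpret punctured_C1 p u "grad u" K
    using p K by unfold_locales auto
  have "(LINT x:\<Omega>|lborel. norm (grad u x) powr p) = (\<integral>x. norm (grad u x) powr p \<partial>lborel)"
    unfolding set_lebesgue_integral_def using K p_gt_1
    by (intro Bochner_Integration.integral_cong) (auto simp: indicator_def)
  moreover have "(LINT x:\<Omega>|lborel. \<bar>u x\<bar> powr p / norm x powr p) = (\<integral>x. \<bar>u x\<bar> powr p / norm x powr p \<partial>lborel)"
    unfolding set_lebesgue_integral_def using K p_gt_1
    by (intro Bochner_Integration.integral_cong) (auto simp: indicator_def)
  moreover have "(p - real CARD('n)) / p = \<alpha>"
    using p_gt_1 by (simp add: \<alpha>_def diff_divide_distrib)
  ultimately have "hardy_difference p \<Omega> u = hardy_gap"
    by (simp add: hardy_difference_def hardy_gap_def)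
  with that K show thesis using punctured_C1_axioms by blast
qed

theorem hardy_morrey_holds:
  fixes p :: real
  assumes p: "real CARD('n::finite) < p"
  shows "\<exists>B C. 1 \<le> B \<and> 0 < C \<and>
    (\<forall>\<Omega> :: (real ^ 'n) set. bounded_domain \<Omega> \<longrightarrow> 0 \<in> \<Omega> \<longrightarrow>
       (\<forall>u \<in> test_functions (\<Omega> - {0}). hardy_morrey_ineq p (1 / p) B C \<Omega> u))"
proof -
  define a where "a = 1 - real CARD('n) / p"
  define w where "w = measure lborel (cball (0 :: real ^ 'n) 1)"
  define C where "C = holder_const a p w"
  have p1: "1 < p" using p zero_less_card_finite[where 'a='n] by linarith
  have a: "0 < a" using p p1 by (simp add: a_def)
  have w: "0 < w" unfolding w_def by (rule content_cball_pos) simp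
  have C: "0 < C"
    unfolding C_def holder_const_def morrey_const_def pointwise_const_def
    using a w log_hardy_const_pos[OF a p1] by (intro add_pos_nonneg) auto
  \<comment> \<open>B = 1 suffices: since the origin lies in \<Omega>, the diameter bounds |x| as
    well as |x - y|, so d = diam \<Omega> serves in every estimate. C involves only \<alpha>, p and
    the volume of the unit ball.\<close>
  have "hardy_morrey_ineq p (1 / p) 1 C \<Omega> u"
    if \<Omega>: "bounded_domain \<Omega>" "0 \<in> \<Omega>" and u: "u \<in> test_functions (\<Omega> - {0})"
    for \<Omega> :: "(real ^ 'n) set" and u
  proof -
    define d where "d = diameter \<Omega>"
    have op: "open \<Omega>" and bd: "bounded \<Omega>" using \<Omega> by (auto simp: bounded_domain_def)
    obtain K where K: "punctured_C1 p u (grad u) K" "K \<subseteq> \<Omega>"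
        "hardy_difference p \<Omega> u = punctured_C1.hardy_gap p u (grad u)"
      using punctured_C1_test_function[OF p u op] by blast
    interpret punctured_C1 p u "grad u" K by (rule K)
    have \<alpha>: "\<alpha> = a" by (simp add: \<alpha>_def a_def)
    have \<omega>: "\<omega> = w" by (simp add: \<omega>_def w_def)
    have dist: "norm (x - y) \<le> d" if "x \<in> \<Omega>" "y \<in> \<Omega>" for x y
      using diameter_bounded_bound[OF bd that] by (simp add: d_def dist_norm)
    have norm: "norm x \<le> d" if "x \<in> \<Omega>" for x
      using dist[OF that \<Omega>(2)] by simp
    have "\<bar>u x - u y\<bar> / norm (x - y) powr a * X (norm (x - y) / d) powr (1 / p) \<le> C * hardy_gap powr (1 / p)"
      if xy: "x \<in> \<Omega>" "y \<in> \<Omega>" "x \<noteq> y" for x y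
    proof -
      define \<rho> where "\<rho> = norm (x - y)"
      define L where "L = 1 + ln (d / \<rho>)"
      have \<rho>: "0 < \<rho>" "\<rho> \<le> d" using xy dist by (auto simp: \<rho>_def)
      have L: "0 < L" using \<rho> by (auto simp: L_def intro!: add_pos_nonneg ln_ge_zero)
      have X: "X (\<rho> / d) powr (1 / p) = 1 / L powr (1 / p)"
      proof -
        have "1 - ln (\<rho> / d) = L" using \<rho> by (simp add: L_def ln_div)
        then show ?thesis by (simp add: X_def inverse_eq_divide powr_divide)
      qed
      have "\<bar>u x - u y\<bar> \<le> C * (\<rho> powr a * L powr (1 / p) * hardy_gap powr (1 / p))"
        using oscillation_le[of d x y] xy norm dist K(2) unfolding C_def L_def \<rho>_def \<alpha> \<omega> by blast
      then show ?thesis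
        unfolding \<rho>_def[symmetric] X using \<rho> L by (simp add: field_simps)
    qed
    then show ?thesis
      unfolding hardy_morrey_ineq_def weighted_holder_sup_def K(3)
      by (intro SUP_least) (auto simp: a_def d_def)
  qed
  then show ?thesis using C by (intro exI[of _ 1] exI[of _ C]) auto
qed

section \<open>Smooth radial functions\<close>

text \<open>With y = 1 / x, the derivative of P(y) e^-y with respect to x is y^2 (P - P')(y)
  e^-y.\<close>

fun flat_poly :: "nat \<Rightarrow> real poly" where
  "flat_poly 0 = 1"
| "flat_poly (Suc k) = [:0, 0, 1:] * (flat_poly k - pderiv (flat_poly k))"

text \<open>\<open>flat k\<close> is the \<open>k\<close>-th derivative of the function \<open>e\<^sup>-\<^sup>1\<^sup>/\<^sup>x\<close> on \<open>x > 0\<close>, extended by zero.\<close>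

definition flat :: "nat \<Rightarrow> real \<Rightarrow> real" where
  "flat k x = (if 0 < x then poly (flat_poly k) (1 / x) * exp (- (1 / x)) else 0)"

lemma poly_div_exp_tendsto_0:
  fixes P :: "real poly"
  shows "((\<lambda>y. poly P y * exp (- y)) \<longlongrightarrow> 0) at_top"
proof -
  have "((\<lambda>y. \<Sum>i\<le>degree P. coeff P i * (y ^ i / exp y)) \<longlongrightarrow> (\<Sum>i\<le>degree P. coeff P i * 0)) at_top"
    by (intro tendsto_sum tendsto_mult tendsto_const tendsto_power_div_exp_0)
  moreover have "poly P y * exp (- y) = (\<Sum>i\<le>degree P. coeff P i * (y ^ i / exp y))" for y
    by (simp add: poly_altdef sum_distrib_right exp_minus divide_inverse mult.assoc)
  ultimately show ?thesis by simp
qed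

lemma has_real_derivative_flat: "(flat k has_real_derivative flat (Suc k) x) (at x)"
proof (cases x "0::real" rule: linorder_cases)
  case less
  then have "\<forall>\<^sub>F y in nhds x. y < 0" by (intro eventually_nhds_in_open[of "{..<0}", simplified]) auto
  then have "\<forall>\<^sub>F y in nhds x. flat k y = 0" by (rule eventually_mono) (simp add: flat_def)
  then have "(flat k has_real_derivative 0) (at x)"
    by (subst DERIV_cong_ev[OF refl _ refl, where g="\<lambda>_. 0"]) auto
  then show ?thesis using less by (simp add: flat_def)
next
  case greater
  then have "\<forall>\<^sub>F y in nhds x. 0 < y" by (intro eventually_nhds_in_open[of "{0<..}", simplified]) auto
  then have ev: "\<forall>\<^sub>F y in nhds x. flat k y = poly (flat_poly k) (1 / y) * exp (- (1 / y))"
    by (rule eventually_mono) (simp add: flat_def)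
  have inv: "((\<lambda>y. 1 / y) has_real_derivative - (1 / x\<^sup>2)) (at x)"
    using greater by (auto intro!: derivative_eq_intros simp: power2_eq_square)
  have "((\<lambda>y. poly (flat_poly k) (1 / y) * exp (- (1 / y))) has_real_derivative
      (poly (pderiv (flat_poly k)) (1 / x) * (- (1 / x\<^sup>2))) * exp (- (1 / x))
      + (exp (- (1 / x)) * (- (- (1 / x\<^sup>2)))) * poly (flat_poly k) (1 / x)) (at x)"
    by (intro DERIV_mult DERIV_chain2[OF poly_DERIV inv] DERIV_chain2[OF DERIV_exp] DERIV_minus inv)
  then have "((\<lambda>y. poly (flat_poly k) (1 / y) * exp (- (1 / y))) has_real_derivative flat (Suc k) x) (at x)"
    by (rule DERIV_cong) (use greater in \<open>simp add: flat_def power2_eq_square algebra_simps\<close>)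
  then show ?thesis by (subst DERIV_cong_ev[OF refl ev refl])
next
  case equal
  have "((\<lambda>h. flat k h / h) \<longlongrightarrow> 0) (at_left 0)"
    by (rule tendsto_eventually) (auto simp: flat_def eventually_at_filter)
  moreover have "((\<lambda>h. flat k h / h) \<longlongrightarrow> 0) (at_right 0)"
  proof -
    have "filterlim (\<lambda>h::real. 1 / h) at_top (at_right 0)"
      using filterlim_inverse_at_top_right by (simp add: inverse_eq_divide)
    \<comment> \<open>The difference quotient at 0 is again a polynomial in 1 / h times e^(-1/h), so
      every order has derivative 0 there.\<close>
    from filterlim_compose[OF poly_div_exp_tendsto_0[of "[:0, 1:] * flat_poly k"] this]
    have "((\<lambda>h. 1 / h * poly (flat_poly k) (1 / h) * exp (- (1 / h))) \<longlongrightarrow> 0) (at_right 0)" by simp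
    moreover have "\<forall>\<^sub>F h in at_right 0. 1 / h * poly (flat_poly k) (1 / h) * exp (- (1 / h)) = flat k h / h"
      by (auto simp: eventually_at_filter flat_def)
    ultimately show ?thesis by (rule Lim_transform_eventually)
  qed
  ultimately have "((\<lambda>h. flat k h / h) \<longlongrightarrow> 0) (at 0)"
    by (rule filterlim_split_at)
  then show ?thesis using equal by (simp add: has_field_derivative_iff flat_def)
qed

text \<open>A class of expressions closed under partial derivatives away from the origin, so that
  one differentiation lemma yields all orders by iteration. The gradient of |x|^b contributes
  coordinates and |x|^(b-2), and differentiating \<open>flat k\<close> raises k; this dictates the
  generators.\<close>

inductive smooth_off_0 :: "(real ^ 'n \<Rightarrow> real) \<Rightarrow> bool" where
  const: "smooth_off_0 (\<lambda>x. c)"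
| coord: "smooth_off_0 (\<lambda>x. x $ i)"
| norm_powr: "smooth_off_0 (\<lambda>x. norm x powr b)"
| ln_norm: "smooth_off_0 (\<lambda>x. ln (norm x))"
| add: "smooth_off_0 f \<Longrightarrow> smooth_off_0 g \<Longrightarrow> smooth_off_0 (\<lambda>x. f x + g x)"
| mult: "smooth_off_0 f \<Longrightarrow> smooth_off_0 g \<Longrightarrow> smooth_off_0 (\<lambda>x. f x * g x)"
| flat: "smooth_off_0 f \<Longrightarrow> smooth_off_0 (\<lambda>x. flat k (f x))"

lemma has_derivative_norm_cart:
  fixes x :: "real ^ 'n"
  assumes "x \<noteq> 0"
  shows "(norm has_derivative (\<lambda>h. \<Sum>i\<in>UNIV. x $ i / norm x * h $ i)) (at x)"
  using has_derivative_norm[OF assms]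
  by (simp add: inner_vec_def sgn_div_norm divide_inverse mult.commute)

lemma smooth_off_0_partials:
  assumes "smooth_off_0 f"
  shows "\<exists>D. (\<forall>i. smooth_off_0 (D i)) \<and>
    (\<forall>x. x \<noteq> 0 \<longrightarrow> (f has_derivative (\<lambda>h. \<Sum>i\<in>UNIV. D i x * h $ i)) (at x))"
  using assms
proof induction
  case (const c)
  show ?case by (intro exI[of _ "\<lambda>_ _. 0"]) (auto intro: smooth_off_0.const)
next
  case (coord i)
  have "((\<lambda>x. x $ i) has_derivative (\<lambda>h. \<Sum>j\<in>UNIV. (if j = i then 1 else 0) * h $ j)) (at x)" for x :: "real ^ 'a"
    by (simp add: if_distrib[of "\<lambda>c. c * _"] bounded_linear_imp_has_derivative[OF bounded_linear_vec_nth]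
        cong: if_cong)
  then show ?case
    by (intro exI[of _ "\<lambda>j _. if j = i then 1 else 0"]) (auto intro: smooth_off_0.const)
next
  case (norm_powr b)
  have "((\<lambda>x. norm x powr b) has_derivative (\<lambda>h. \<Sum>i\<in>UNIV. b * norm x powr (b - 2) * x $ i * h $ i)) (at x)"
    if "x \<noteq> 0" for x :: "real ^ 'a"
  proof -
    have "((\<lambda>r. r powr b) has_derivative (\<lambda>h. b * norm x powr (b - 1) * h)) (at (norm x))"
      using has_real_derivative_powr[of "norm x" b] that by (simp add: has_field_derivative_def)
    from has_derivative_compose[OF has_derivative_norm_cart[OF that] this]
    show ?thesis
      by (rule has_derivative_eq_rhs)
        (use that in \<open>simp add: fun_eq_iff sum_distrib_left powr_diff power2_eq_square mult_ac\<close>)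
  qed
  then show ?case
    by (intro exI[of _ "\<lambda>i x. b * norm x powr (b - 2) * x $ i"])
       (blast intro: smooth_off_0.mult[OF smooth_off_0.mult[OF smooth_off_0.const smooth_off_0.norm_powr] smooth_off_0.coord])
next
  case ln_norm
  have "((\<lambda>x. ln (norm x)) has_derivative (\<lambda>h. \<Sum>i\<in>UNIV. norm x powr (- 2) * x $ i * h $ i)) (at x)"
    if "x \<noteq> 0" for x :: "real ^ 'a"
  proof -
    have "(ln has_derivative (\<lambda>h. 1 / norm x * h)) (at (norm x))"
      using DERIV_ln_divide[OF zero_less_norm_iff[THEN iffD2, OF that]]
      by (simp only: has_field_derivative_def)
    from has_derivative_compose[OF has_derivative_norm_cart[OF that] this]
    show ?thesis
      by (rule has_derivative_eq_rhs)
        (use that in \<open>simp add: fun_eq_iff sum_distrib_left powr_minus power2_eq_square divide_inverse mult_ac\<close>)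
  qed
  then show ?case
    by (intro exI[of _ "\<lambda>i x. norm x powr (- 2) * x $ i"]) (auto intro: smooth_off_0.intros)
next
  case (add f g)
  then obtain D E where
    "\<And>i. smooth_off_0 (D i)" "\<And>x. x \<noteq> 0 \<Longrightarrow> (f has_derivative (\<lambda>h. \<Sum>i\<in>UNIV. D i x * h $ i)) (at x)"
    "\<And>i. smooth_off_0 (E i)" "\<And>x. x \<noteq> 0 \<Longrightarrow> (g has_derivative (\<lambda>h. \<Sum>i\<in>UNIV. E i x * h $ i)) (at x)"
    by blast
  then show ?case
    by (intro exI[of _ "\<lambda>i x. D i x + E i x"])
       (auto intro!: smooth_off_0.add has_derivative_eq_rhs[OF has_derivative_add]
         simp: distrib_right sum.distrib)
next
  case (mult f g)
  then obtain D E where DE: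
    "\<And>i. smooth_off_0 (D i)" "\<And>x. x \<noteq> 0 \<Longrightarrow> (f has_derivative (\<lambda>h. \<Sum>i\<in>UNIV. D i x * h $ i)) (at x)"
    "\<And>i. smooth_off_0 (E i)" "\<And>x. x \<noteq> 0 \<Longrightarrow> (g has_derivative (\<lambda>h. \<Sum>i\<in>UNIV. E i x * h $ i)) (at x)"
    by blast
  have "((\<lambda>x. f x * g x) has_derivative (\<lambda>h. \<Sum>i\<in>UNIV. (f x * E i x + D i x * g x) * h $ i)) (at x)"
    if "x \<noteq> 0" for x
    by (rule has_derivative_eq_rhs[OF has_derivative_mult[OF DE(2,4)[OF that]]])
       (simp add: fun_eq_iff sum_distrib_left sum_distrib_right sum.distrib[symmetric] algebra_simps)
  moreover have "smooth_off_0 (\<lambda>x. f x * E i x + D i x * g x)" for i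
    by (rule smooth_off_0.add[OF smooth_off_0.mult[OF mult.hyps(1) DE(3)] smooth_off_0.mult[OF DE(1) mult.hyps(2)]])
  ultimately show ?case by (intro exI[of _ "\<lambda>i x. f x * E i x + D i x * g x"]) blast
next
  case (flat f k)
  then obtain D where D:
    "\<And>i. smooth_off_0 (D i)" "\<And>x. x \<noteq> 0 \<Longrightarrow> (f has_derivative (\<lambda>h. \<Sum>i\<in>UNIV. D i x * h $ i)) (at x)"
    by blast
  have "((\<lambda>x. flat k (f x)) has_derivative (\<lambda>h. \<Sum>i\<in>UNIV. flat (Suc k) (f x) * D i x * h $ i)) (at x)"
    if "x \<noteq> 0" for x
  proof -
    have "(flat k has_derivative (\<lambda>h. flat (Suc k) (f x) * h)) (at (f x))"
      using has_real_derivative_flat by (simp add: has_field_derivative_def)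
    from has_derivative_compose[OF D(2)[OF that] this] show ?thesis
      by (rule has_derivative_eq_rhs) (simp add: fun_eq_iff sum_distrib_left mult_ac)
  qed
  moreover have "smooth_off_0 (\<lambda>x. flat (Suc k) (f x) * D i x)" for i
    by (rule smooth_off_0.mult[OF smooth_off_0.flat[OF flat.hyps] D(1)])
  ultimately show ?case by (intro exI[of _ "\<lambda>i x. flat (Suc k) (f x) * D i x"]) blast
qed

text \<open>At the origin the expressions carry no information, so f agrees with g only elsewhere
  and vanishes on a ball. The partial derivatives of f satisfy the same two conditions, which is the
  induction step towards \<open>Ck\<close>.\<close>

lemma smooth_off_0_extension:
  fixes f :: "real ^ 'n \<Rightarrow> real"
  assumes "smooth_off_0 g" and f: "\<And>x. x \<noteq> 0 \<Longrightarrow> f x = g x" and e: "0 < e" "\<And>x. norm x < e \<Longrightarrow> f x = 0"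
  obtains D where "\<And>i. smooth_off_0 (D i)" "\<And>x. f differentiable (at x)"
    "\<And>x i. x \<noteq> 0 \<Longrightarrow> grad f x $ i = D i x" "\<And>x i. norm x < e \<Longrightarrow> grad f x $ i = 0"
proof -
  obtain D where D: "\<And>i. smooth_off_0 (D i)"
    "\<And>x. x \<noteq> 0 \<Longrightarrow> (g has_derivative (\<lambda>h. \<Sum>i\<in>UNIV. D i x * h $ i)) (at x)"
    using smooth_off_0_partials[OF assms(1)] by blast
  have der: "(f has_derivative (\<lambda>h. \<Sum>i\<in>UNIV. D i x * h $ i)) (at x)" if "x \<noteq> 0" for x
    using has_derivative_transform_within_open[OF D(2)[OF that], of "- {0}" f] that f by auto
  have der0: "(f has_derivative (\<lambda>_. 0)) (at x)" if "norm x < e" for x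
    using has_derivative_transform_within_open[of "\<lambda>_. 0::real" "\<lambda>_. 0" x UNIV "ball 0 e" f] that e(2)
    by auto
  show thesis
  proof (rule that[OF D(1)])
    show "f differentiable (at x)" for x
      using der[of x] der0[of x] e(1) unfolding differentiable_def by (cases "x = 0") auto
    show "grad f x $ i = D i x" if "x \<noteq> 0" for x i
      unfolding grad_def frechet_derivative_at[OF der[OF that], symmetric]
      by (simp add: axis_def if_distrib[of "\<lambda>c. _ * c"] cong: if_cong)
    show "grad f x $ i = 0" if "norm x < e" for x i
      unfolding grad_def frechet_derivative_at[OF der0[OF that], symmetric] by simp
  qed
qed

lemma Ck_of_smooth_off_0:
  fixes f :: "real ^ 'n \<Rightarrow> real"
  assumes "smooth_off_0 g" "\<And>x. x \<noteq> 0 \<Longrightarrow> f x = g x" "0 < e" "\<And>x. norm x < e \<Longrightarrow> f x = 0"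
  shows "Ck k f"
  using assms
proof (induction k arbitrary: f g)
  case 0
  then show ?case
    using smooth_off_0_extension[of g f e]
    by (metis Ck.simps(1) continuous_at_imp_continuous_on differentiable_imp_continuous_within)
next
  case (Suc k)
  from smooth_off_0_extension[OF Suc.prems] obtain D where D: "\<And>i. smooth_off_0 (D i)"
    "\<And>x. f differentiable (at x)"
    "\<And>x i. x \<noteq> 0 \<Longrightarrow> grad f x $ i = D i x" "\<And>x i. norm x < e \<Longrightarrow> grad f x $ i = 0"
    by blast
  have "Ck k (\<lambda>x. grad f x $ i)" for i
    by (rule Suc.IH[OF D(1,3) Suc.prems(3) D(4)])
  with D(2) show ?case by simp
qed

section \<open>Optimality of the power\<close>

definition bump :: "real \<Rightarrow> real" where
  "bump s = flat 0 s * flat 0 (1 - s)"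

definition bump' :: "real \<Rightarrow> real" where
  "bump' s = flat 1 s * flat 0 (1 - s) - flat 0 s * flat 1 (1 - s)"

lemma has_real_derivative_bump: "(bump has_real_derivative bump' s) (at s)"
proof -
  have "((\<lambda>s. flat 0 (1 - s)) has_real_derivative flat 1 (1 - s) * (- 1)) (at s)"
    using has_real_derivative_flat[of 0 "1 - s"]
    by (intro DERIV_chain2[where f="flat 0"]) (auto intro!: derivative_eq_intros)
  from DERIV_mult[OF has_real_derivative_flat[of 0 s] this] show ?thesis
    unfolding bump_def[abs_def] bump'_def by (rule DERIV_cong) simp
qed

lemma bump_bounds: "0 \<le> bump s" "bump s \<le> 1"
proof -
  have "0 \<le> flat 0 s" "flat 0 s \<le> 1" for s by (auto simp: flat_def)
  then show "0 \<le> bump s" "bump s \<le> 1" unfolding bump_def by (auto intro: mult_le_one)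
qed

lemma bump_eq_0: "s \<le> 0 \<or> 1 \<le> s \<Longrightarrow> bump s = 0"
  by (auto simp: bump_def flat_def)

lemma bump_half_pos: "0 < bump (1 / 2)"
  by (simp add: bump_def flat_def)

lemma bump'_bounded: obtains c where "0 < c" "\<And>s. \<bar>bump' s\<bar> \<le> c"
proof -
  have cont: "continuous_on S (flat k)" for S k
    by (intro continuous_at_imp_continuous_on ballI DERIV_isCont[OF has_real_derivative_flat])
  have "continuous_on {0..1} bump'"
    unfolding bump'_def[abs_def]
    by (intro continuous_intros cont continuous_on_compose2[OF cont[of UNIV]]) auto
  then have "bounded (bump' ` {0..1})"
    by (intro compact_imp_bounded compact_continuous_image) auto
  then obtain c where c: "\<forall>s\<in>{0..1}. \<bar>bump' s\<bar> \<le> c" by (auto simp: bounded_iff)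
  have "\<bar>bump' s\<bar> \<le> max c 1" for s
    using c by (cases "s \<in> {0..1}") (auto simp: bump'_def flat_def le_max_iff_disj)
  then show thesis by (intro that[of "max c 1"]) auto
qed

text \<open>When \<open>|b| > A\<close> Taylor's formula is useless, but then \<open>A = a \<theta>\<^sup>2\<close> forces \<open>\<theta> = O(1/M)\<close> and
  \<open>b = O(1/M\<^sup>2)\<close>. This is why the profile is the square of a bump.\<close>

lemma trial_energy_le:
  fixes p a c :: real
  assumes p: "1 < p" and a: "0 < a" and c: "0 < c"
  obtains C where "0 < C" "\<And>\<theta> \<theta>' M A b. \<lbrakk>0 \<le> \<theta>; \<theta> \<le> 1; \<bar>\<theta>'\<bar> \<le> c; 1 \<le> M; A = a * \<theta>\<^sup>2; b = 2 * \<theta> * \<theta>' / M\<rbrakk>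
    \<Longrightarrow> \<bar>A + b\<bar> powr p - A powr p - p * A powr (p - 1) * b \<le> C / M\<^sup>2"
proof -
  define C1 where "C1 = p\<^sup>2 * 2 powr p * (4 * a powr (p - 1) * c\<^sup>2 / a)"
  define B where "B = 4 * c\<^sup>2 / a"
  define C2 where "C2 = (2 powr p + p) * B powr p"
  have B: "0 < B" using a c by (simp add: B_def)
  have C: "0 < C1" "0 < C2" using p a c B by (auto simp: C1_def C2_def add_pos_pos)
  have "\<bar>A + b\<bar> powr p - A powr p - p * A powr (p - 1) * b \<le> (C1 + C2) / M\<^sup>2"
    if \<theta>: "0 \<le> \<theta>" "\<theta> \<le> 1" "\<bar>\<theta>'\<bar> \<le> c" and M: "1 \<le> M" and A: "A = a * \<theta>\<^sup>2" and b: "b = 2 * \<theta> * \<theta>' / M"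
    for \<theta> \<theta>' M A b
  proof (cases "\<theta> = 0")
    case True
    then show ?thesis using C by (simp add: A b)
  next
    case False
    with \<theta> a have pos: "0 < \<theta>" "0 < A" by (auto simp: A)
    have \<theta>'2: "\<theta>'\<^sup>2 \<le> c\<^sup>2" using \<theta>(3) c by (intro abs_le_square_iff[THEN iffD1]) simp
    have M2: "0 < M\<^sup>2" "1 \<le> M\<^sup>2" using M by (auto simp: one_le_power)
    have "\<bar>A + b\<bar> powr p - A powr p - p * A powr (p - 1) * b \<le> C1 / M\<^sup>2 \<or>
          \<bar>A + b\<bar> powr p - A powr p - p * A powr (p - 1) * b \<le> C2 / M\<^sup>2"
    proof (cases "\<bar>b\<bar> \<le> A")
      case True
      define s where "s = 1 + b / A"
      have bA: "\<bar>b / A\<bar> \<le> 1" using True pos by (simp add: abs_divide)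
      have s: "0 \<le> s" "s \<le> 2" using bA unfolding s_def by linarith+
      have Ab: "A + b = A * s" using pos by (simp add: s_def field_simps)
      have "\<bar>A + b\<bar> powr p = A powr p * s powr p"
        using pos s by (simp add: Ab abs_mult powr_mult)
      also have "\<dots> \<le> A powr p * (1 + p * (s - 1) + p\<^sup>2 * 2 powr p * (s - 1)\<^sup>2)"
        using s p by (intro mult_left_mono powr_le_second_order) auto
      also have "\<dots> = A powr p + p * (A powr p / A) * b + p\<^sup>2 * 2 powr p * (A powr p / A * (b\<^sup>2 / A))"
        by (simp add: s_def distrib_left power2_eq_square mult_ac)
      also have "A powr p / A = A powr (p - 1)" using pos by (simp add: powr_diff)
      \<comment> \<open>Here the squared profile pays off: b^2 and A share the factor \<theta>^2, so
        the quotient stays bounded where the cutoff is small.\<close>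
      also have "b\<^sup>2 / A = 4 * \<theta>'\<^sup>2 / a / M\<^sup>2"
        using pos a by (simp add: b A power_mult_distrib power_divide)
      finally have 1: "\<bar>A + b\<bar> powr p - A powr p - p * A powr (p - 1) * b
          \<le> p\<^sup>2 * 2 powr p * (A powr (p - 1) * (4 * \<theta>'\<^sup>2 / a / M\<^sup>2))"
        by linarith
      have "\<theta>\<^sup>2 \<le> 1" using \<theta> by (simp add: power_le_one)
      then have "A \<le> a * 1" unfolding A using a by (intro mult_left_mono) auto
      then have "A powr (p - 1) \<le> a powr (p - 1)" using pos p by (intro powr_mono2) auto
      then have "p\<^sup>2 * 2 powr p * (A powr (p - 1) * (4 * \<theta>'\<^sup>2 / a / M\<^sup>2))
          \<le> p\<^sup>2 * 2 powr p * (a powr (p - 1) * (4 * c\<^sup>2 / a / M\<^sup>2))"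
        using \<theta>'2 a by (intro mult_left_mono mult_mono divide_right_mono) auto
      also have "\<dots> = C1 / M\<^sup>2" by (simp add: C1_def)
      finally show ?thesis using 1 by linarith
    next
      case False
      have absb: "\<bar>b\<bar> = 2 * \<theta> * \<bar>\<theta>'\<bar> / M" using \<theta> M by (simp add: b abs_mult)
      have "\<theta> * (a * \<theta>) < \<theta> * (2 * \<bar>\<theta>'\<bar> / M)"
        using False unfolding absb by (simp add: A power2_eq_square mult_ac)
      then have "a * \<theta> < 2 * \<bar>\<theta>'\<bar> / M" using pos by (simp only: mult_less_cancel_left_pos)
      then have "\<theta> \<le> 2 * \<bar>\<theta>'\<bar> / M / a"
        unfolding pos_le_divide_eq[OF a] by (simp only: mult.commute[of \<theta> a] less_imp_le)
      then have "\<theta> * (2 * \<bar>\<theta>'\<bar> / M) \<le> 2 * \<bar>\<theta>'\<bar> / M / a * (2 * \<bar>\<theta>'\<bar> / M)"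
        using M by (intro mult_right_mono) auto
      then have "\<bar>b\<bar> \<le> 4 * \<theta>'\<^sup>2 / a / M\<^sup>2"
        by (simp add: absb power2_eq_square mult_ac)
      also have "\<dots> \<le> 4 * c\<^sup>2 / a / M\<^sup>2"
        using \<theta>'2 a by (intro divide_right_mono mult_left_mono) auto
      finally have "\<bar>b\<bar> \<le> B * (1 / M\<^sup>2)" by (simp add: B_def)
      then have "\<bar>b\<bar> powr p \<le> (B * (1 / M\<^sup>2)) powr p" using p by (intro powr_mono2) auto
      also have "\<dots> = B powr p * (1 / M\<^sup>2) powr p" by (rule powr_mult)
      \<comment> \<open>As 1 / M^2 \<le> 1 and p > 1, lowering the exponent to 1 only increases the
        bound and gives both cases the same order.\<close>
      also have "\<dots> \<le> B powr p * (1 / M\<^sup>2) powr 1"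
        using p M2 by (intro mult_left_mono powr_mono') auto
      finally have bp: "\<bar>b\<bar> powr p \<le> B powr p / M\<^sup>2" using M2 by simp
      have "\<bar>A + b\<bar> powr p \<le> (2 * \<bar>b\<bar>) powr p"
        using False pos p by (intro powr_mono2) auto
      then have 1: "\<bar>A + b\<bar> powr p \<le> 2 powr p * \<bar>b\<bar> powr p" by (simp add: powr_mult)
      have "A powr (p - 1) * (- b) \<le> A powr (p - 1) * \<bar>b\<bar>" by (intro mult_left_mono) auto
      also have "\<dots> \<le> \<bar>b\<bar> powr (p - 1) * \<bar>b\<bar>"
        using False pos p by (intro mult_right_mono powr_mono2) auto
      also have "\<dots> = \<bar>b\<bar> powr p" using False pos by (simp add: powr_diff)
      finally have "p * (A powr (p - 1) * (- b)) \<le> p * \<bar>b\<bar> powr p" using p by (intro mult_left_mono) auto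
      with 1 have "\<bar>A + b\<bar> powr p - A powr p - p * A powr (p - 1) * b \<le> (2 powr p + p) * \<bar>b\<bar> powr p"
        using powr_ge_zero[of A p] unfolding distrib_right mult_minus_right mult.assoc by linarith
      also have "\<dots> \<le> (2 powr p + p) * (B powr p / M\<^sup>2)"
        using bp p by (intro mult_left_mono) auto
      finally show ?thesis by (simp add: C2_def)
    qed
    moreover have "C1 / M\<^sup>2 \<le> (C1 + C2) / M\<^sup>2" "C2 / M\<^sup>2 \<le> (C1 + C2) / M\<^sup>2"
      using C M2 by (auto intro!: divide_right_mono)
    ultimately show ?thesis by linarith
  qed
  then show thesis using C by (intro that[of "C1 + C2"]) auto
qed

section \<open>Trial functions and the size of their Hardy difference\<close>

lemma nn_integral_annulus_le:
  assumes "0 < r"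
  shows "(\<integral>\<^sup>+x. ennreal (indicator {x::'a::euclidean_space. r / 2 \<le> norm x \<and> norm x \<le> r} x * norm x powr - real DIM('a)) \<partial>lborel)
    \<le> ennreal (2 ^ DIM('a) * measure lborel (cball (0::'a::euclidean_space) 1))"
proof -
  have "(\<integral>\<^sup>+x. ennreal (indicator {x::'a. r / 2 \<le> norm x \<and> norm x \<le> r} x * norm x powr - real DIM('a)) \<partial>lborel)
      \<le> (\<integral>\<^sup>+x. ennreal (indicator (cball (0::'a) r) x * (r / 2) powr - real DIM('a)) \<partial>lborel)"
    using assms by (intro nn_integral_mono ennreal_leI) (auto simp: indicator_def intro!: powr_mono2')
  also have "\<dots> = ennreal (measure lborel (cball (0::'a) r) * (r / 2) powr - real DIM('a))"
    using assms by (intro nn_integral_indicator_const) auto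
  also have "measure lborel (cball (0::'a) r) * (r / 2) powr - real DIM('a)
      = 2 ^ DIM('a) * measure lborel (cball (0::'a) 1)"
    using assms content_ball_conv_unit_ball[of r "0::'a"]
    by (simp add: content_cball_conv_ball powr_minus powr_realpow power_divide)
  finally show ?thesis .
qed

text \<open>By dilation invariance each dyadic shell has the same bounded mass, so the total grows
  like N, the logarithm of the ratio of the radii. The degenerate case N = 0 is already bounded by a
  full shell, hence \<open>Suc N\<close>.\<close>

lemma nn_integral_dyadic_annulus_le:
  assumes "0 < R"
  shows "(\<integral>\<^sup>+x. ennreal (indicator {x::'a::euclidean_space. R / 2 ^ N \<le> norm x \<and> norm x \<le> R} x * norm x powr - real DIM('a)) \<partial>lborel)
    \<le> ennreal (real (Suc N) * (2 ^ DIM('a) * measure lborel (cball (0::'a::euclidean_space) 1)))"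
proof (induction N)
  case 0
  have "(\<integral>\<^sup>+x. ennreal (indicator {x::'a. R / 2 ^ 0 \<le> norm x \<and> norm x \<le> R} x * norm x powr - real DIM('a)) \<partial>lborel)
    \<le> (\<integral>\<^sup>+x. ennreal (indicator {x::'a. R / 2 \<le> norm x \<and> norm x \<le> R} x * norm x powr - real DIM('a)) \<partial>lborel)"
    using assms by (intro nn_integral_mono ennreal_leI mult_right_mono) (auto simp: indicator_def)
  also note nn_integral_annulus_le[OF assms]
  finally show ?case by simp
next
  case (Suc N)
  let ?f = "\<lambda>a b x::'a. ennreal (indicator {x::'a. a \<le> norm x \<and> norm x \<le> b} x * norm x powr - real DIM('a))"
  let ?c = "2 ^ DIM('a) * measure lborel (cball (0::'a) 1)"
  have meas: "?f a b \<in> borel_measurable lborel" for a b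
  proof -
    have "{x::'a. a \<le> norm x \<and> norm x \<le> b} \<in> sets borel" by measurable
    then show ?thesis by measurable
  qed
  have "(\<integral>\<^sup>+x. ?f (R / 2 ^ Suc N) R x \<partial>lborel)
      \<le> (\<integral>\<^sup>+x. ?f (R / 2 ^ N) R x + ?f (R / 2 ^ N / 2) (R / 2 ^ N) x \<partial>lborel)"
    by (intro nn_integral_mono) (auto simp: indicator_def mult.commute)
  also have "\<dots> = (\<integral>\<^sup>+x. ?f (R / 2 ^ N) R x \<partial>lborel) + (\<integral>\<^sup>+x. ?f (R / 2 ^ N / 2) (R / 2 ^ N) x \<partial>lborel)"
    by (intro nn_integral_add meas)
  also have "\<dots> \<le> ennreal (real (Suc N) * ?c) + ennreal ?c"
    using assms by (intro add_mono Suc.IH nn_integral_annulus_le) auto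
  also have "\<dots> = ennreal (real (Suc (Suc N)) * ?c)"
    by (subst ennreal_plus[symmetric]) (auto simp: algebra_simps)
  finally show ?case .
qed

text \<open>For a multiple of |x|^\<alpha> the increment b is 0 and the density vanishes. In general
  it is the first-order Taylor remainder of |.|^p at A with increment b; all powers of |x| combine
  to |x|^-n because p \<alpha> = p - n.\<close>

lemma (in punctured_C1) gap_density_radial:
  assumes x: "x \<noteq> 0" and A: "0 \<le> A" "\<alpha> * u x = norm x powr \<alpha> * A"
    and grad: "norm (Du x) = norm x powr (\<alpha> - 1) * \<bar>A + b\<bar>" "Du x \<bullet> x = norm x powr \<alpha> * (A + b)"
  shows "gap_density 1 0 x
    = norm x powr - real DIM('a) * (\<bar>A + b\<bar> powr p - A powr p - p * A powr (p - 1) * b)"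
proof -
  define r where "r = norm x"
  have r: "0 < r" using x by (simp add: r_def)
  have n: "real DIM('a) = p - p * \<alpha>" by (simp add: p_\<alpha>)
  have u: "\<alpha> * \<bar>u x\<bar> = r powr \<alpha> * A"
  proof -
    have "\<bar>\<alpha> * u x\<bar> = \<bar>r powr \<alpha> * A\<bar>" using A(2) by (simp add: r_def)
    then show ?thesis using \<alpha>_pos A(1) by (simp add: abs_mult)
  qed
  have up: "\<alpha> powr q * \<bar>u x\<bar> powr q = r powr (\<alpha> * q) * A powr q" for q
    by (simp only: powr_mult[symmetric] u) (simp only: powr_mult powr_powr)
  have sgn: "A powr (p - 1) * sgn (u x) = A powr (p - 1)"
  proof (cases "A = 0")
    case False
    then have "0 < \<alpha> * u x" using A x by simp
    then have "0 < u x" using \<alpha>_pos by (rule zero_less_mult_pos)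
    then show ?thesis by simp
  qed simp
  have 1: "norm (Du x) powr p = r powr - real DIM('a) * \<bar>A + b\<bar> powr p"
    by (simp add: grad(1) powr_mult powr_powr n r_def[symmetric] algebra_simps)
  have 2: "\<alpha> powr p * (\<bar>u x\<bar> powr p / norm x powr p) = r powr - real DIM('a) * A powr p"
  proof -
    have "\<alpha> powr p * (\<bar>u x\<bar> powr p / norm x powr p) = r powr (\<alpha> * p) * r powr - p * A powr p"
      by (simp only: times_divide_eq_right up r_def[symmetric]) (simp add: powr_minus_divide)
    also have "r powr (\<alpha> * p) * r powr - p = r powr - real DIM('a)"
      by (simp add: powr_add[symmetric] n mult.commute)
    finally show ?thesis .
  qed
  have 3: "\<alpha> powr (p - 1) * (r powr - p * dil x) = r powr - real DIM('a) * (p * (A powr (p - 1) * (A + b)))"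
  proof -
    have "\<alpha> powr (p - 1) * (r powr - p * dil x)
        = p * (\<alpha> powr (p - 1) * \<bar>u x\<bar> powr (p - 1)) * sgn (u x) * (r powr - p * r powr \<alpha>) * (A + b)"
      by (simp add: dil_def grad(2) r_def mult_ac)
    also have "\<dots> = p * (A powr (p - 1) * sgn (u x)) * (r powr (\<alpha> * (p - 1)) * (r powr - p * r powr \<alpha>)) * (A + b)"
      by (subst up) (simp only: mult_ac)
    also have "r powr (\<alpha> * (p - 1)) * (r powr - p * r powr \<alpha>) = r powr - real DIM('a)"
      by (simp add: powr_add[symmetric] n algebra_simps)
    finally show ?thesis unfolding sgn by (simp only: mult_ac)
  qed
  have 4: "\<alpha> powr (p - 1) * (r powr - p * (p * \<alpha> * \<bar>u x\<bar> powr p)) = r powr - real DIM('a) * (p * A powr p)"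
  proof -
    have "\<alpha> powr (p - 1) * \<alpha> = \<alpha> powr p" using \<alpha>_pos by (simp add: powr_diff)
    then have "\<alpha> powr (p - 1) * (r powr - p * (p * \<alpha> * \<bar>u x\<bar> powr p)) = p * (\<alpha> powr p * (\<bar>u x\<bar> powr p / norm x powr p))"
      by (simp add: r_def powr_minus_divide mult_ac)
    then show ?thesis unfolding 2 by (simp add: mult_ac)
  qed
  have A1: "A powr (p - 1) * A = A powr p" using A(1) by (cases "A = 0") (simp_all add: powr_diff)
  have "gap_density 1 0 x = norm (Du x) powr p - \<alpha> powr p * (\<bar>u x\<bar> powr p / norm x powr p)
      - (\<alpha> powr (p - 1) * (r powr - p * dil x)
         - \<alpha> powr (p - 1) * (r powr - p * (p * \<alpha> * \<bar>u x\<bar> powr p)))"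
    by (simp add: gap_density_def r_def algebra_simps)
  also have "\<dots> = r powr - real DIM('a)
      * (\<bar>A + b\<bar> powr p - A powr p - p * (A powr (p - 1) * (A + b)) + p * (A powr (p - 1) * A))"
    unfolding 1 2 3 4 A1 by (simp add: algebra_simps)
  finally show ?thesis by (simp add: r_def algebra_simps)
qed

text \<open>The argument of the bump runs from 0 to 1 as |x| runs from R e^-M to R. It is affine in
  log |x| with slope 1 / M, so each derivative along the dilations gains a factor 1 / M.\<close>

definition trial :: "real \<Rightarrow> real \<Rightarrow> real \<Rightarrow> real ^ 'n \<Rightarrow> real" where
  "trial a R M x = norm x powr a * (bump (1 + (ln (norm x) - ln R) / M))\<^sup>2"

lemma trial_eq_0:
  assumes "0 < R" "0 < M" "norm x < R * exp (- M) \<or> R < norm x"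
  shows "trial a R M x = 0"
proof (cases "x = 0")
  case False
  then have x: "0 < norm x" by simp
  have "1 + (ln (norm x) - ln R) / M \<le> 0 \<or> 1 \<le> 1 + (ln (norm x) - ln R) / M"
  proof (cases "R < norm x")
    case True
    then have "ln R \<le> ln (norm x)" using assms(1) x by simp
    then show ?thesis using assms(2) by simp
  next
    case False
    with assms(3) have "ln (norm x) \<le> ln (R * exp (- M))" using x by (intro ln_mono) auto
    then have "ln (norm x) \<le> ln R - M" using assms(1) by (simp add: ln_mult)
    then show ?thesis using assms(2) by (simp add: field_simps)
  qed
  then show ?thesis by (simp add: trial_def bump_eq_0)
qed (simp add: trial_def)

lemma trial_in_test_functions:
  fixes \<Omega> :: "(real ^ 'n) set"
  assumes R: "0 < R" and M: "0 < M" and \<Omega>: "cball 0 R \<subseteq> \<Omega>"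
  shows "trial a R M \<in> test_functions (\<Omega> - {0})"
proof -
  define K where "K = cball (0 :: real ^ 'n) R - ball 0 (R * exp (- M))"
  have K: "compact K" unfolding K_def by (intro compact_diff compact_cball open_ball)
  have "{x. trial a R M x \<noteq> 0} \<subseteq> K"
    using trial_eq_0[OF R M] by (fastforce simp: K_def not_less[symmetric])
  then have cl: "closure {x. trial a R M x \<noteq> 0} \<subseteq> K"
    by (intro closure_minimal compact_imp_closed K)
  define c where "c = 1 - ln R / M"
  define k where "k = 1 / M"
  let ?b = "\<lambda>x::real ^ 'n. flat 0 (c + k * ln (norm x)) * flat 0 ((1 - c) + (- k) * ln (norm x))"
  have smooth: "smooth_off_0 (\<lambda>x::real ^ 'n. norm x powr a * (?b x * ?b x))"
    by (intro smooth_off_0.mult smooth_off_0.flat smooth_off_0.add smooth_off_0.norm_powr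
        smooth_off_0.ln_norm smooth_off_0.const)
  have eq: "trial a R M x = norm x powr a * (?b x * ?b x)" for x
  proof -
    have 1: "1 + (ln (norm x) - ln R) / M = c + k * ln (norm x)"
      by (simp add: c_def k_def diff_divide_distrib)
    have 2: "1 - (c + k * ln (norm x)) = (1 - c) + (- k) * ln (norm x)" by simp
    show ?thesis unfolding trial_def bump_def power2_eq_square 1 2 ..
  qed
  have "Ck j (trial a R M :: real ^ 'n \<Rightarrow> real)" for j :: nat
  proof (rule Ck_of_smooth_off_0[OF smooth eq])
    show "0 < R * exp (- M)" using R by simp
    show "trial a R M x = 0" if "norm x < R * exp (- M)" for x :: "real ^ 'n"
      using trial_eq_0[OF R M] that by blast
  qed
  moreover have "K \<subseteq> \<Omega> - {0}" using \<Omega> R by (auto simp: K_def)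
  moreover have "compact (closure {x :: real ^ 'n. trial a R M x \<noteq> 0})"
    using compact_Int_closed[OF K closed_closure, of "{x. trial a R M x \<noteq> 0}"]
    unfolding Int_absorb1[OF cl] .
  ultimately show ?thesis using cl by (auto simp: test_functions_def)
qed

lemma has_derivative_trial:
  assumes x: "x \<noteq> 0" and R: "0 < R" and M: "0 < M"
    and \<sigma>: "\<sigma> = 1 + (ln (norm x) - ln R) / M"
  shows "(trial a R M has_derivative
    (\<lambda>h. norm x powr (a - 1) * (a * (bump \<sigma>)\<^sup>2 + 2 * bump \<sigma> * bump' \<sigma> / M) * (sgn x \<bullet> h))) (at x)"
proof -
  define r where "r = norm x"
  have r: "0 < r" using x by (simp add: r_def)
  have "((\<lambda>r. 1 + (ln r - ln R) / M) has_real_derivative 1 / r / M) (at r)"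
    using r M by (auto intro!: derivative_eq_intros)
  from DERIV_chain2[OF has_real_derivative_bump this]
  have "((\<lambda>r. bump (1 + (ln r - ln R) / M)) has_real_derivative bump' \<sigma> * (1 / r / M)) (at r)"
    by (simp add: \<sigma> r_def)
  from DERIV_power[OF this, of 2]
  have 1: "((\<lambda>r. (bump (1 + (ln r - ln R) / M))\<^sup>2) has_real_derivative 2 * bump \<sigma> * (bump' \<sigma> * (1 / r / M))) (at r)"
    by (simp add: \<sigma> r_def mult_ac)
  from DERIV_mult[OF has_real_derivative_powr[OF r, of a] 1]
  have "((\<lambda>r. r powr a * (bump (1 + (ln r - ln R) / M))\<^sup>2) has_real_derivative
      r powr (a - 1) * (a * (bump \<sigma>)\<^sup>2 + 2 * bump \<sigma> * bump' \<sigma> / M)) (at r)"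
    by (rule DERIV_cong)
      (use r M in \<open>simp add: \<sigma> r_def[symmetric] powr_diff field_simps\<close>)
  then have "((\<lambda>r. r powr a * (bump (1 + (ln r - ln R) / M))\<^sup>2) has_derivative
      (\<lambda>h. r powr (a - 1) * (a * (bump \<sigma>)\<^sup>2 + 2 * bump \<sigma> * bump' \<sigma> / M) * h)) (at (norm x))"
    by (simp only: has_field_derivative_def r_def)
  from has_derivative_compose[OF has_derivative_norm[OF x] this]
  show ?thesis unfolding trial_def[abs_def] r_def by (simp only: inner_commute)
qed

text \<open>The Taylor remainder is at most C0 / M^2 times |x|^-n, and the support has mass of order
  M for |x|^-n dx, which leaves 1 / M. With M = N log 2 the support is an annulus with radii R / 2^N
  and R, and dyadic shells can be counted.\<close>

lemma hardy_difference_trial_le: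
  assumes p: "real CARD('n::finite) < p"
  obtains C where "0 < C" "\<And>(\<Omega> :: (real ^ 'n) set) R N. \<lbrakk>open \<Omega>; 0 < R; cball 0 R \<subseteq> \<Omega>; 2 \<le> N\<rbrakk>
    \<Longrightarrow> 0 \<le> hardy_difference p \<Omega> (trial (1 - real CARD('n) / p) R (real N * ln 2))
      \<and> hardy_difference p \<Omega> (trial (1 - real CARD('n) / p) R (real N * ln 2)) \<le> C / real N"
proof -
  define a where "a = 1 - real CARD('n) / p"
  define W where "W = 2 ^ CARD('n) * measure lborel (cball (0 :: real ^ 'n) 1)"
  have W: "0 < W" unfolding W_def by (intro mult_pos_pos content_cball_pos) auto
  have p1: "1 < p" using p zero_less_card_finite[where 'a='n] by linarith
  have a: "0 < a" using p p1 by (simp add: a_def)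
  obtain c where c: "0 < c" "\<And>s. \<bar>bump' s\<bar> \<le> c" using bump'_bounded by blast
  obtain C0 where C0: "0 < C0" "\<And>\<theta> \<theta>' M A b. \<lbrakk>0 \<le> \<theta>; \<theta> \<le> 1; \<bar>\<theta>'\<bar> \<le> c; 1 \<le> M; A = a * \<theta>\<^sup>2; b = 2 * \<theta> * \<theta>' / M\<rbrakk>
    \<Longrightarrow> \<bar>A + b\<bar> powr p - A powr p - p * A powr (p - 1) * b \<le> C0 / M\<^sup>2"
    using trial_energy_le[OF p1 a c(1)] by blast
  define C where "C = 2 * C0 * W / (ln 2)\<^sup>2"
  have C: "0 < C" using C0(1) W by (simp add: C_def)
  have "0 \<le> hardy_difference p \<Omega> (trial a R (real N * ln 2))
      \<and> hardy_difference p \<Omega> (trial a R (real N * ln 2)) \<le> C / real N"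
    if op: "open \<Omega>" and R: "0 < R" and \<Omega>: "cball 0 R \<subseteq> \<Omega>" and N: "2 \<le> N"
    for \<Omega> :: "(real ^ 'n) set" and R N
  proof -
    define M where "M = real N * ln 2"
    have "2 * ln 2 \<le> M" unfolding M_def using N by (intro mult_right_mono) auto
    then have M: "1 \<le> M" using ln2_ge_two_thirds by linarith
    then have M0: "0 < M" by simp
    have exp_M: "R * exp (- M) = R / 2 ^ N"
      by (simp add: M_def exp_minus exp_of_nat_mult divide_inverse)
    define u :: "real ^ 'n \<Rightarrow> real" where "u = trial a R M"
    have u: "u \<in> test_functions (\<Omega> - {0})"
      unfolding u_def by (intro trial_in_test_functions R M0 \<Omega>)
    obtain K where K: "punctured_C1 p u (grad u) K"
        "hardy_difference p \<Omega> u = punctured_C1.hardy_gap p u (grad u)"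
      using punctured_C1_test_function[OF p u op] by blast
    interpret punctured_C1 p u "grad u" K by (rule K)
    have \<alpha>: "\<alpha> = a" by (simp add: \<alpha>_def a_def)
    define S where "S = {x :: real ^ 'n. R / 2 ^ N \<le> norm x \<and> norm x \<le> R}"
    have [measurable]: "S \<in> sets borel" unfolding S_def by measurable
    have le: "gap_density 1 0 x \<le> C0 / M\<^sup>2 * (indicator S x * norm x powr - real CARD('n))" for x
    proof (cases "x \<in> S")
      case True
      have "0 < R / 2 ^ N" using R by simp
      then have x: "x \<noteq> 0" using True by (auto simp: S_def)
      define \<sigma> where "\<sigma> = 1 + (ln (norm x) - ln R) / M"
      define A where "A = a * (bump \<sigma>)\<^sup>2"
      define b where "b = 2 * bump \<sigma> * bump' \<sigma> / M"
      have "(u has_derivative (\<lambda>h. norm x powr (a - 1) * (A + b) * (sgn x \<bullet> h))) (at x)"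
        unfolding u_def A_def b_def by (rule has_derivative_trial[OF x R M0 \<sigma>_def])
      from has_derivative_unique[OF der_u this]
      have "grad u x \<bullet> h = (norm x powr (a - 1) * (A + b)) *\<^sub>R sgn x \<bullet> h" for h
        by (simp add: fun_eq_iff)
      then have g: "grad u x = (norm x powr (a - 1) * (A + b)) *\<^sub>R sgn x"
        by (rule vector_eq_rdot[THEN iffD1, OF allI])
      have "norm (grad u x) = norm x powr (\<alpha> - 1) * \<bar>A + b\<bar>"
        unfolding g \<alpha> using x by (simp add: norm_sgn abs_mult)
      moreover have "grad u x \<bullet> x = norm x powr \<alpha> * (A + b)"
        unfolding g \<alpha> using x
        by (simp add: sgn_div_norm powr_diff dot_square_norm power2_eq_square)
      moreover have "\<alpha> * u x = norm x powr \<alpha> * A"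
        by (simp add: \<alpha> u_def trial_def A_def \<sigma>_def)
      moreover have "0 \<le> A" using a by (simp add: A_def)
      ultimately have "gap_density 1 0 x
          = norm x powr - real CARD('n) * (\<bar>A + b\<bar> powr p - A powr p - p * A powr (p - 1) * b)"
        using gap_density_radial[OF x] by simp
      also have "\<dots> \<le> norm x powr - real CARD('n) * (C0 / M\<^sup>2)"
        by (intro mult_left_mono C0(2)[OF bump_bounds c(2) M A_def b_def]) simp
      finally show ?thesis using True by (simp add: mult.commute)
    next
      case False
      then have *: "norm x < R * exp (- M) \<or> R < norm x" by (auto simp: S_def exp_M)
      have "open ({x. norm x < R * exp (- M)} \<union> {x :: real ^ 'n. R < norm x})"
        by (intro open_Un open_Collect_less continuous_intros)
      then have "(u has_derivative (\<lambda>_. 0)) (at x)"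
        using has_derivative_transform_within_open[of "\<lambda>_. 0::real" "\<lambda>_. 0" x UNIV _ u] * trial_eq_0[OF R M0]
        by (auto simp: u_def)
      from fun_cong[OF has_derivative_unique[OF der_u this], of "grad u x"] have "grad u x = 0" by simp
      moreover have "u x = 0" unfolding u_def by (rule trial_eq_0[OF R M0 *])
      ultimately have "gap_density 1 0 x = 0" using p_gt_1 by (simp add: gap_density_def dil_def)
      then show ?thesis using False by simp
    qed
    have "ennreal hardy_gap = (\<integral>\<^sup>+x. ennreal (gap_density 1 0 x) \<partial>lborel)"
      unfolding hardy_gap_eq_0
      by (rule nn_integral_eq_integral[OF integrable_gap_density_0 AE_I2[OF gap_density_0_nonneg], symmetric])
    also have "\<dots> \<le> (\<integral>\<^sup>+x. ennreal (C0 / M\<^sup>2) * ennreal (indicator S x * norm x powr - real CARD('n)) \<partial>lborel)"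
    proof (rule nn_integral_mono)
      show "ennreal (gap_density 1 0 x)
          \<le> ennreal (C0 / M\<^sup>2) * ennreal (indicator S x * norm x powr - real CARD('n))" for x
        using ennreal_leI[OF le[of x]] C0(1) by (subst ennreal_mult[symmetric]) auto
    qed
    also have "\<dots> = ennreal (C0 / M\<^sup>2) * (\<integral>\<^sup>+x. ennreal (indicator S x * norm x powr - real CARD('n)) \<partial>lborel)"
      by (intro nn_integral_cmult) measurable
    also have "\<dots> \<le> ennreal (C0 / M\<^sup>2) * ennreal (real (Suc N) * W)"
      using nn_integral_dyadic_annulus_le[OF R, where 'a="real ^ 'n", of N]
      by (intro mult_left_mono) (auto simp: S_def W_def)
    also have "\<dots> = ennreal (C0 / M\<^sup>2 * (real (Suc N) * W))"
      using C0(1) W by (intro ennreal_mult[symmetric]) auto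
    finally have "hardy_gap \<le> C0 / M\<^sup>2 * (real (Suc N) * W)"
      using C0(1) W by (subst (asm) ennreal_le_iff) auto
    also have "\<dots> \<le> C0 / M\<^sup>2 * ((2 * real N) * W)"
      using C0(1) W N by (intro mult_left_mono mult_right_mono) auto
    also have "\<dots> = C / real N"
      using N by (simp add: C_def M_def power_mult_distrib power2_eq_square mult_ac)
    finally show ?thesis
      using hardy_gap_nonneg K(2) by (simp add: u_def M_def)
  qed
  with C that show thesis unfolding a_def by blast
qed

text \<open>The trial function vanishes at the origin, and at radius R e^(-M/2) the argument of the
  bump is 1/2. Between these points |x|^a cancels exactly and the quotient equals t l^-q with l = l0
  + M / 2. The right side is of order N^(-1/p) and l grows like N, so l^(1/p - q) would stay
  bounded. The constant B enters only through the additive term l0.\<close>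

theorem log_power_optimal:
  fixes p q :: real and \<Omega> :: "(real ^ 'n::finite) set"
  assumes p: "real CARD('n) < p" and \<Omega>: "bounded_domain \<Omega>" "0 \<in> \<Omega>" and q: "q < 1 / p"
  shows "\<not> (\<exists>B C. 1 \<le> B \<and> 0 < C \<and>
    (\<forall>u \<in> test_functions (\<Omega> - {0}). hardy_morrey_ineq p q B C \<Omega> u))"
proof
  assume "\<exists>B C. 1 \<le> B \<and> 0 < C \<and>
    (\<forall>u \<in> test_functions (\<Omega> - {0}). hardy_morrey_ineq p q B C \<Omega> u)"
  then obtain B C where BC: "1 \<le> B" "0 < C"
    "\<And>u. u \<in> test_functions (\<Omega> - {0}) \<Longrightarrow> hardy_morrey_ineq p q B C \<Omega> u" by blast
  define a where "a = 1 - real CARD('n) / p"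
  have p1: "1 < p" using p zero_less_card_finite[where 'a='n] by linarith
  have op: "open \<Omega>" and bd: "bounded \<Omega>" using \<Omega> by (auto simp: bounded_domain_def)
  obtain R where R: "0 < R" "cball 0 R \<subseteq> \<Omega>"
    using op \<Omega>(2) open_contains_cball by blast
  obtain G where G: "0 < G" "\<And>N. 2 \<le> N \<Longrightarrow> 0 \<le> hardy_difference p \<Omega> (trial a R (real N * ln 2))
      \<and> hardy_difference p \<Omega> (trial a R (real N * ln 2)) \<le> G / real N"
    using hardy_difference_trial_le[OF p] op R unfolding a_def by metis
  obtain e :: "real ^ 'n" where e: "norm e = 1" using vector_choose_size[of 1] by auto
  define D where "D = B * diameter \<Omega>"
  have "R *\<^sub>R e \<in> \<Omega>" using R e by (auto simp: subset_iff)
  from diameter_bounded_bound[OF bd this \<Omega>(2)] have "R \<le> diameter \<Omega>" using R e by simp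
  moreover have "1 * diameter \<Omega> \<le> D" unfolding D_def using BC(1) R calculation by (intro mult_right_mono) auto
  ultimately have D: "R \<le> D" "0 < D" using R by auto
  define l0 where "l0 = 1 + ln (D / R)"
  have l0: "1 \<le> l0" using D R by (simp add: l0_def)
  define \<delta> where "\<delta> = 1 / p - q"
  define t where "t = (bump (1 / 2))\<^sup>2"
  have \<delta>: "0 < \<delta>" using q by (simp add: \<delta>_def)
  have t: "0 < t" using bump_half_pos by (simp add: t_def)
  define H where "H = C * (G * (l0 + 1)) powr (1 / p) / t"
  have bound: "(l0 + real N * ln 2 / 2) powr \<delta> \<le> H" if N: "2 \<le> N" for N
  proof -
    define M where "M = real N * ln 2"
    define l where "l = l0 + M / 2"
    have M0: "0 < M" using N by (simp add: M_def)
    have l: "0 < l" using l0 M0 by (simp add: l_def)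
    define u :: "real ^ 'n \<Rightarrow> real" where "u = trial a R M"
    define s where "s = R * exp (- (M / 2))"
    define x where "x = s *\<^sub>R e"
    have s: "0 < s" "s \<le> R" using R M0 by (auto simp: s_def mult_le_cancel_left1)
    have nx: "norm x = s" using s e by (simp add: x_def)
    have x: "x \<in> \<Omega>" "x \<noteq> 0" using R s nx by (auto simp: subset_iff)
    have ln_s: "ln s = ln R - M / 2" using R by (simp add: s_def ln_mult)
    have half: "1 + (ln s - ln R) / M = 1 / 2" using M0 by (simp add: ln_s)
    have ux: "u x = s powr a * t" unfolding u_def trial_def nx t_def half ..
    have "u 0 = 0" by (simp add: u_def trial_def)
    have u_test: "u \<in> test_functions (\<Omega> - {0})"
      unfolding u_def by (intro trial_in_test_functions R M0)
    \<comment> \<open>l \<le> (l0 + 1) N converts 1 / N into 1 / l, so that both sides become powers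
      of the same quantity.\<close>
    have GN: "G / real N \<le> G * (l0 + 1) / l"
    proof -
      have "M / 2 \<le> real N * 1" unfolding M_def using ln_2_less_1 N by (simp add: field_simps)
      moreover have "l0 * 1 \<le> l0 * real N" using l0 N by (intro mult_left_mono) auto
      ultimately have "l \<le> (l0 + 1) * real N" by (simp add: l_def algebra_simps)
      then have "G * l / (l * real N) \<le> G * ((l0 + 1) * real N) / (l * real N)"
        using G(1) l N by (intro divide_right_mono mult_left_mono) auto
      then show ?thesis using l N by simp
    qed
    from BC(3)[OF u_test] have sup: "weighted_holder_sup p q D \<Omega> u \<le> ereal (C * hardy_difference p \<Omega> u powr (1 / p))"
      by (simp add: hardy_morrey_ineq_def D_def)
    have "ereal (\<bar>u x - u 0\<bar> / norm (x - 0) powr a * X (norm (x - 0) / D) powr q) \<le> weighted_holder_sup p q D \<Omega> u"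
      unfolding weighted_holder_sup_def a_def
      by (rule SUP_upper2[of "(x, 0)"]) (use x \<Omega>(2) in auto)
    from order_trans[OF this sup]
    have "\<bar>u x - u 0\<bar> / norm (x - 0) powr a * X (norm (x - 0) / D) powr q \<le> C * hardy_difference p \<Omega> u powr (1 / p)"
      by simp
    moreover have "\<bar>u x - u 0\<bar> / norm (x - 0) powr a = t"
      using s t by (simp add: ux \<open>u 0 = 0\<close> nx)
    moreover have "X (norm (x - 0) / D) = inverse l"
      using s D R by (simp add: X_def nx ln_div ln_s l_def l0_def)
    ultimately have "t * inverse l powr q \<le> C * hardy_difference p \<Omega> u powr (1 / p)"
      by (simp only:)
    also have "\<dots> \<le> C * (G / real N) powr (1 / p)"
      using G(2)[OF N] BC(2) p1 unfolding u_def M_def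
      by (intro mult_left_mono powr_mono2) auto
    also have "\<dots> \<le> C * (G * (l0 + 1) / l) powr (1 / p)"
      using BC(2) G(1) p1 GN by (intro mult_left_mono powr_mono2) auto
    also have "\<dots> = t * H * inverse l powr (1 / p)"
      using t by (simp add: H_def powr_mult divide_inverse)
    finally have "inverse l powr q \<le> H * inverse l powr (1 / p)" using t by simp
    then have "l powr (1 / p) * inverse l powr q \<le> l powr (1 / p) * (H * inverse l powr (1 / p))"
      by (intro mult_left_mono) auto
    moreover have "inverse l powr s = l powr (- s)" for s using l by (simp add: powr_minus inverse_powr)
    ultimately have "l powr (1 / p) * l powr (- q) \<le> H * (l powr (1 / p) * l powr (- (1 / p)))"
      by (simp add: mult_ac)
    then have "l powr \<delta> \<le> H" using l by (simp add: powr_add[symmetric] \<delta>_def)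
    then show ?thesis by (simp add: l_def M_def)
  qed
  have H: "0 < H" using BC(2) G(1) l0 t by (auto simp: H_def)
  \<comment> \<open>This choice gives l^\<delta> \<ge> H + 1 against the bound H; the summand 2
    makes N admissible in \<open>bound\<close>.\<close>
  obtain N :: nat where N: "2 * (H + 1) powr (1 / \<delta>) / ln 2 + 2 \<le> real N"
    using real_arch_simple by blast
  have N2: "2 \<le> N"
  proof -
    have "0 \<le> 2 * (H + 1) powr (1 / \<delta>) / ln 2" by simp
    with N have "2 \<le> real N" by linarith
    then show ?thesis by simp
  qed
  have "2 * (H + 1) powr (1 / \<delta>) / ln 2 \<le> real N" using N by simp
  then have "(H + 1) powr (1 / \<delta>) \<le> l0 + real N * ln 2 / 2" using l0 by (simp add: field_simps)
  then have "((H + 1) powr (1 / \<delta>)) powr \<delta> \<le> (l0 + real N * ln 2 / 2) powr \<delta>"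
    using \<delta> by (intro powr_mono2) auto
  also have "\<dots> \<le> H" by (rule bound[OF N2])
  finally show False using \<delta> H by (simp add: powr_powr)
qed

theorem mainTheorem7:
  fixes p :: real
  assumes "real CARD('n::finite) < p"
  shows "(\<exists>B C. 1 \<le> B \<and> 0 < C \<and>
            (\<forall>\<Omega> :: (real ^ 'n) set. bounded_domain \<Omega> \<longrightarrow> 0 \<in> \<Omega> \<longrightarrow>
               (\<forall>u \<in> test_functions (\<Omega> - {0}). hardy_morrey_ineq p (1 / p) B C \<Omega> u)))
       \<and> (\<forall>\<Omega> :: (real ^ 'n) set. bounded_domain \<Omega> \<longrightarrow> 0 \<in> \<Omega> \<longrightarrow>
            (\<forall>q < 1 / p. \<not> (\<exists>B C. 1 \<le> B \<and> 0 < C \<and>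
               (\<forall>u \<in> test_functions (\<Omega> - {0}). hardy_morrey_ineq p q B C \<Omega> u))))"
proof (intro conjI allI impI)
  show "\<exists>B C. 1 \<le> B \<and> 0 < C \<and>
            (\<forall>\<Omega> :: (real ^ 'n) set. bounded_domain \<Omega> \<longrightarrow> 0 \<in> \<Omega> \<longrightarrow>
               (\<forall>u \<in> test_functions (\<Omega> - {0}). hardy_morrey_ineq p (1 / p) B C \<Omega> u))"
    by (rule hardy_morrey_holds[OF assms])
qed (rule log_power_optimal[OF assms])

end
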